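(* Any division grading, by an abelian group, on a simple finite-dimensional real associative algebra, whose (nonzero) homogeneous components have dimension $1$, is equivalent to one, and only one, of the graded tensor products (over $\mathbb{R}$) of the following list, where the factors $M_2(\mathbb{R})$, $\mathbb{H}$, $\mathbb{C}$ and $M_2(\mathbb{C})$ carry the standard gradings described in the context. (1-a) $M_n(\mathbb{R})\cong M_2(\mathbb{R})\otimes\dots\otimes M_2(\mathbb{R})$ ($m$ factors), $n=2^m\geq 1$, with grading group $(\mathbb{Z}_2^2)^m\cong\mathbb{Z}_2^{2m}$. (1-b) $M_{n/2}(\mathbb{H})\cong M_2(\mathbb{R})\otimes\dots\otimes M_2(\mathbb{R})\otimes\mathbb{H}$ ($m-1$ factors $M_2(\mathbb{R})$), $n=2^m\geq 2$, with grading group $(\mathbb{Z}_2^2)^m\cong\mathbb{Z}_2^{2m}$. (1-c) $M_n(\mathbb{C})\cong M_2(\mathbb{R})\otimes\dots\otimes M_2(\mathbb{R})\otimes\mathbb{C}$ ($m$ factors $M_2(\mathbb{R})$), $n=2^m\geq 1$, with grading group $(\mathbb{Z}_2^2)^m\times\mathbb{Z}_2\cong\mathbb{Z}_2^{2m+1}$. (1-d) $M_n(\mathbb{C})\cong M_2(\mathbb{R})\otimes\dots\otimes M_2(\mathbb{R})\otimes M_2(\mathbb{C})$ ($m-1$ factors $M_2(\mathbb{R})$), $n=2^m\geq 2$, with grading group $(\mathbb{Z}_2^2)^{m-1}\times(\mathbb{Z}_2\times\mathbb{Z}_4)\cong\mathbb{Z}_2^{2m-1}\times\mathbb{Z}_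4$.
   Context: A grading on an algebra $\mathcal{D}$ by a group $G$ is a vector space decomposition $\mathcal{D}=\bigoplus_{g\in G}\mathcal{D}_g$ with $\mathcal{D}_g\mathcal{D}_h\subseteq\mathcal{D}_{gh}$ for all $g,h\in G$. The support is the set of $g$ with $\mathcal{D}_g\neq0$. A grading on a unital associative algebra is a division grading if every nonzero homogeneous element is invertible. Two graded algebras $\mathcal{D}=\bigoplus_{g\in G}\mathcal{D}_g$ and $\mathcal{E}=\bigoplus_{h\in H}\mathcal{E}_h$ are equivalent if there is an algebra isomorphism $\psi:\mathcal{D}\to\mathcal{E}$ such that for every $g$ in the support of $\mathcal{D}$ there is $h\in H$ with $\psi(\mathcal{D}_g)=\mathcal{E}_h$. The graded tensor product of a $G$-graded algebra $\mathcal{D}$ and an $H$-graded algebra $\mathcal{E}$ is $\mathcal{D}\otimes\mathcal{E}$ with the $G\times H$-grading whose component of degree $(g,h)$ is $\mathcal{D}_g\otimes\mathcal{E}_h$. An empty tensor product is $\mathbb{R}$ with the trivial grading. Standard gradings of the factors: - $M_2(\mathbb{R})$ is graded by $\mathbb{Z}_2^2=\langle a,b\mid a^2=e=b^2,\ ab=ba\rangle$, with components of degrees $e,a,b,ab$ spanned over $\mathbb{R}$ respectively by $\begin{pmatrix}1&0\\0&1\end{pmatrix},\begin{pmatrix}-1&0\\0&1\end{pmatrix},\begin{pmatrix}0&1\\1&0\end{pmatrix},\begin{pmatrix}0&-1\\1&0\end{pmatrix}$. - $\mathbb{H}=\mathbb{R}1\oplus\mathbb{R}i\oplus\mathbb{R}j\oplus\mathbb{R}k$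 is graded by $\mathbb{Z}_2^2$ with degrees $e,a,b,ab$ respectively. - $\mathbb{C}=\mathbb{R}1\oplus\mathbb{R}i$ is graded by $\mathbb{Z}_2=\langle a\mid a^2=e\rangle$ with degrees $e,a$ respectively. - $M_2(\mathbb{C})$ (as a real algebra) is graded by $\mathbb{Z}_2\times\mathbb{Z}_4=\langle a,b\mid a^2=e=b^4,\ ab=ba\rangle$, with components of degrees $e,a,b,ab,b^2,ab^2,b^3,ab^3$ spanned over $\mathbb{R}$ respectively by $\begin{pmatrix}1&0\\0&1\end{pmatrix}$, $\begin{pmatrix}0&1\\1&0\end{pmatrix}$, $\begin{pmatrix}1+i&0\\0&-1-i\end{pmatrix}$, $\begin{pmatrix}0&-1-i\\1+i&0\end{pmatrix}$, $\begin{pmatrix}i&0\\0&i\end{pmatrix}$, $\begin{pmatrix}0&i\\i&0\end{pmatrix}$, $\begin{pmatrix}-1+i&0\\0&1-i\end{pmatrix}$, $\begin{pmatrix}0&1-i\\-1+i&0\end{pmatrix}$. *)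

theory Defs
  imports
    "HOL-Analysis.Analysis"
    "HOL-Algebra.Product_Groups"
    "HOL-Library.Function_Algebras"
begin

section \<open>Real algebras\<close>

instantiation "fun" :: (type, real_vector) real_vector
begin

definition scaleR_fun :: "real \<Rightarrow> ('a \<Rightarrow> 'b) \<Rightarrow> 'a \<Rightarrow> 'b"
  where "scaleR_fun c f = (\<lambda>x. c *\<^sub>R f x)"

instance
  by standard (auto simp: scaleR_fun_def fun_eq_iff scaleR_add_right scaleR_add_left)

end

lemma scaleR_fun_apply [simp]: "(c *\<^sub>R f) x = c *\<^sub>R f x"
  by (simp add: scaleR_fun_def)

definition linear_on :: "'a::real_vector set \<Rightarrow> ('a \<Rightarrow> 'b::real_vector) \<Rightarrow> bool"
  where "linear_on V f \<longleftrightarrow>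
    (\<forall>x\<in>V. \<forall>y\<in>V. f (x + y) = f x + f y) \<and> (\<forall>c. \<forall>x\<in>V. f (c *\<^sub>R x) = c *\<^sub>R f x)"

text \<open>A unital associative real algebra is a multiplicative monoid whose carrier is a linear
  subspace of an ambient real vector space; the vector space operations are the ambient ones.
  The subspace is part of the data because the dimension of the algebras below depends on a
  natural number.\<close>

definition real_algebra :: "('a::real_vector, 'x) monoid_scheme \<Rightarrow> bool"
  where "real_algebra A \<longleftrightarrow> Group.monoid A \<and> subspace (carrier A) \<and>
    (\<forall>a\<in>carrier A. linear_on (carrier A) (\<lambda>x. a \<otimes>\<^bsub>A\<^esub> x) \<and> linear_on (carrier A) (\<lambda>x. x \<otimes>\<^bsub>A\<^esub> a))"

definition finite_dim_algebra :: "('a::real_vector, 'x) monoid_scheme \<Rightarrow> bool"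
  where "finite_dim_algebra A \<longleftrightarrow> (\<exists>B. finite B \<and> span B = carrier A)"

definition two_sided_ideal :: "'a::real_vector set \<Rightarrow> ('a, 'x) monoid_scheme \<Rightarrow> bool"
  where "two_sided_ideal I A \<longleftrightarrow> subspace I \<and> I \<subseteq> carrier A \<and>
    (\<forall>a\<in>carrier A. \<forall>x\<in>I. a \<otimes>\<^bsub>A\<^esub> x \<in> I \<and> x \<otimes>\<^bsub>A\<^esub> a \<in> I)"

definition simple_algebra :: "('a::real_vector, 'x) monoid_scheme \<Rightarrow> bool"
  where "simple_algebra A \<longleftrightarrow> carrier A \<noteq> {0} \<and>
    (\<forall>I. two_sided_ideal I A \<longrightarrow> I = {0} \<or> I = carrier A)"

definition algebra_iso ::
    "('a::real_vector, 'x) monoid_scheme \<Rightarrow> ('b::real_vector, 'y) monoid_scheme \<Rightarrow> ('a \<Rightarrow> 'b) set"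
  where "algebra_iso A B = {\<psi>. bij_betw \<psi> (carrier A) (carrier B) \<and> linear_on (carrier A) \<psi> \<and>
    (\<forall>x\<in>carrier A. \<forall>y\<in>carrier A. \<psi> (x \<otimes>\<^bsub>A\<^esub> y) = \<psi> x \<otimes>\<^bsub>B\<^esub> \<psi> y) \<and> \<psi> \<one>\<^bsub>A\<^esub> = \<one>\<^bsub>B\<^esub>}"

definition algebras_isomorphic ::
    "('a::real_vector, 'x) monoid_scheme \<Rightarrow> ('b::real_vector, 'y) monoid_scheme \<Rightarrow> bool"
  where "algebras_isomorphic A B \<longleftrightarrow> algebra_iso A B \<noteq> {}"


section \<open>Graded algebras\<close>

record ('a, 'g) graded_algebra = "'a monoid" +
  grading_group :: "'g monoid"
  component :: "'g \<Rightarrow> 'a set"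

text \<open>The condition with the unique finitely supported family \<open>f\<close> says that the carrier is the
  direct sum of the components.\<close>

definition is_graded_algebra :: "('a::real_vector, 'g) graded_algebra \<Rightarrow> bool"
  where "is_graded_algebra X \<longleftrightarrow>
    real_algebra X \<and> group (grading_group X) \<and>
    (\<forall>g\<in>carrier (grading_group X). subspace (component X g) \<and> component X g \<subseteq> carrier X) \<and>
    (\<forall>x\<in>carrier X. \<exists>!f. (\<forall>g\<in>carrier (grading_group X). f g \<in> component X g) \<and>
        (\<forall>g. g \<notin> carrier (grading_group X) \<longrightarrow> f g = 0) \<and>
        finite {g. f g \<noteq> 0} \<and> x = (\<Sum>g | f g \<noteq> 0. f g)) \<and>
    (\<forall>g\<in>carrier (grading_group X). \<forall>h\<in>carrier (grading_group X).
        \<forall>x\<in>component X g. \<forall>y\<in>component X h.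
          x \<otimes>\<^bsub>X\<^esub> y \<in> component X (g \<otimes>\<^bsub>grading_group X\<^esub> h))"

definition support :: "('a::real_vector, 'g) graded_algebra \<Rightarrow> 'g set"
  where "support X = {g \<in> carrier (grading_group X). component X g \<noteq> {0}}"

definition division_grading :: "('a::real_vector, 'g) graded_algebra \<Rightarrow> bool"
  where "division_grading X \<longleftrightarrow> is_graded_algebra X \<and>
    (\<forall>g\<in>carrier (grading_group X). \<forall>x\<in>component X g. x \<noteq> 0 \<longrightarrow> x \<in> Units X)"

definition graded_equivalent ::
    "('a::real_vector, 'g) graded_algebra \<Rightarrow> ('b::real_vector, 'h) graded_algebra \<Rightarrow> bool"
  where "graded_equivalent X Y \<longleftrightarrow>
    (\<exists>\<psi>\<in>algebra_iso X Y. \<forall>g\<in>support X. \<exists>h\<in>carrier (grading_group Y). \<psi> ` component X g = component Y h)"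


section \<open>Graded tensor products\<close>

text \<open>The tensor product \<open>A \<otimes> B\<close> is realised as the space of functionals on the bilinear forms
  on \<open>A \<times> B\<close> spanned by the evaluations \<open>x \<otimes> y = (f \<mapsto> f x y)\<close>. Over a field, this is the usual
  tensor product, as bilinear forms separate the points of \<open>A \<otimes> B\<close>. A form is a function
  on the ambient types, of which only the values on the carriers matter; functionals are \<open>0\<close>
  outside the set of forms, so that equality of tensors is equality of functions.\<close>

definition bilinear_forms ::
    "('a::real_vector, 'x) monoid_scheme \<Rightarrow> ('b::real_vector, 'y) monoid_scheme \<Rightarrow> ('a \<Rightarrow> 'b \<Rightarrow> real) set"
  where "bilinear_forms A B = {f.
    (\<forall>x\<in>carrier A. linear_on (carrier B) (\<lambda>y. f x y)) \<and>
    (\<forall>y\<in>carrier B. linear_on (carrier A) (\<lambda>x. f x y))}"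

definition pure_tensor ::
    "('a::real_vector, 'x) monoid_scheme \<Rightarrow> ('b::real_vector, 'y) monoid_scheme \<Rightarrow>
      'a \<Rightarrow> 'b \<Rightarrow> ('a \<Rightarrow> 'b \<Rightarrow> real) \<Rightarrow> real"
  where "pure_tensor A B x y = (\<lambda>f. if f \<in> bilinear_forms A B then f x y else 0)"

text \<open>The bilinear extension of \<open>(x \<otimes> y) (x' \<otimes> y') = x x' \<otimes> y y'\<close>, see \<open>tensor_mult_pure\<close> below; similarly \<open>power_mult_pure\<close>.\<close>

definition tensor_mult ::
    "('a::real_vector, 'x) monoid_scheme \<Rightarrow> ('b::real_vector, 'y) monoid_scheme \<Rightarrow>
      (('a \<Rightarrow> 'b \<Rightarrow> real) \<Rightarrow> real) \<Rightarrow> (('a \<Rightarrow> 'b \<Rightarrow> real) \<Rightarrow> real) \<Rightarrow> ('a \<Rightarrow> 'b \<Rightarrow> real) \<Rightarrow> real"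
  where "tensor_mult A B s t = (\<lambda>f. if f \<in> bilinear_forms A B
    then s (\<lambda>x y. t (\<lambda>x' y'. f (x \<otimes>\<^bsub>A\<^esub> x') (y \<otimes>\<^bsub>B\<^esub> y'))) else 0)"

definition graded_tensor ::
    "('a::real_vector, 'g) graded_algebra \<Rightarrow> ('b::real_vector, 'h) graded_algebra \<Rightarrow>
      (('a \<Rightarrow> 'b \<Rightarrow> real) \<Rightarrow> real, 'g \<times> 'h) graded_algebra"
  where "graded_tensor X Y =
    \<lparr>carrier = span {pure_tensor X Y x y | x y. x \<in> carrier X \<and> y \<in> carrier Y},
     monoid.mult = tensor_mult X Y,
     one = pure_tensor X Y \<one>\<^bsub>X\<^esub> \<one>\<^bsub>Y\<^esub>,
     grading_group = grading_group X \<times>\<times> grading_group Y,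
     component = (\<lambda>(g, h). span {pure_tensor X Y x y | x y. x \<in> component X g \<and> y \<in> component Y h})\<rparr>"

text \<open>The \<open>m\<close>-fold tensor power, in the same way, from \<open>m\<close>-linear forms. A binary product would
  not do here, since the type of its iterations depends on \<open>m\<close>. For \<open>m = 0\<close> a form
  is an arbitrary function on the singleton of the empty tuple, so the power is \<open>\<real>\<close>.\<close>

definition multilinear_forms ::
    "nat \<Rightarrow> ('a::real_vector, 'x) monoid_scheme \<Rightarrow> ((nat \<Rightarrow> 'a) \<Rightarrow> real) set"
  where "multilinear_forms m A = {f.
    \<forall>v \<in> {..<m} \<rightarrow>\<^sub>E carrier A. \<forall>i<m. linear_on (carrier A) (\<lambda>x. f (v(i := x)))}"

definition pure_power ::
    "nat \<Rightarrow> ('a::real_vector, 'x) monoid_scheme \<Rightarrow> (nat \<Rightarrow> 'a) \<Rightarrow> ((nat \<Rightarrow> 'a) \<Rightarrow> real) \<Rightarrow> real"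
  where "pure_power m A v = (\<lambda>f. if f \<in> multilinear_forms m A then f v else 0)"

definition power_mult ::
    "nat \<Rightarrow> ('a::real_vector, 'x) monoid_scheme \<Rightarrow>
      (((nat \<Rightarrow> 'a) \<Rightarrow> real) \<Rightarrow> real) \<Rightarrow> (((nat \<Rightarrow> 'a) \<Rightarrow> real) \<Rightarrow> real) \<Rightarrow> ((nat \<Rightarrow> 'a) \<Rightarrow> real) \<Rightarrow> real"
  where "power_mult m A s t = (\<lambda>f. if f \<in> multilinear_forms m A
    then s (\<lambda>v. t (\<lambda>w. f (\<lambda>i\<in>{..<m}. v i \<otimes>\<^bsub>A\<^esub> w i))) else 0)"

definition graded_tensor_power ::
    "nat \<Rightarrow> ('a::real_vector, 'g) graded_algebra \<Rightarrow>
      (((nat \<Rightarrow> 'a) \<Rightarrow> real) \<Rightarrow> real, nat \<Rightarrow> 'g) graded_algebra"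
  where "graded_tensor_power m X =
    \<lparr>carrier = span (pure_power m X ` ({..<m} \<rightarrow>\<^sub>E carrier X)),
     monoid.mult = power_mult m X,
     one = pure_power m X (\<lambda>i\<in>{..<m}. \<one>\<^bsub>X\<^esub>),
     grading_group = product_group {..<m} (\<lambda>_. grading_group X),
     component = (\<lambda>d. span (pure_power m X ` (\<Pi>\<^sub>E i\<in>{..<m}. component X (d i))))\<rparr>"

lemma linear_on_cong:
  assumes "\<And>x. x \<in> V \<Longrightarrow> f x = g x" "subspace V"
  shows "linear_on V f \<longleftrightarrow> linear_on V g"
  using assms by (auto simp: linear_on_def subspace_add subspace_scale)

lemma real_algebraD:
  assumes "real_algebra A"
  shows "Group.monoid A" "subspace (carrier A)"
    "a \<in> carrier A \<Longrightarrow> linear_on (carrier A) (\<lambda>x. a \<otimes>\<^bsub>A\<^esub> x)"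
    "a \<in> carrier A \<Longrightarrow> linear_on (carrier A) (\<lambda>x. x \<otimes>\<^bsub>A\<^esub> a)"
  using assms by (auto simp: real_algebra_def)

lemma linear_on_compose:
  assumes "linear_on V f" "linear_on W g" "\<And>x. x \<in> V \<Longrightarrow> f x \<in> W"
  shows "linear_on V (\<lambda>x. g (f x))"
  using assms by (simp add: linear_on_def)

lemma tensor_mult_pure:
  assumes A: "real_algebra A" and B: "real_algebra B"
    and x: "x \<in> carrier A" "x' \<in> carrier A" and y: "y \<in> carrier B" "y' \<in> carrier B"
  shows "tensor_mult A B (pure_tensor A B x y) (pure_tensor A B x' y')
    = pure_tensor A B (x \<otimes>\<^bsub>A\<^esub> x') (y \<otimes>\<^bsub>B\<^esub> y')"
proof
  fix f
  note mA = monoid.m_closed[OF real_algebraD(1)[OF A]]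
  note mB = monoid.m_closed[OF real_algebraD(1)[OF B]]
  show "tensor_mult A B (pure_tensor A B x y) (pure_tensor A B x' y') f
      = pure_tensor A B (x \<otimes>\<^bsub>A\<^esub> x') (y \<otimes>\<^bsub>B\<^esub> y') f"
  proof (cases "f \<in> bilinear_forms A B")
    case True
    have f1: "linear_on (carrier B) (f u)" if "u \<in> carrier A" for u
      using True that by (simp add: bilinear_forms_def)
    have f2: "linear_on (carrier A) (\<lambda>u. f u w)" if "w \<in> carrier B" for w
      using True that by (simp add: bilinear_forms_def)
    have in1: "(\<lambda>a b. f (u \<otimes>\<^bsub>A\<^esub> a) (w \<otimes>\<^bsub>B\<^esub> b)) \<in> bilinear_forms A B"
      if "u \<in> carrier A" "w \<in> carrier B" for u w
      using linear_on_compose[OF real_algebraD(3)[OF A that(1)] f2]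
        linear_on_compose[OF real_algebraD(3)[OF B that(2)] f1] that mA mB
      by (simp add: bilinear_forms_def)
    have in2: "(\<lambda>a b. f (a \<otimes>\<^bsub>A\<^esub> x') (b \<otimes>\<^bsub>B\<^esub> y')) \<in> bilinear_forms A B"
      using linear_on_compose[OF real_algebraD(4)[OF A x(2)] f2]
        linear_on_compose[OF real_algebraD(4)[OF B y(2)] f1] mA mB x y
      by (simp add: bilinear_forms_def)
    let ?g = "\<lambda>a b. pure_tensor A B x' y' (\<lambda>a' b'. f (a \<otimes>\<^bsub>A\<^esub> a') (b \<otimes>\<^bsub>B\<^esub> b'))"
    have eq: "?g a b = f (a \<otimes>\<^bsub>A\<^esub> x') (b \<otimes>\<^bsub>B\<^esub> y')" if "a \<in> carrier A" "b \<in> carrier B" for a b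
      using in1[OF that] by (simp add: pure_tensor_def)
    have "?g \<in> bilinear_forms A B"
      using in2 linear_on_cong[OF _ real_algebraD(2)[OF B], of "?g _"]
        linear_on_cong[OF _ real_algebraD(2)[OF A], of "\<lambda>a. ?g a _"] eq
      unfolding bilinear_forms_def by auto
    then show ?thesis
      using True eq[OF x(1) y(1)] unfolding tensor_mult_def by (simp add: pure_tensor_def)
  qed (simp add: tensor_mult_def pure_tensor_def)
qed

lemma power_mult_pure:
  assumes A: "real_algebra A"
    and v: "v \<in> {..<m} \<rightarrow>\<^sub>E carrier A" and w: "w \<in> {..<m} \<rightarrow>\<^sub>E carrier A"
  shows "power_mult m A (pure_power m A v) (pure_power m A w)
    = pure_power m A (\<lambda>i\<in>{..<m}. v i \<otimes>\<^bsub>A\<^esub> w i)"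
proof
  fix f
  let ?P = "{..<m} \<rightarrow>\<^sub>E carrier A"
  let ?p = "\<lambda>a b. (\<lambda>i\<in>{..<m}. a i \<otimes>\<^bsub>A\<^esub> b i)"
  note mA = monoid.m_closed[OF real_algebraD(1)[OF A]]
  have P: "?p a b \<in> ?P" if "a \<in> ?P" "b \<in> ?P" for a b
    using that mA by (auto simp: PiE_iff)
  have upd: "a(i := x) \<in> ?P" if "a \<in> ?P" "i < m" "x \<in> carrier A" for a i x
    using that by (auto simp: PiE_iff extensional_def)
  show "power_mult m A (pure_power m A v) (pure_power m A w) f = pure_power m A (?p v w) f"
  proof (cases "f \<in> multilinear_forms m A")
    case True
    have lin: "linear_on (carrier A) (\<lambda>x. f (a(i := x)))" if "a \<in> ?P" "i < m" for a i
      using True that by (simp add: multilinear_forms_def)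
    have in1: "(\<lambda>b. f (?p a b)) \<in> multilinear_forms m A" if a: "a \<in> ?P" for a
      unfolding multilinear_forms_def
    proof (intro CollectI ballI allI impI)
      fix b i assume b: "b \<in> ?P" and i: "i < m"
      have ai: "a i \<in> carrier A" using a i by auto
      have "?p a (b(i := x)) = (?p a b)(i := a i \<otimes>\<^bsub>A\<^esub> x)" for x
        using i by (auto simp: fun_eq_iff)
      then show "linear_on (carrier A) (\<lambda>x. f (?p a (b(i := x))))"
        using linear_on_compose[OF real_algebraD(3)[OF A ai] lin[OF P[OF a b] i]] mA ai by simp
    qed
    have in2: "(\<lambda>a. f (?p a w)) \<in> multilinear_forms m A"
      unfolding multilinear_forms_def
    proof (intro CollectI ballI allI impI)
      fix a i assume a: "a \<in> ?P" and i: "i < m"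
      have wi: "w i \<in> carrier A" using w i by auto
      have "?p (a(i := x)) w = (?p a w)(i := x \<otimes>\<^bsub>A\<^esub> w i)" for x
        using i by (auto simp: fun_eq_iff)
      then show "linear_on (carrier A) (\<lambda>x. f (?p (a(i := x)) w))"
        using linear_on_compose[OF real_algebraD(4)[OF A wi] lin[OF P[OF a w] i]] mA wi by simp
    qed
    let ?g = "\<lambda>a. pure_power m A w (\<lambda>b. f (?p a b))"
    have eq: "?g a = f (?p a w)" if "a \<in> ?P" for a
      using in1[OF that] by (simp add: pure_power_def)
    have "?g \<in> multilinear_forms m A"
      unfolding multilinear_forms_def
    proof (intro CollectI ballI allI impI)
      fix a i assume a: "a \<in> ?P" and i: "i < m"
      show "linear_on (carrier A) (\<lambda>x. ?g (a(i := x)))"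
        using in2 a i linear_on_cong[of "carrier A" "\<lambda>x. ?g (a(i := x))" "\<lambda>x. f (?p (a(i := x)) w)"]
          eq[OF upd[OF a i]] real_algebraD(2)[OF A]
        unfolding multilinear_forms_def by blast
    qed
    then show ?thesis
      using True eq[OF v] unfolding power_mult_def by (simp add: pure_power_def)
  qed (simp add: power_mult_def pure_power_def)
qed


section \<open>The standard graded factors and the matrix algebras\<close>

abbreviation Z2 :: "int monoid"
  where "Z2 \<equiv> integer_mod_group 2"

abbreviation Z4 :: "int monoid"
  where "Z4 \<equiv> integer_mod_group 4"

text \<open>In \<open>\<int>\<^sub>2\<^sup>2\<close> and \<open>\<int>\<^sub>2 \<times> \<int>\<^sub>4\<close> the element \<open>a\<^sup>r b\<^sup>s\<close> is \<open>(r, s)\<close>. The functions giving the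
  homogeneous basis elements are \<open>0\<close> off the grading group, where they are irrelevant.\<close>

abbreviation mat2 :: "'a::zero \<Rightarrow> 'a \<Rightarrow> 'a \<Rightarrow> 'a \<Rightarrow> 'a^2^2"
  where "mat2 p q r s \<equiv> vector [vector [p, q], vector [r, s]]"

definition M2R_basis :: "int \<times> int \<Rightarrow> real^2^2"
  where "M2R_basis = (\<lambda>_. 0)(
    (0, 0) := mat2 1 0 0 1,
    (1, 0) := mat2 (-1) 0 0 1,
    (0, 1) := mat2 0 1 1 0,
    (1, 1) := mat2 0 (-1) 1 0)"

definition M2R :: "(real^2^2, int \<times> int) graded_algebra"
  where "M2R = \<lparr>carrier = UNIV, monoid.mult = (**), one = mat 1,
    grading_group = Z2 \<times>\<times> Z2, component = (\<lambda>g. span {M2R_basis g})\<rparr>"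

text \<open>The quadruple \<open>(p, q, r, s)\<close> is the quaternion \<open>p + q i + r j + s k\<close>.\<close>

type_synonym quat = "real \<times> real \<times> real \<times> real"

fun quat_mult :: "quat \<Rightarrow> quat \<Rightarrow> quat"
  where "quat_mult (p, q, r, s) (p', q', r', s') =
   (p * p' - q * q' - r * r' - s * s',
    p * q' + q * p' + r * s' - s * r',
    p * r' - q * s' + r * p' + s * q',
    p * s' + q * r' - r * q' + s * p')"

definition quat_basis :: "int \<times> int \<Rightarrow> quat"
  where "quat_basis = (\<lambda>_. 0)(
    (0, 0) := (1, 0, 0, 0),
    (1, 0) := (0, 1, 0, 0),
    (0, 1) := (0, 0, 1, 0),
    (1, 1) := (0, 0, 0, 1))"

definition HH :: "(quat, int \<times> int) graded_algebra"
  where "HH = \<lparr>carrier = UNIV, monoid.mult = quat_mult, one = (1, 0, 0, 0),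
    grading_group = Z2 \<times>\<times> Z2, component = (\<lambda>g. span {quat_basis g})\<rparr>"

definition CC_basis :: "int \<Rightarrow> complex"
  where "CC_basis = (\<lambda>_. 0)(0 := 1, 1 := \<i>)"

definition CC :: "(complex, int) graded_algebra"
  where "CC = \<lparr>carrier = UNIV, monoid.mult = (*), one = 1,
    grading_group = Z2, component = (\<lambda>g. span {CC_basis g})\<rparr>"

definition M2C_basis :: "int \<times> int \<Rightarrow> complex^2^2"
  where "M2C_basis = (\<lambda>_. 0)(
    (0, 0) := mat2 1 0 0 1,
    (1, 0) := mat2 0 1 1 0,
    (0, 1) := mat2 (1 + \<i>) 0 0 (-1 - \<i>),
    (1, 1) := mat2 0 (-1 - \<i>) (1 + \<i>) 0,
    (0, 2) := mat2 \<i> 0 0 \<i>,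
    (1, 2) := mat2 0 \<i> \<i> 0,
    (0, 3) := mat2 (-1 + \<i>) 0 0 (1 - \<i>),
    (1, 3) := mat2 0 (1 - \<i>) (-1 + \<i>) 0)"

definition M2C :: "(complex^2^2, int \<times> int) graded_algebra"
  where "M2C = \<lparr>carrier = UNIV, monoid.mult = (**), one = mat 1,
    grading_group = Z2 \<times>\<times> Z4, component = (\<lambda>g. span {M2C_basis g})\<rparr>"

definition RR :: "real monoid"
  where "RR = \<lparr>carrier = UNIV, monoid.mult = (*), one = 1\<rparr>"

text \<open>The \<open>n \<times> n\<close> matrices over \<open>A\<close>, as functions of two indices that vanish outside \<open>{..<n}\<close>.\<close>

definition matrix_algebra :: "nat \<Rightarrow> ('a::real_vector, 'x) monoid_scheme \<Rightarrow> (nat \<Rightarrow> nat \<Rightarrow> 'a) monoid"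
  where "matrix_algebra n A =
    \<lparr>carrier = {M. \<forall>i j. if i < n \<and> j < n then M i j \<in> carrier A else M i j = 0},
     monoid.mult = (\<lambda>M N i j. if i < n \<and> j < n then \<Sum>k<n. M i k \<otimes>\<^bsub>A\<^esub> N k j else 0),
     one = (\<lambda>i j. if i < n \<and> i = j then \<one>\<^bsub>A\<^esub> else 0)\<rparr>"


section \<open>The list\<close>

definition model_a :: "nat \<Rightarrow> (((nat \<Rightarrow> real^2^2) \<Rightarrow> real) \<Rightarrow> real, nat \<Rightarrow> int \<times> int) graded_algebra"
  where "model_a m = graded_tensor_power m M2R"

definition model_b where "model_b m = graded_tensor (graded_tensor_power (m - 1) M2R) HH"

definition model_c where "model_c m = graded_tensor (graded_tensor_power m M2R) CC"

definition model_d where "model_d m = graded_tensor (graded_tensor_power (m - 1) M2R) M2C"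

datatype list_item = Item_a nat | Item_b nat | Item_c nat | Item_d nat

text \<open>\<open>m \<ge> 1\<close> is required where the list has \<open>n = 2\<^sup>m \<ge> 2\<close>, so that \<open>Item_b 0\<close> and \<open>Item_d 0\<close> are
  not on the list.\<close>

primrec equivalent_to_item :: "('a::real_vector, 'g) graded_algebra \<Rightarrow> list_item \<Rightarrow> bool"
  where
    "equivalent_to_item X (Item_a m) \<longleftrightarrow> graded_equivalent X (model_a m)"
  | "equivalent_to_item X (Item_b m) \<longleftrightarrow> m \<ge> 1 \<and> graded_equivalent X (model_b m)"
  | "equivalent_to_item X (Item_c m) \<longleftrightarrow> graded_equivalent X (model_c m)"
  | "equivalent_to_item X (Item_d m) \<longleftrightarrow> m \<ge> 1 \<and> graded_equivalent X (model_d m)"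

end

theory Submission
  imports Defs
begin

text \<open>An algebra graded with one-dimensional components has a homogeneous basis that is closed
  under multiplication up to real factors, and algebras with the same factors are equivalent.
  Homogeneous elements of \<open>X\<close> commute up to sign, so choose a maximal family of mutually commuting
  pairs \<open>a\<^sub>i, b\<^sub>i\<close> of homogeneous elements with \<open>a\<^sub>i\<^sup>2 = b\<^sub>i\<^sup>2 = 1\<close> and \<open>a\<^sub>i b\<^sub>i = - b\<^sub>i a\<^sub>i\<close>; each pair
  spans a copy of \<open>M\<^sub>2(\<real>)\<close>, and \<open>X\<close> is the tensor product of these copies and their commutant.
  By simplicity, the centre of \<open>X\<close> is \<open>\<real>\<close> or \<open>\<real>1 \<oplus> \<real>f\<close> with \<open>f\<^sup>2 = - 1\<close>. In the first case,
  maximality forces the nonscalar homogeneous elements of the commutant to have negative squares,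
  so that products of commuting ones are scalar and the commutant is \<open>\<real>\<close> or the quaternions. In the
  second case, multiplication by \<open>f\<close> changes the sign of a real square, so that anticommuting
  homogeneous elements of the commutant cannot both have real squares; the commutant is then
  \<open>\<complex>\<close> or \<open>M\<^sub>2(\<complex>)\<close>. The matrix algebras carry bases with the same factors, given by Kronecker
  products.\<close>

section \<open>Algebras with a basis closed under multiplication up to scalars\<close>

text \<open>When squares of homogeneous elements are scalar, their signs form a quadratic form over
  the field with two elements, with the commutation sign as polar form; the pairs are its hyperbolic
  planes. Behind the steps of the overview: (i) One-dimensional components and a commutative group
  give xy = r yx. As there are finitely many lines, some power of x is scalar, so r is a real root
  of unity, that is, a sign. (ii) A central homogeneous z might have any finite order modulo
  scalars. Simplicity makes the centre free of zero divisors; factoring y^n - 1 excludes odd orders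
  above 1, Sophie Germain's identity excludes order 4, and what remains is that z^2 is scalar. (iii)
  With centre spanned by 1 and f, a homogeneous square may lie in Rf rather than R. Such an element
  has order 4 modulo scalars, which is the origin of the factor Z4 in (1-d), and y^2 = 2 f copies (1
  + i)^2 = 2 i. (iv) Uniqueness is a count of lines by the type of their squares. The sum of the
  signs is a Gauss sum, whose sign distinguishes (1-a) from (1-b) as an Arf invariant would.\<close>

lemma linear_on_linear: "linear f \<Longrightarrow> linear_on V f"
  by (simp add: linear_on_def linear_add linear_scale)

lemma linear_on_sum:
  assumes "linear_on V f" "subspace V" "\<And>i. i \<in> I \<Longrightarrow> x i \<in> V"
  shows "f (\<Sum>i\<in>I. a i *\<^sub>R x i) = (\<Sum>i\<in>I. a i *\<^sub>R f (x i))"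
proof -
  have zero: "f 0 = 0"
    using assms(1) subspace_0[OF assms(2)] unfolding linear_on_def by (metis scaleR_zero_left)
  show ?thesis
  proof (cases "finite I")
    case True
    then show ?thesis using assms(3)
    proof (induction I)
      case (insert i I)
      have "(\<Sum>i\<in>I. a i *\<^sub>R x i) \<in> V" "a i *\<^sub>R x i \<in> V"
        using insert assms(2) by (auto intro!: subspace_sum subspace_scale)
      then show ?case using insert assms(1) by (simp add: linear_on_def)
    qed (simp add: zero)
  qed (simp add: zero)
qed

lemma linear_on_zero: "linear_on V f \<Longrightarrow> subspace V \<Longrightarrow> f 0 = 0"
  using linear_on_sum[of V f "{}"] by simp

lemma span_image_eq_sums:
  assumes "finite I"
  shows "span (e ` I) = {\<Sum>i\<in>I. a i *\<^sub>R e i | a. True}"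
proof (intro equalityI subsetI)
  fix x assume "x \<in> span (e ` I)"
  then show "x \<in> {\<Sum>i\<in>I. a i *\<^sub>R e i | a. True}"
  proof (induction rule: span_induct_alt)
    case base
    show ?case by (auto intro!: exI[of _ "\<lambda>_. 0"])
  next
    case (step c x y)
    then obtain a j where *: "y = (\<Sum>i\<in>I. a i *\<^sub>R e i)" "j \<in> I" "x = e j" by auto
    have "c *\<^sub>R x = (\<Sum>i\<in>I. (if i = j then c else 0) *\<^sub>R e i)"
      using * assms by (simp add: if_distrib[of "\<lambda>r. r *\<^sub>R _"] cong: if_cong)
    then have "c *\<^sub>R x + y = (\<Sum>i\<in>I. ((if i = j then c else 0) + a i) *\<^sub>R e i)"
      using * by (simp add: scaleR_add_left sum.distrib)
    then show ?case by (auto intro!: exI[of _ "\<lambda>i. (if i = j then c else 0) + a i"])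
  qed
next
  fix x assume "x \<in> {\<Sum>i\<in>I. a i *\<^sub>R e i | a. True}"
  then show "x \<in> span (e ` I)"
    by (auto intro!: span_sum intro: span_scale[OF span_base])
qed

lemma in_span_singleton: "x \<in> span {y} \<longleftrightarrow> (\<exists>c. x = c *\<^sub>R y)"
  by (auto simp: span_singleton)

text \<open>A twisted group algebra of \<open>G\<close>, with structure constants \<open>c\<close>.
  Of the algebra laws only bilinearity of the product is asked, so that tensor products and matrix
  algebras fit in without a check of associativity. Independence is stated for the family
  \<open>e\<close>, which makes \<open>e\<close> injective.\<close>

locale twisted_basis =
  fixes A :: "('a::real_vector, 'x) monoid_scheme" and G :: "('i, 'y) monoid_scheme"
    and c :: "'i \<Rightarrow> 'i \<Rightarrow> real" and e :: "'i \<Rightarrow> 'a"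
  assumes finite_index: "finite (carrier G)"
    and monoid_index: "Group.monoid G"
    and linear_left: "a \<in> carrier A \<Longrightarrow> linear_on (carrier A) (\<lambda>x. a \<otimes>\<^bsub>A\<^esub> x)"
    and linear_right: "a \<in> carrier A \<Longrightarrow> linear_on (carrier A) (\<lambda>x. x \<otimes>\<^bsub>A\<^esub> a)"
    and carrier_eq_span: "carrier A = span (e ` carrier G)"
    and indep: "(\<Sum>i\<in>carrier G. r i *\<^sub>R e i) = 0 \<Longrightarrow> j \<in> carrier G \<Longrightarrow> r j = 0"
    and basis_mult: "s \<in> carrier G \<Longrightarrow> t \<in> carrier G \<Longrightarrow> e s \<otimes>\<^bsub>A\<^esub> e t = c s t *\<^sub>R e (s \<otimes>\<^bsub>G\<^esub> t)"
    and basis_one: "\<one>\<^bsub>A\<^esub> = e \<one>\<^bsub>G\<^esub>"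
begin

lemma index_closed [simp]: "s \<in> carrier G \<Longrightarrow> t \<in> carrier G \<Longrightarrow> s \<otimes>\<^bsub>G\<^esub> t \<in> carrier G"
  and index_one [simp]: "\<one>\<^bsub>G\<^esub> \<in> carrier G"
  using monoid_index by (auto simp: monoid.m_closed monoid.one_closed)

lemma subspace_carrier: "subspace (carrier A)"
  by (simp add: carrier_eq_span)

lemma basis_in_carrier [simp]: "s \<in> carrier G \<Longrightarrow> e s \<in> carrier A"
  by (simp add: carrier_eq_span span_base)

lemma sum_in_carrier: "I \<subseteq> carrier G \<Longrightarrow> (\<Sum>i\<in>I. r i *\<^sub>R e i) \<in> carrier A"
  by (auto intro!: subspace_sum subspace_scale simp: subspace_carrier)

lemma expand:
  assumes "x \<in> carrier A"
  obtains r where "x = (\<Sum>i\<in>carrier G. r i *\<^sub>R e i)"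
  using assms span_image_eq_sums[OF finite_index, of e] carrier_eq_span by auto

lemma coord_unique:
  assumes "(\<Sum>i\<in>carrier G. r i *\<^sub>R e i) = (\<Sum>i\<in>carrier G. r' i *\<^sub>R e i)" "j \<in> carrier G"
  shows "r j = r' j"
  using indep[of "\<lambda>i. r i - r' i" j] assms by (simp add: scaleR_diff_left sum_subtractf)

lemma basis_inj: "inj_on e (carrier G)"
proof (rule inj_onI)
  fix s t assume *: "s \<in> carrier G" "t \<in> carrier G" "e s = e t"
  have single: "(\<Sum>i\<in>carrier G. (if i = j then 1 else 0) *\<^sub>R e i) = e j" if "j \<in> carrier G" for j
    using that finite_index by (simp add: if_distrib[of "\<lambda>r. r *\<^sub>R _"] cong: if_cong)
  show "s = t"
    using coord_unique[of "\<lambda>i. if i = s then 1 else 0" "\<lambda>i. if i = t then 1 else 0" s] * single[of s] single[of t]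
    by (auto split: if_splits)
qed

lemma basis_independent: "independent (e ` carrier G)"
proof (rule independent_if_scalars_zero)
  show "finite (e ` carrier G)" using finite_index by simp
  fix f x assume "(\<Sum>x\<in>e ` carrier G. f x *\<^sub>R x) = 0" and x: "x \<in> e ` carrier G"
  then have "(\<Sum>i\<in>carrier G. f (e i) *\<^sub>R e i) = 0"
    by (simp add: sum.reindex[OF basis_inj])
  then show "f x = 0" using indep[of "\<lambda>i. f (e i)"] x by blast
qed

lemma basis_nonzero: "s \<in> carrier G \<Longrightarrow> e s \<noteq> 0"
  using basis_independent dependent_zero by (metis image_eqI)

text \<open>The dual basis, extended to the ambient space. Products of these functionals are the
  forms that show pure tensors of basis elements to be independent.\<close>

lemma coord_functional:
  "\<exists>\<delta> :: 'i \<Rightarrow> 'a \<Rightarrow> real. (\<forall>i. linear (\<delta> i)) \<and>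
    (\<forall>i. \<forall>j\<in>carrier G. \<delta> i (e j) = (if i = j then 1 else 0))"
proof -
  have "\<exists>g::'a \<Rightarrow> real. linear g \<and> (\<forall>j\<in>carrier G. g (e j) = (if i = j then 1 else 0))" for i
    using linear_independent_extend[OF basis_independent, of "\<lambda>x. if i = the_inv_into (carrier G) e x then 1 else 0"]
    by (metis (no_types, lifting) the_inv_into_f_f[OF basis_inj] imageI)
  then show ?thesis by metis
qed

lemma mult_sums:
  "(\<Sum>i\<in>carrier G. p i *\<^sub>R e i) \<otimes>\<^bsub>A\<^esub> (\<Sum>j\<in>carrier G. q j *\<^sub>R e j)
    = (\<Sum>i\<in>carrier G. \<Sum>j\<in>carrier G. (p i * q j * c i j) *\<^sub>R e (i \<otimes>\<^bsub>G\<^esub> j))"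
proof -
  let ?y = "\<Sum>j\<in>carrier G. q j *\<^sub>R e j"
  have y: "?y \<in> carrier A" by (rule sum_in_carrier) simp
  have "(\<Sum>i\<in>carrier G. p i *\<^sub>R e i) \<otimes>\<^bsub>A\<^esub> ?y = (\<Sum>i\<in>carrier G. p i *\<^sub>R (e i \<otimes>\<^bsub>A\<^esub> ?y))"
    using linear_on_sum[OF linear_right[OF y] subspace_carrier, of "carrier G" e p] by simp
  also have "\<dots> = (\<Sum>i\<in>carrier G. p i *\<^sub>R (\<Sum>j\<in>carrier G. q j *\<^sub>R (e i \<otimes>\<^bsub>A\<^esub> e j)))"
    using linear_on_sum[OF linear_left subspace_carrier, of _ "carrier G" e q] by simp
  finally show ?thesis by (simp add: basis_mult scaleR_sum_right mult.assoc)
qed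

end

text \<open>Structure constants determine the algebra: the linear map that matches the bases is
  multiplicative by bilinearity. Linearity of \<open>\<psi>\<close> on the ambient space is kept so
  that images of lines can be computed as images of spans.\<close>

lemma twisted_basis_iso:
  fixes A :: "('a::real_vector, 'x) monoid_scheme" and B :: "('b::real_vector, 'z) monoid_scheme"
  assumes A: "twisted_basis A G c e" and B: "twisted_basis B G c f"
  obtains \<psi> where "\<psi> \<in> algebra_iso A B" "linear \<psi>" "\<And>s. s \<in> carrier G \<Longrightarrow> \<psi> (e s) = f s"
proof -
  interpret A: twisted_basis A G c e by fact
  interpret B: twisted_basis B G c f by fact
  obtain \<psi> where lin: "linear \<psi>" and \<psi>: "\<And>s. s \<in> carrier G \<Longrightarrow> \<psi> (e s) = f s"
    using linear_independent_extend[OF A.basis_independent, of "\<lambda>x. f (the_inv_into (carrier G) e x)"]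
    by (metis (no_types, lifting) the_inv_into_f_f[OF A.basis_inj] imageI)
  have img: "\<psi> ` e ` carrier G = f ` carrier G"
    using \<psi> by (auto simp: image_image)
  have inj: "inj_on \<psi> (e ` carrier G)"
    by (rule inj_onI) (use \<psi> B.basis_inj in \<open>auto dest: inj_onD\<close>)
  have "bij_betw \<psi> (carrier A) (carrier B)"
    using linear_inj_on_span_independent_image[OF lin, of "e ` carrier G"] B.basis_independent
      linear_span_image[OF lin, of "e ` carrier G"] img inj
    by (simp add: bij_betw_def A.carrier_eq_span B.carrier_eq_span)
  moreover have "\<psi> (x \<otimes>\<^bsub>A\<^esub> y) = \<psi> x \<otimes>\<^bsub>B\<^esub> \<psi> y" if x: "x \<in> carrier A" and y: "y \<in> carrier A" for x y
  proof -
    obtain p q where p: "x = (\<Sum>i\<in>carrier G. p i *\<^sub>R e i)" and q: "y = (\<Sum>i\<in>carrier G. q i *\<^sub>R e i)"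
      using A.expand x y by metis
    have "\<psi> x = (\<Sum>i\<in>carrier G. p i *\<^sub>R f i)" "\<psi> y = (\<Sum>i\<in>carrier G. q i *\<^sub>R f i)"
      by (simp_all add: p q linear_sum[OF lin] linear_scale[OF lin] \<psi>)
    then show ?thesis
      by (simp add: p q A.mult_sums B.mult_sums linear_sum[OF lin] linear_scale[OF lin] \<psi>)
  qed
  moreover have "\<psi> \<one>\<^bsub>A\<^esub> = \<one>\<^bsub>B\<^esub>" by (simp add: A.basis_one B.basis_one \<psi>)
  ultimately have "\<psi> \<in> algebra_iso A B"
    by (simp add: algebra_iso_def linear_on_linear[OF lin])
  then show thesis using that lin \<psi> by blast
qed

text \<open>Serves to regroup index groups, such as a power with one factor split off, and to add or
  remove a trivial factor.\<close>

lemma twisted_basis_reindex: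
  assumes B: "twisted_basis B H c f" and \<phi>: "\<phi> \<in> iso G H" and G: "Group.monoid G"
    and one: "\<phi> \<one>\<^bsub>G\<^esub> = \<one>\<^bsub>H\<^esub>"
  shows "twisted_basis B G (\<lambda>s t. c (\<phi> s) (\<phi> t)) (\<lambda>s. f (\<phi> s))"
proof -
  interpret B: twisted_basis B H c f by fact
  have bij: "bij_betw \<phi> (carrier G) (carrier H)"
    and mult: "\<And>s t. s \<in> carrier G \<Longrightarrow> t \<in> carrier G \<Longrightarrow> \<phi> (s \<otimes>\<^bsub>G\<^esub> t) = \<phi> s \<otimes>\<^bsub>H\<^esub> \<phi> t"
    using \<phi> by (auto simp: iso_def hom_def)
  have mem: "\<phi> s \<in> carrier H" if "s \<in> carrier G" for s
    using bij that by (auto simp: bij_betw_def)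
  show ?thesis
  proof (rule twisted_basis.intro)
    show "finite (carrier G)" using bij B.finite_index bij_betw_finite by blast
    show "carrier B = span ((\<lambda>s. f (\<phi> s)) ` carrier G)"
      using bij by (simp add: B.carrier_eq_span bij_betw_def flip: image_image)
    fix r j assume sum: "(\<Sum>i\<in>carrier G. r i *\<^sub>R f (\<phi> i)) = 0" and j: "j \<in> carrier G"
    have "(\<Sum>i\<in>carrier H. r (the_inv_into (carrier G) \<phi> i) *\<^sub>R f i) = (\<Sum>i\<in>carrier G. r i *\<^sub>R f (\<phi> i))"
      using bij by (subst sum.reindex_bij_betw[OF bij, symmetric])
        (auto simp: bij_betw_def the_inv_into_f_f intro!: sum.cong)
    then show "r j = 0"
      using sum B.indep[of "\<lambda>i. r (the_inv_into (carrier G) \<phi> i)" "\<phi> j"] j mem[OF j] bij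
      by (auto simp: bij_betw_def the_inv_into_f_f)
  qed (use G B.linear_left B.linear_right mem in \<open>auto simp: B.basis_mult mult one B.basis_one\<close>)
qed

lemma twisted_basis_cong:
  assumes "twisted_basis A G c e"
    "\<And>s t. s \<in> carrier G \<Longrightarrow> t \<in> carrier G \<Longrightarrow> c s t = c' s t"
    "\<And>s. s \<in> carrier G \<Longrightarrow> e s = e' s"
  shows "twisted_basis A G c' e'"
proof -
  interpret twisted_basis A G c e by fact
  have eq: "e ` carrier G = e' ` carrier G" using assms(3) by auto
  show ?thesis
    by (rule twisted_basis.intro) (use finite_index monoid_index linear_left linear_right basis_mult indep assms(2,3)
        in \<open>auto simp: carrier_eq_span eq basis_one\<close>)
qed

section \<open>Tensor products of twisted bases\<close>

lemma fun_sum_apply: "(\<Sum>i\<in>I. f i) x = (\<Sum>i\<in>I. f i x)" for f :: "'i \<Rightarrow> 'b \<Rightarrow> 'c::comm_monoid_add"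
  by (induction I rule: infinite_finite_induct) auto

section \<open>Extension of linear identities from a spanning set\<close>

lemma linear_on_add_scale:
  "linear_on V f \<Longrightarrow> linear_on V g \<Longrightarrow> linear_on V (\<lambda>x. c *\<^sub>R f x + g x)"
  by (simp add: linear_on_def algebra_simps)

lemma linear_on_span_eq:
  assumes "linear_on (span S) f" "linear_on (span S) g" "\<And>x. x \<in> S \<Longrightarrow> f x = g x" "x \<in> span S"
  shows "f x = g x"
proof -
  \<comment> \<open>\<open>linear_on\<close> says nothing outside \<open>span S\<close>, so
    membership travels with the induction.\<close>
  have "x \<in> span S \<and> f x = g x"
    using assms(4)
  proof (induction rule: span_induct_alt)
    case base
    show ?case
      using linear_on_zero[OF assms(1)] linear_on_zero[OF assms(2)] by (simp add: span_zero)
  next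
    case (step c x y)
    then show ?case
      using assms(1,2,3) by (simp add: linear_on_def span_base span_scale span_add)
  qed
  then show ?thesis ..
qed

lemma linear_on_span_in:
  assumes "linear_on (span S) f" "\<And>x. x \<in> S \<Longrightarrow> f x \<in> W" "subspace W" "x \<in> span S"
  shows "f x \<in> W"
proof -
  have "x \<in> span S \<and> f x \<in> W"
    using assms(4)
  proof (induction rule: span_induct_alt)
    case base
    show ?case using linear_on_zero[OF assms(1)] assms(3) by (simp add: subspace_0 span_zero)
  next
    case (step c x y)
    then show ?case
      using assms(1,2,3)
      by (simp add: linear_on_def span_base span_scale span_add subspace_add subspace_scale)
  qed
  then show ?thesis ..
qed

text \<open>Associativity is trilinear, so it extends from generators one argument at a time:
  \<open>assoc1\<close>, \<open>assoc2\<close> and \<open>assoc3\<close> free the third, second and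
  first argument in turn.\<close>

lemma real_algebra_spanI:
  fixes A :: "('a::real_vector, 'x) monoid_scheme" (structure)
  assumes carrier: "carrier A = span S"
    and left: "\<And>a. a \<in> carrier A \<Longrightarrow> linear_on (carrier A) (\<lambda>x. a \<otimes> x)"
    and right: "\<And>a. a \<in> carrier A \<Longrightarrow> linear_on (carrier A) (\<lambda>x. x \<otimes> a)"
    and closed: "\<And>x y. x \<in> S \<Longrightarrow> y \<in> S \<Longrightarrow> x \<otimes> y \<in> carrier A"
    and assoc: "\<And>x y z. x \<in> S \<Longrightarrow> y \<in> S \<Longrightarrow> z \<in> S \<Longrightarrow> x \<otimes> y \<otimes> z = x \<otimes> (y \<otimes> z)"
    and one: "\<one> \<in> carrier A" "\<And>x. x \<in> S \<Longrightarrow> \<one> \<otimes> x = x" "\<And>x. x \<in> S \<Longrightarrow> x \<otimes> \<one> = x"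
  shows "real_algebra A"
proof -
  have sub: "subspace (carrier A)" by (simp add: carrier)
  have base: "x \<in> carrier A" if "x \<in> S" for x using that by (simp add: carrier span_base)
  have id: "linear_on (span S) (\<lambda>x. x)" by (simp add: linear_on_def)
  have closed1: "x \<otimes> y \<in> carrier A" if "x \<in> S" "y \<in> carrier A" for x y
    using linear_on_span_in[of S "\<lambda>y. x \<otimes> y" "carrier A" y] left[OF base[OF that(1)]] closed that sub
    by (simp add: carrier)
  have closed2: "x \<otimes> y \<in> carrier A" if "x \<in> carrier A" "y \<in> carrier A" for x y
    using linear_on_span_in[of S "\<lambda>x. x \<otimes> y" "carrier A" x] right[OF that(2)] closed1 that sub
    by (simp add: carrier)
  note comp = linear_on_compose[where V = "carrier A" and W = "carrier A"]
  have assoc1: "x \<otimes> y \<otimes> z = x \<otimes> (y \<otimes> z)" if "x \<in> S" "y \<in> S" "z \<in> carrier A" for x y z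
    using linear_on_span_eq[of S "\<lambda>z. x \<otimes> y \<otimes> z" "\<lambda>z. x \<otimes> (y \<otimes> z)" z]
      left[of "x \<otimes> y"] comp[OF left[of y] left[of x]] that assoc closed2 base by (simp add: carrier)
  have assoc2: "x \<otimes> y \<otimes> z = x \<otimes> (y \<otimes> z)" if "x \<in> S" "y \<in> carrier A" "z \<in> carrier A" for x y z
    using linear_on_span_eq[of S "\<lambda>y. x \<otimes> y \<otimes> z" "\<lambda>y. x \<otimes> (y \<otimes> z)" y]
      comp[OF left[of x] right[of z]] comp[OF right[of z] left[of x]] that assoc1 closed2 base
    by (simp add: carrier)
  have assoc3: "x \<otimes> y \<otimes> z = x \<otimes> (y \<otimes> z)" if "x \<in> carrier A" "y \<in> carrier A" "z \<in> carrier A" for x y z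
    using linear_on_span_eq[of S "\<lambda>x. x \<otimes> y \<otimes> z" "\<lambda>x. x \<otimes> (y \<otimes> z)" x]
      comp[OF right[of y] right[of z]] right[of "y \<otimes> z"] that assoc2 closed2 base
    by (simp add: carrier)
  have "\<one> \<otimes> x = x" "x \<otimes> \<one> = x" if "x \<in> carrier A" for x
    using linear_on_span_eq[of S "\<lambda>x. \<one> \<otimes> x" "\<lambda>x. x" x] linear_on_span_eq[of S "\<lambda>x. x \<otimes> \<one>" "\<lambda>x. x" x]
      left[OF one(1)] right[OF one(1)] one id that by (simp_all add: carrier)
  then show ?thesis
    unfolding real_algebra_def
    using closed2 assoc3 one(1) left right sub by (auto intro!: monoidI)
qed

section \<open>Bilinearity of the product of tensors\<close>

lemma bilinear_forms_add_scale:
  "f \<in> bilinear_forms A B \<Longrightarrow> g \<in> bilinear_forms A B \<Longrightarrow>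
    (\<lambda>x y. c * f x y + g x y) \<in> bilinear_forms A B"
  by (auto simp: bilinear_forms_def intro!: linear_on_add_scale[where 'b = real, unfolded real_scaleR_def])

context
  fixes A :: "('a::real_vector, 'x) monoid_scheme" and B :: "('b::real_vector, 'y) monoid_scheme"
  assumes A: "real_algebra A" and B: "real_algebra B"
begin

private abbreviation "pure_tensors \<equiv> {pure_tensor A B x y | x y. x \<in> carrier A \<and> y \<in> carrier B}"

text \<open>\<open>tensor_mult\<close> applies \<open>s\<close> to this function, and a pure tensor
  returns \<open>0\<close> on anything that is not a bilinear form. So the product with a sum
  \<open>t\<close> of pure tensors has its intended value only because of this fact.\<close>

lemma translated_bilinear_form:
  assumes t: "t \<in> span pure_tensors" and f: "f \<in> bilinear_forms A B"
  shows "(\<lambda>x y. t (\<lambda>x' y'. f (x \<otimes>\<^bsub>A\<^esub> x') (y \<otimes>\<^bsub>B\<^esub> y'))) \<in> bilinear_forms A B"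
  using t
proof (induction rule: span_induct_alt)
  case base
  show ?case by (simp add: bilinear_forms_def linear_on_def)
next
  case (step r s t)
  have f1: "linear_on (carrier B) (f u)" if "u \<in> carrier A" for u
    using f that by (simp add: bilinear_forms_def)
  have f2: "linear_on (carrier A) (\<lambda>u. f u w)" if "w \<in> carrier B" for w
    using f that by (simp add: bilinear_forms_def)
  note mA = monoid.m_closed[OF real_algebraD(1)[OF A]]
  note mB = monoid.m_closed[OF real_algebraD(1)[OF B]]
  obtain x' y' where s: "s = pure_tensor A B x' y'" and x': "x' \<in> carrier A" and y': "y' \<in> carrier B"
    using step by auto
  have in1: "(\<lambda>a b. f (u \<otimes>\<^bsub>A\<^esub> a) (w \<otimes>\<^bsub>B\<^esub> b)) \<in> bilinear_forms A B"
    if "u \<in> carrier A" "w \<in> carrier B" for u w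
    using linear_on_compose[OF real_algebraD(3)[OF A that(1)] f2]
      linear_on_compose[OF real_algebraD(3)[OF B that(2)] f1] that mA mB
    by (simp add: bilinear_forms_def)
  have in2: "(\<lambda>a b. f (a \<otimes>\<^bsub>A\<^esub> x') (b \<otimes>\<^bsub>B\<^esub> y')) \<in> bilinear_forms A B"
    using linear_on_compose[OF real_algebraD(4)[OF A x'] f2]
      linear_on_compose[OF real_algebraD(4)[OF B y'] f1] mA mB x' y'
    by (simp add: bilinear_forms_def)
  let ?g = "\<lambda>a b. s (\<lambda>a' b'. f (a \<otimes>\<^bsub>A\<^esub> a') (b \<otimes>\<^bsub>B\<^esub> b'))"
  have eq: "?g a b = f (a \<otimes>\<^bsub>A\<^esub> x') (b \<otimes>\<^bsub>B\<^esub> y')" if "a \<in> carrier A" "b \<in> carrier B" for a b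
    using in1[OF that] by (simp add: s pure_tensor_def)
  have "?g \<in> bilinear_forms A B"
    using in2 linear_on_cong[OF _ real_algebraD(2)[OF B], of "?g _"]
      linear_on_cong[OF _ real_algebraD(2)[OF A], of "\<lambda>a. ?g a _"] eq
    unfolding bilinear_forms_def by auto
  then show ?case
    using bilinear_forms_add_scale[OF _ step(2), of ?g r] by simp
qed

lemma tensor_mult_linear_left: "linear_on (span pure_tensors) (\<lambda>s. tensor_mult A B s t)"
  by (auto simp: linear_on_def tensor_mult_def fun_eq_iff)

text \<open>Linearity in \<open>s\<close> is pointwise, but \<open>t\<close> sits inside the
  argument of \<open>s\<close>. For a pure tensor \<open>p\<close> the value at a sum is the sum of
  the values because all arguments involved are bilinear forms.\<close>

lemma tensor_mult_linear_right:
  assumes "s \<in> span pure_tensors"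
  shows "linear_on (span pure_tensors) (\<lambda>t. tensor_mult A B s t)"
  using assms
proof (induction rule: span_induct_alt)
  case base
  show ?case by (auto simp: linear_on_def tensor_mult_def fun_eq_iff)
next
  case (step r p s)
  then obtain x y where p: "p = pure_tensor A B x y" by auto
  have "linear_on (span pure_tensors) (\<lambda>t. tensor_mult A B p t)"
    unfolding linear_on_def
  proof (intro conjI ballI allI)
    fix t u assume tu: "t \<in> span pure_tensors" "u \<in> span pure_tensors"
    show "tensor_mult A B p (t + u) = tensor_mult A B p t + tensor_mult A B p u"
      using translated_bilinear_form[OF tu(1)] translated_bilinear_form[OF tu(2)]
        translated_bilinear_form[OF span_add[OF tu]]
      by (simp add: fun_eq_iff tensor_mult_def p pure_tensor_def)
  next
    fix c t assume t: "t \<in> span pure_tensors"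
    show "tensor_mult A B p (c *\<^sub>R t) = c *\<^sub>R tensor_mult A B p t"
      using translated_bilinear_form[OF t] translated_bilinear_form[OF span_scale[OF t, of c]]
      by (simp add: fun_eq_iff tensor_mult_def p pure_tensor_def)
  qed
  moreover have "tensor_mult A B (r *\<^sub>R p + s) t = r *\<^sub>R tensor_mult A B p t + tensor_mult A B s t" for t
    by (auto simp: fun_eq_iff tensor_mult_def)
  ultimately show ?case using step(2) by (simp only: linear_on_add_scale)
qed

end

lemma pure_tensor_sums:
  assumes "subspace (carrier A)" "subspace (carrier B)"
    and "\<And>i. i \<in> I \<Longrightarrow> x i \<in> carrier A" "\<And>j. j \<in> J \<Longrightarrow> y j \<in> carrier B"
  shows "pure_tensor A B (\<Sum>i\<in>I. p i *\<^sub>R x i) (\<Sum>j\<in>J. q j *\<^sub>R y j)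
    = (\<Sum>i\<in>I. \<Sum>j\<in>J. (p i * q j) *\<^sub>R pure_tensor A B (x i) (y j))"
proof
  fix f
  show "pure_tensor A B (\<Sum>i\<in>I. p i *\<^sub>R x i) (\<Sum>j\<in>J. q j *\<^sub>R y j) f
    = (\<Sum>i\<in>I. \<Sum>j\<in>J. (p i * q j) *\<^sub>R pure_tensor A B (x i) (y j)) f"
  proof (cases "f \<in> bilinear_forms A B")
    case True
    have Y: "(\<Sum>j\<in>J. q j *\<^sub>R y j) \<in> carrier B"
      using assms by (auto intro!: subspace_sum subspace_scale)
    have "f (\<Sum>i\<in>I. p i *\<^sub>R x i) (\<Sum>j\<in>J. q j *\<^sub>R y j) = (\<Sum>i\<in>I. p i *\<^sub>R f (x i) (\<Sum>j\<in>J. q j *\<^sub>R y j))"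
      using True Y assms linear_on_sum[of "carrier A" "\<lambda>x. f x (\<Sum>j\<in>J. q j *\<^sub>R y j)" I x p]
      by (simp add: bilinear_forms_def)
    also have "\<dots> = (\<Sum>i\<in>I. p i *\<^sub>R (\<Sum>j\<in>J. q j *\<^sub>R f (x i) (y j)))"
    proof (rule sum.cong[OF refl])
      fix i assume "i \<in> I"
      then show "p i *\<^sub>R f (x i) (\<Sum>j\<in>J. q j *\<^sub>R y j) = p i *\<^sub>R (\<Sum>j\<in>J. q j *\<^sub>R f (x i) (y j))"
        using True assms linear_on_sum[of "carrier B" "f (x i)" J y q] by (simp add: bilinear_forms_def)
    qed
    finally show ?thesis
      using True by (simp add: pure_tensor_def fun_sum_apply sum_distrib_left mult.assoc)
  qed (simp add: pure_tensor_def fun_sum_apply)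
qed

lemma span_scaled_generators:
  assumes "z \<in> S" "S \<subseteq> span {z}"
  shows "span S = span {z}"
  using assms by (metis empty_subsetI insert_subset order_antisym span_minimal span_mono subspace_span)

lemma graded_tensor_component:
  assumes "subspace (carrier A)" "subspace (carrier B)" "x \<in> carrier A" "y \<in> carrier B"
    and "component A g = span {x}" "component B h = span {y}"
  shows "component (graded_tensor A B) (g, h) = span {pure_tensor A B x y}"
proof -
  \<comment> \<open>Sums over the singleton \<open>{()}\<close> specialise bilinearity to the
    extraction of two scalars.\<close>
  have "pure_tensor A B (p *\<^sub>R x) (q *\<^sub>R y) = (p * q) *\<^sub>R pure_tensor A B x y" for p q
    using pure_tensor_sums[of A B "{()}" "\<lambda>_. x" "{()}" "\<lambda>_. y" "\<lambda>_. p" "\<lambda>_. q"] assms by simp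
  moreover have "x \<in> component A g" "y \<in> component B h" by (simp_all add: assms span_base)
  ultimately show ?thesis
    by (auto simp: graded_tensor_def assms(5,6) in_span_singleton intro!: span_scaled_generators)
qed

lemma twisted_basis_tensor:
  assumes A: "real_algebra A" and B: "real_algebra B"
    and bA: "twisted_basis A G c e" and bB: "twisted_basis B H d f"
  shows "twisted_basis (graded_tensor A B) (G \<times>\<times> H) (\<lambda>s t. c (fst s) (fst t) * d (snd s) (snd t))
    (\<lambda>s. pure_tensor A B (e (fst s)) (f (snd s)))"
proof -
  interpret A: twisted_basis A G c e by fact
  interpret B: twisted_basis B H d f by fact
  let ?P = "{pure_tensor A B x y | x y. x \<in> carrier A \<and> y \<in> carrier B}"
  let ?b = "\<lambda>s. pure_tensor A B (e (fst s)) (f (snd s))"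
  have carrier: "carrier (graded_tensor A B) = span ?P"
    and mult: "monoid.mult (graded_tensor A B) = tensor_mult A B"
    and one: "\<one>\<^bsub>graded_tensor A B\<^esub> = pure_tensor A B \<one>\<^bsub>A\<^esub> \<one>\<^bsub>B\<^esub>"
    by (simp_all add: graded_tensor_def)
  show ?thesis
  proof (rule twisted_basis.intro)
    show "finite (carrier (G \<times>\<times> H))" by (simp add: A.finite_index B.finite_index)
    show "Group.monoid (G \<times>\<times> H)" by (rule DirProd_monoid[OF A.monoid_index B.monoid_index])
    show "linear_on (carrier (graded_tensor A B)) (\<lambda>x. a \<otimes>\<^bsub>graded_tensor A B\<^esub> x)"
      if "a \<in> carrier (graded_tensor A B)" for a
      using tensor_mult_linear_right[OF A B] that by (simp add: carrier mult)
    show "linear_on (carrier (graded_tensor A B)) (\<lambda>x. x \<otimes>\<^bsub>graded_tensor A B\<^esub> a)" for a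
      using tensor_mult_linear_left[OF A B] by (simp add: carrier mult)
    show "carrier (graded_tensor A B) = span (?b ` carrier (G \<times>\<times> H))"
      unfolding carrier
    proof (intro equalityI span_minimal subspace_span subsetI)
      fix p assume "p \<in> ?P"
      then obtain x y where p: "p = pure_tensor A B x y" "x \<in> carrier A" "y \<in> carrier B" by blast
      obtain r where r: "x = (\<Sum>i\<in>carrier G. r i *\<^sub>R e i)" using A.expand p by blast
      obtain q where q: "y = (\<Sum>i\<in>carrier H. q i *\<^sub>R f i)" using B.expand p by blast
      have "p = (\<Sum>i\<in>carrier G. \<Sum>j\<in>carrier H. (r i * q j) *\<^sub>R ?b (i, j))"
        using pure_tensor_sums[OF A.subspace_carrier B.subspace_carrier, of "carrier G" e "carrier H" f r q]
        by (simp add: p r q)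
      also have "\<dots> \<in> span (?b ` carrier (G \<times>\<times> H))"
        by (intro span_sum span_scale span_base) force
      finally show "p \<in> span (?b ` carrier (G \<times>\<times> H))" .
    next
      fix p assume "p \<in> ?b ` carrier (G \<times>\<times> H)"
      then obtain s where s: "p = ?b s" "fst s \<in> carrier G" "snd s \<in> carrier H" by auto
      have "p \<in> ?P"
        unfolding s(1)
        by (rule CollectI, rule exI[of _ "e (fst s)"], rule exI[of _ "f (snd s)"]) (simp add: s)
      then show "p \<in> span ?P" by (rule span_base)
    qed
    show "r j = 0" if sum: "(\<Sum>i\<in>carrier (G \<times>\<times> H). r i *\<^sub>R ?b i) = 0" and j: "j \<in> carrier (G \<times>\<times> H)" for r j
    proof -
      obtain \<delta> :: "_ \<Rightarrow> _ \<Rightarrow> real" where "(\<forall>i. linear (\<delta> i)) \<and> (\<forall>i. \<forall>j\<in>carrier G. \<delta> i (e j) = (if i = j then 1 else 0))"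
        using A.coord_functional by blast
      then have \<delta>: "\<And>i. linear (\<delta> i)" "\<And>i j. j \<in> carrier G \<Longrightarrow> \<delta> i (e j) = (if i = j then 1 else 0)"
        by auto
      obtain \<epsilon> :: "_ \<Rightarrow> _ \<Rightarrow> real" where "(\<forall>i. linear (\<epsilon> i)) \<and> (\<forall>i. \<forall>j\<in>carrier H. \<epsilon> i (f j) = (if i = j then 1 else 0))"
        using B.coord_functional by blast
      then have \<epsilon>: "\<And>i. linear (\<epsilon> i)" "\<And>i j. j \<in> carrier H \<Longrightarrow> \<epsilon> i (f j) = (if i = j then 1 else 0)"
        by auto
      \<comment> \<open>A tensor is a functional on forms; its value at this product of dual basis
        elements is the coefficient of index \<open>j\<close>.\<close>
      let ?F = "\<lambda>x y. \<delta> (fst j) x * \<epsilon> (snd j) y"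
      have F: "?F \<in> bilinear_forms A B"
        using \<delta>(1) \<epsilon>(1) by (auto simp: bilinear_forms_def linear_on_def linear_add linear_scale algebra_simps)
      have "0 = (\<Sum>i\<in>carrier (G \<times>\<times> H). r i *\<^sub>R ?b i) ?F" unfolding sum by simp
      also have "\<dots> = (\<Sum>i\<in>carrier (G \<times>\<times> H). r i * (if j = i then 1 else 0))"
        unfolding fun_sum_apply using F \<delta>(2) \<epsilon>(2)
        by (intro sum.cong refl) (auto simp: pure_tensor_def prod_eq_iff)
      also have "\<dots> = r j"
        using j A.finite_index B.finite_index by (simp add: if_distrib cong: if_cong)
      finally show ?thesis by simp
    qed
    show "?b s \<otimes>\<^bsub>graded_tensor A B\<^esub> ?b t = (c (fst s) (fst t) * d (snd s) (snd t)) *\<^sub>R ?b (s \<otimes>\<^bsub>G \<times>\<times> H\<^esub> t)"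
      if s: "s \<in> carrier (G \<times>\<times> H)" and t: "t \<in> carrier (G \<times>\<times> H)" for s t
    proof -
      have *: "fst s \<in> carrier G" "fst t \<in> carrier G" "snd s \<in> carrier H" "snd t \<in> carrier H"
        using s t by auto
      then show ?thesis
        using tensor_mult_pure[OF A B, of "e (fst s)" "e (fst t)" "f (snd s)" "f (snd t)"]
          pure_tensor_sums[OF A.subspace_carrier B.subspace_carrier, of "{()}" "\<lambda>_. e (fst (s \<otimes>\<^bsub>G \<times>\<times> H\<^esub> t))"
            "{()}" "\<lambda>_. f (snd (s \<otimes>\<^bsub>G \<times>\<times> H\<^esub> t))" "\<lambda>_. c (fst s) (fst t)" "\<lambda>_. d (snd s) (snd t)"]
        by (simp add: mult A.basis_mult B.basis_mult mult_DirProd')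
    qed
    show "\<one>\<^bsub>graded_tensor A B\<^esub> = ?b \<one>\<^bsub>G \<times>\<times> H\<^esub>" by (simp add: one A.basis_one B.basis_one)
  qed
qed

section \<open>Tensor powers of twisted bases\<close>

lemma multilinear_forms_add_scale:
  "f \<in> multilinear_forms m A \<Longrightarrow> g \<in> multilinear_forms m A \<Longrightarrow>
    (\<lambda>v. c * f v + g v) \<in> multilinear_forms m A"
  by (auto simp: multilinear_forms_def intro!: linear_on_add_scale[where 'b = real, unfolded real_scaleR_def])

lemma PiE_update:
  assumes "v \<in> {..<m} \<rightarrow>\<^sub>E V" "i < m" "x \<in> V"
  shows "v(i := x) \<in> {..<m} \<rightarrow>\<^sub>E V"
  using assms by (auto simp: PiE_iff extensional_def)

context
  fixes A :: "('a::real_vector, 'x) monoid_scheme" and m :: nat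
  assumes A: "real_algebra A"
begin

private abbreviation "tuples \<equiv> {..<m} \<rightarrow>\<^sub>E carrier A"
private abbreviation "pure_powers \<equiv> pure_power m A ` tuples"

text \<open>Plays for \<open>m\<close> factors the role of \<open>translated_bilinear_form\<close>:
  pure powers vanish off \<open>multilinear_forms m A\<close>, and \<open>power_mult\<close>
  evaluates \<open>s\<close> at this function.\<close>

lemma translated_multilinear_form:
  assumes t: "t \<in> span pure_powers" and f: "f \<in> multilinear_forms m A"
  shows "(\<lambda>v. t (\<lambda>w. f (\<lambda>i\<in>{..<m}. v i \<otimes>\<^bsub>A\<^esub> w i))) \<in> multilinear_forms m A"
  using t
proof (induction rule: span_induct_alt)
  case base
  show ?case by (simp add: multilinear_forms_def linear_on_def)
next
  case (step r s t)
  let ?p = "\<lambda>a b. (\<lambda>i\<in>{..<m}. a i \<otimes>\<^bsub>A\<^esub> b i)"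
  note mA = monoid.m_closed[OF real_algebraD(1)[OF A]]
  have closed: "?p a b \<in> tuples" if "a \<in> tuples" "b \<in> tuples" for a b
    using that mA by (auto simp: PiE_iff)
  have lin: "linear_on (carrier A) (\<lambda>x. f (a(i := x)))" if "a \<in> tuples" "i < m" for a i
    using f that by (simp add: multilinear_forms_def)
  obtain w where s: "s = pure_power m A w" and w: "w \<in> tuples" using step by auto
  have in1: "(\<lambda>b. f (?p a b)) \<in> multilinear_forms m A" if a: "a \<in> tuples" for a
    unfolding multilinear_forms_def
  proof (intro CollectI ballI allI impI)
    fix b i assume b: "b \<in> tuples" and i: "i < m"
    have ai: "a i \<in> carrier A" using a i by auto
    have "?p a (b(i := x)) = (?p a b)(i := a i \<otimes>\<^bsub>A\<^esub> x)" for x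
      using i by (auto simp: fun_eq_iff)
    then show "linear_on (carrier A) (\<lambda>x. f (?p a (b(i := x))))"
      using linear_on_compose[OF real_algebraD(3)[OF A ai] lin[OF closed[OF a b] i]] mA ai by simp
  qed
  let ?g = "\<lambda>a. s (\<lambda>b. f (?p a b))"
  have eq: "?g a = f (?p a w)" if "a \<in> tuples" for a
    using in1[OF that] by (simp add: s pure_power_def)
  have "?g \<in> multilinear_forms m A"
    unfolding multilinear_forms_def
  proof (intro CollectI ballI allI impI)
    fix a i assume a: "a \<in> tuples" and i: "i < m"
    have wi: "w i \<in> carrier A" using w i by auto
    have upd: "?p (a(i := x)) w = (?p a w)(i := x \<otimes>\<^bsub>A\<^esub> w i)" for x
      using i by (auto simp: fun_eq_iff)
    have "linear_on (carrier A) (\<lambda>x. f (?p (a(i := x)) w))"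
      unfolding upd using linear_on_compose[OF real_algebraD(4)[OF A wi] lin[OF closed[OF a w] i]] mA wi
      by simp
    moreover have "?g (a(i := x)) = f (?p (a(i := x)) w)" if "x \<in> carrier A" for x
      by (rule eq[OF PiE_update[OF a i that]])
    ultimately show "linear_on (carrier A) (\<lambda>x. ?g (a(i := x)))"
      using linear_on_cong[of "carrier A" "\<lambda>x. ?g (a(i := x))" "\<lambda>x. f (?p (a(i := x)) w)"]
        real_algebraD(2)[OF A] by blast
  qed
  then show ?case
    using multilinear_forms_add_scale[OF _ step(2), of ?g r] by (simp del: restrict_apply)
qed

lemma power_mult_linear_left: "linear_on (span pure_powers) (\<lambda>s. power_mult m A s t)"
  by (auto simp: linear_on_def power_mult_def fun_eq_iff)

lemma power_mult_linear_right:
  assumes "s \<in> span pure_powers"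
  shows "linear_on (span pure_powers) (\<lambda>t. power_mult m A s t)"
  using assms
proof (induction rule: span_induct_alt)
  case base
  show ?case by (auto simp: linear_on_def power_mult_def fun_eq_iff)
next
  case (step r p s)
  then obtain v where p: "p = pure_power m A v" by auto
  have "linear_on (span pure_powers) (\<lambda>t. power_mult m A p t)"
    unfolding linear_on_def
  proof (intro conjI ballI allI)
    fix t u assume tu: "t \<in> span pure_powers" "u \<in> span pure_powers"
    show "power_mult m A p (t + u) = power_mult m A p t + power_mult m A p u"
      using translated_multilinear_form[OF tu(1)] translated_multilinear_form[OF tu(2)]
        translated_multilinear_form[OF span_add[OF tu]]
      by (simp add: fun_eq_iff power_mult_def p pure_power_def)
  next
    fix c t assume t: "t \<in> span pure_powers"
    show "power_mult m A p (c *\<^sub>R t) = c *\<^sub>R power_mult m A p t"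
      using translated_multilinear_form[OF t] translated_multilinear_form[OF span_scale[OF t, of c]]
      by (simp add: fun_eq_iff power_mult_def p pure_power_def)
  qed
  moreover have "power_mult m A (r *\<^sub>R p + s) t = r *\<^sub>R power_mult m A p t + power_mult m A s t" for t
    by (auto simp: fun_eq_iff power_mult_def)
  ultimately show ?case using step(2) by (simp only: linear_on_add_scale)
qed

text \<open>The power is itself a tensor factor of the models (1-b) to (1-d), and
  \<open>twisted_basis_tensor\<close> asks its factors to be real algebras. The monoid laws hold
  entrywise on pure powers.\<close>

lemma real_algebra_tensor_power:
  assumes "carrier T = span pure_powers" "monoid.mult T = power_mult m A"
    "\<one>\<^bsub>T\<^esub> = pure_power m A (\<lambda>i\<in>{..<m}. \<one>\<^bsub>A\<^esub>)"
  shows "real_algebra T"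
proof (rule real_algebra_spanI[of T pure_powers])
  interpret A: Group.monoid A using real_algebraD(1)[OF A] .
  have one: "(\<lambda>i\<in>{..<m}. \<one>\<^bsub>A\<^esub>) \<in> tuples" by auto
  have closed: "(\<lambda>i\<in>{..<m}. v i \<otimes>\<^bsub>A\<^esub> w i) \<in> tuples" if "v \<in> tuples" "w \<in> tuples" for v w
    using that by (auto simp: PiE_iff)
  note mult = power_mult_pure[OF A]
  show "carrier T = span pure_powers" by fact
  show "x \<otimes>\<^bsub>T\<^esub> y \<in> carrier T" if "x \<in> pure_powers" "y \<in> pure_powers" for x y
    using that closed by (auto simp: assms mult intro!: span_base)
  show "x \<otimes>\<^bsub>T\<^esub> y \<otimes>\<^bsub>T\<^esub> z = x \<otimes>\<^bsub>T\<^esub> (y \<otimes>\<^bsub>T\<^esub> z)" if "x \<in> pure_powers" "y \<in> pure_powers" "z \<in> pure_powers" for x y z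
  proof -
    obtain u v w where *: "u \<in> tuples" "v \<in> tuples" "w \<in> tuples" "x = pure_power m A u" "y = pure_power m A v" "z = pure_power m A w"
      using \<open>x \<in> pure_powers\<close> \<open>y \<in> pure_powers\<close> \<open>z \<in> pure_powers\<close> by blast
    have "(\<lambda>i\<in>{..<m}. (\<lambda>i\<in>{..<m}. u i \<otimes>\<^bsub>A\<^esub> v i) i \<otimes>\<^bsub>A\<^esub> w i) = (\<lambda>i\<in>{..<m}. u i \<otimes>\<^bsub>A\<^esub> (\<lambda>i\<in>{..<m}. v i \<otimes>\<^bsub>A\<^esub> w i) i)"
      using * by (intro restrict_ext) (auto simp: PiE_iff A.m_assoc)
    then show ?thesis using * closed by (simp add: assms mult)
  qed
  show "\<one>\<^bsub>T\<^esub> \<in> carrier T" using one by (simp add: assms span_base)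
  show "\<one>\<^bsub>T\<^esub> \<otimes>\<^bsub>T\<^esub> x = x" "x \<otimes>\<^bsub>T\<^esub> \<one>\<^bsub>T\<^esub> = x" if "x \<in> pure_powers" for x
  proof -
    obtain u where *: "u \<in> tuples" "x = pure_power m A u" using \<open>x \<in> pure_powers\<close> by blast
    have "(\<lambda>i\<in>{..<m}. (\<lambda>i\<in>{..<m}. \<one>\<^bsub>A\<^esub>) i \<otimes>\<^bsub>A\<^esub> u i) = u" "(\<lambda>i\<in>{..<m}. u i \<otimes>\<^bsub>A\<^esub> (\<lambda>i\<in>{..<m}. \<one>\<^bsub>A\<^esub>) i) = u"
      using * by (auto simp: PiE_iff extensional_def)
    then show "\<one>\<^bsub>T\<^esub> \<otimes>\<^bsub>T\<^esub> x = x" "x \<otimes>\<^bsub>T\<^esub> \<one>\<^bsub>T\<^esub> = x" using * one by (simp_all add: assms mult)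
  qed
qed (use power_mult_linear_left power_mult_linear_right in \<open>simp_all add: assms\<close>)

end

lemma real_algebra_graded_tensor_power:
  "real_algebra A \<Longrightarrow> real_algebra (graded_tensor_power m A)"
  by (rule real_algebra_tensor_power) (simp_all add: graded_tensor_power_def)

lemma pure_power_linear:
  assumes "v \<in> {..<m} \<rightarrow>\<^sub>E carrier A" "i < m"
  shows "linear_on (carrier A) (\<lambda>x. pure_power m A (v(i := x)))"
  using assms by (auto simp: pure_power_def multilinear_forms_def linear_on_def fun_eq_iff)

lemma pure_power_scale:
  assumes v: "v \<in> {..<m} \<rightarrow>\<^sub>E carrier A" and A: "subspace (carrier A)"
  shows "pure_power m A (\<lambda>i\<in>{..<m}. r i *\<^sub>R v i) = (\<Prod>i<m. r i) *\<^sub>R pure_power m A v"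
proof -
  \<comment> \<open>Linearity in one slot releases one scalar at a time: here the entries below
    \<open>k\<close> have been rescaled.\<close>
  have "pure_power m A (\<lambda>i\<in>{..<m}. if i < k then r i *\<^sub>R v i else v i) = (\<Prod>i<k. r i) *\<^sub>R pure_power m A v"
    if "k \<le> m" for k
    using that
  proof (induction k)
    case 0
    have "restrict v {..<m} = v" using v by auto
    then show ?case by simp
  next
    case (Suc k)
    let ?w = "\<lambda>i\<in>{..<m}. if i < k then r i *\<^sub>R v i else v i"
    have w: "?w \<in> {..<m} \<rightarrow>\<^sub>E carrier A" using v A by (auto simp: PiE_iff subspace_scale)
    have upd: "?w(k := v k) = ?w" using Suc.prems by (auto simp: fun_eq_iff)
    have vk: "v k \<in> carrier A" using PiE_mem[OF v, of k] Suc.prems by simp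
    have k: "k < m" "k \<le> m" using Suc.prems by simp_all
    have "(\<lambda>i\<in>{..<m}. if i < Suc k then r i *\<^sub>R v i else v i) = ?w(k := r k *\<^sub>R v k)"
      using Suc.prems by (auto simp: fun_eq_iff less_Suc_eq)
    then have "pure_power m A (\<lambda>i\<in>{..<m}. if i < Suc k then r i *\<^sub>R v i else v i)
        = pure_power m A (?w(k := r k *\<^sub>R v k))"
      by (simp only:)
    also have "\<dots> = r k *\<^sub>R pure_power m A (?w(k := v k))"
      using pure_power_linear[OF w k(1)] vk unfolding linear_on_def by blast
    also have "\<dots> = r k *\<^sub>R (\<Prod>i<k. r i) *\<^sub>R pure_power m A v"
      unfolding upd Suc.IH[OF k(2)] ..
    finally show ?case by (simp only: scaleR_scaleR prod.lessThan_Suc mult.commute)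
  qed
  moreover have "(\<lambda>i\<in>{..<m}. if i < m then r i *\<^sub>R v i else v i) = (\<lambda>i\<in>{..<m}. r i *\<^sub>R v i)"
    by (rule restrict_ext) simp
  ultimately show ?thesis by (metis order_refl)
qed

lemma graded_tensor_power_component:
  assumes A: "subspace (carrier A)" and v: "v \<in> {..<m} \<rightarrow>\<^sub>E carrier A"
    and comp: "\<And>i. i < m \<Longrightarrow> component A (d i) = span {v i}"
  shows "component (graded_tensor_power m A) d = span {pure_power m A v}"
proof -
  have "component (graded_tensor_power m A) d = span (pure_power m A ` (\<Pi>\<^sub>E i\<in>{..<m}. component A (d i)))"
    by (simp add: graded_tensor_power_def)
  also have "\<dots> = span {pure_power m A v}"
  proof (rule span_scaled_generators)
    show "pure_power m A v \<in> pure_power m A ` (\<Pi>\<^sub>E i\<in>{..<m}. component A (d i))"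
      using v comp by (intro imageI) (auto simp: PiE_iff span_base)
    show "pure_power m A ` (\<Pi>\<^sub>E i\<in>{..<m}. component A (d i)) \<subseteq> span {pure_power m A v}"
    proof (intro image_subsetI)
      fix w assume w: "w \<in> (\<Pi>\<^sub>E i\<in>{..<m}. component A (d i))"
      then have "\<forall>i<m. \<exists>r. w i = r *\<^sub>R v i" using comp by (auto simp: PiE_iff in_span_singleton)
      then obtain r where "\<And>i. i < m \<Longrightarrow> w i = r i *\<^sub>R v i" by metis
      then have "w = (\<lambda>i\<in>{..<m}. r i *\<^sub>R v i)"
        using w by (auto simp: PiE_iff extensional_def fun_eq_iff)
      then show "pure_power m A w \<in> span {pure_power m A v}"
        using pure_power_scale[OF v A, of r] by (auto simp: in_span_singleton)
    qed
  qed
  finally show ?thesis .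
qed

lemma twisted_basis_tensor_power:
  assumes A: "real_algebra A" and bA: "twisted_basis A G c e"
  shows "twisted_basis (graded_tensor_power m A) (product_group {..<m} (\<lambda>_. G))
    (\<lambda>s t. \<Prod>i<m. c (s i) (t i)) (\<lambda>s. pure_power m A (\<lambda>i\<in>{..<m}. e (s i)))"
proof -
  interpret A: twisted_basis A G c e by fact
  let ?T = "graded_tensor_power m A" and ?P = "product_group {..<m} (\<lambda>_. G)"
  let ?b = "\<lambda>s. pure_power m A (\<lambda>i\<in>{..<m}. e (s i))"
  let ?V = "{..<m} \<rightarrow>\<^sub>E carrier A"
  have carrier: "carrier ?T = span (pure_power m A ` ?V)"
    and mult: "monoid.mult ?T = power_mult m A"
    and one: "\<one>\<^bsub>?T\<^esub> = pure_power m A (\<lambda>i\<in>{..<m}. \<one>\<^bsub>A\<^esub>)"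
    by (simp_all add: graded_tensor_power_def)
  have b_mem: "(\<lambda>i\<in>{..<m}. e (s i)) \<in> ?V" if "s \<in> carrier ?P" for s
    using that by (auto simp: PiE_iff)
  show ?thesis
  proof (rule twisted_basis.intro)
    show "finite (carrier ?P)" by (simp add: A.finite_index finite_PiE)
    show "Group.monoid ?P"
      by (rule monoidI) (auto simp: PiE_iff monoid.m_assoc[OF A.monoid_index]
          monoid.l_one[OF A.monoid_index] monoid.r_one[OF A.monoid_index] extensional_def fun_eq_iff)
    show "linear_on (carrier ?T) (\<lambda>x. a \<otimes>\<^bsub>?T\<^esub> x)" if "a \<in> carrier ?T" for a
      using power_mult_linear_right[OF A] that by (simp add: carrier mult)
    show "linear_on (carrier ?T) (\<lambda>x. x \<otimes>\<^bsub>?T\<^esub> a)" for a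
      using power_mult_linear_left[OF A] by (simp add: carrier mult)
    \<comment> \<open>\<open>k\<close> bounds the entries that may fail to be basis elements. The
      induction step expands entry \<open>k\<close> in the basis, and \<open>k = m\<close> covers
      every tuple.\<close>
    have "pure_power m A v \<in> span (?b ` carrier ?P)"
      if "v \<in> ?V" "\<And>i. k \<le> i \<Longrightarrow> i < m \<Longrightarrow> v i \<in> e ` carrier G" "k \<le> m" for v k
      using that
    proof (induction k arbitrary: v)
      case 0
      then obtain s where s: "\<And>i. i < m \<Longrightarrow> v i = e (s i) \<and> s i \<in> carrier G"
        by (simp add: image_iff Bex_def) metis
      then have "v = (\<lambda>i\<in>{..<m}. e (restrict s {..<m} i))"
        using 0 by (auto simp: PiE_iff extensional_def fun_eq_iff)
      then have "pure_power m A v = ?b (restrict s {..<m})" by (simp only:)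
      moreover have "restrict s {..<m} \<in> carrier ?P" using s by auto
      ultimately show ?case by (intro span_base image_eqI)
    next
      case (Suc k)
      then have "v k \<in> carrier A" by auto
      then obtain r where r: "v k = (\<Sum>j\<in>carrier G. r j *\<^sub>R e j)" using A.expand by blast
      have "pure_power m A v = (\<Sum>j\<in>carrier G. r j *\<^sub>R pure_power m A (v(k := e j)))"
        using linear_on_sum[OF pure_power_linear[OF Suc.prems(1)] A.subspace_carrier, of k "carrier G" e r] Suc.prems
        by (simp flip: r)
      moreover have "pure_power m A (v(k := e j)) \<in> span (?b ` carrier ?P)" if "j \<in> carrier G" for j
      proof (rule Suc.IH)
        show "v(k := e j) \<in> ?V" using Suc.prems that by (intro PiE_update) auto
        show "(v(k := e j)) i \<in> e ` carrier G" if "k \<le> i" "i < m" for i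
          using Suc.prems(2)[of i] that \<open>j \<in> carrier G\<close> by (cases "i = k") auto
      qed (use Suc.prems in simp)
      ultimately show ?case by (simp only: span_sum span_scale)
    qed
    from this[of _ m] have "pure_power m A ` ?V \<subseteq> span (?b ` carrier ?P)" by auto
    moreover have "?b ` carrier ?P \<subseteq> pure_power m A ` ?V"
      using b_mem by (intro image_subsetI imageI)
    ultimately show "carrier ?T = span (?b ` carrier ?P)"
      unfolding carrier by (intro equalityI span_minimal subspace_span) (meson span_superset order_trans)+
    show "r j = 0" if sum: "(\<Sum>i\<in>carrier ?P. r i *\<^sub>R ?b i) = 0" and j: "j \<in> carrier ?P" for r j
    proof -
      obtain \<delta> :: "_ \<Rightarrow> _ \<Rightarrow> real" where "(\<forall>i. linear (\<delta> i)) \<and> (\<forall>i. \<forall>j\<in>carrier G. \<delta> i (e j) = (if i = j then 1 else 0))"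
        using A.coord_functional by blast
      then have \<delta>: "\<And>i. linear (\<delta> i)" "\<And>i j. j \<in> carrier G \<Longrightarrow> \<delta> i (e j) = (if i = j then 1 else 0)"
        by auto
      \<comment> \<open>Each slot occurs in exactly one factor, whence multilinearity. On tuples of
        basis elements this form is the indicator of the index \<open>j\<close>.\<close>
      let ?F = "\<lambda>v. \<Prod>i<m. \<delta> (j i) (v i)"
      have F: "?F \<in> multilinear_forms m A"
        unfolding multilinear_forms_def
      proof (intro CollectI ballI allI impI)
        fix v i assume i: "i < m"
        have "?F (v(i := x)) = \<delta> (j i) x * (\<Prod>k\<in>{..<m} - {i}. \<delta> (j k) (v k))" for x
          using i by (subst prod.remove[of _ i]) auto
        then show "linear_on (carrier A) (\<lambda>x. ?F (v(i := x)))"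
          using \<delta>(1) by (simp add: linear_on_def linear_add linear_scale algebra_simps)
      qed
      have F_b: "?F (\<lambda>k\<in>{..<m}. e (i k)) = (if j = i then 1 else 0)" if i: "i \<in> carrier ?P" for i
      proof (cases "j = i")
        case True
        then show ?thesis using i by (auto simp: \<delta>(2) PiE_iff intro!: prod.neutral)
      next
        case False
        have "\<exists>k<m. j k \<noteq> i k"
        proof (rule ccontr)
          assume "\<not> ?thesis"
          then have "j = i"
            by (intro PiE_ext[of j "{..<m}" "\<lambda>_. carrier G" i]) (use i j in auto)
          with False show False by simp
        qed
        then obtain k where k: "k < m" "j k \<noteq> i k" by blast
        then have "\<delta> (j k) ((\<lambda>k\<in>{..<m}. e (i k)) k) = 0" using i \<delta>(2)[of "i k" "j k"] by (simp add: PiE_iff)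
        then have "?F (\<lambda>k\<in>{..<m}. e (i k)) = 0" using k by (intro prod_zero bexI[of _ k]) auto
        then show ?thesis using False by (simp only: if_False)
      qed
      have "0 = (\<Sum>i\<in>carrier ?P. r i *\<^sub>R ?b i) ?F" unfolding sum by simp
      also have "\<dots> = (\<Sum>i\<in>carrier ?P. r i * (if j = i then 1 else 0))"
        unfolding fun_sum_apply using F F_b
        by (intro sum.cong refl) (simp add: pure_power_def)
      also have "\<dots> = r j"
        using j A.finite_index by (simp add: if_distrib finite_PiE cong: if_cong)
      finally show ?thesis by simp
    qed
    show "?b s \<otimes>\<^bsub>?T\<^esub> ?b t = (\<Prod>i<m. c (s i) (t i)) *\<^sub>R ?b (s \<otimes>\<^bsub>?P\<^esub> t)"
      if s: "s \<in> carrier ?P" and t: "t \<in> carrier ?P" for s t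
    proof -
      have "(\<lambda>i\<in>{..<m}. (\<lambda>i\<in>{..<m}. e (s i)) i \<otimes>\<^bsub>A\<^esub> (\<lambda>i\<in>{..<m}. e (t i)) i)
        = (\<lambda>i\<in>{..<m}. c (s i) (t i) *\<^sub>R (\<lambda>i\<in>{..<m}. e ((s \<otimes>\<^bsub>?P\<^esub> t) i)) i)"
        using s t by (auto simp: A.basis_mult PiE_iff fun_eq_iff)
      then show ?thesis
        using power_mult_pure[OF A b_mem[OF s] b_mem[OF t]]
          pure_power_scale[OF b_mem A.subspace_carrier, of "s \<otimes>\<^bsub>?P\<^esub> t" "\<lambda>i. c (s i) (t i)"] s t
        by (simp add: mult PiE_iff)
    qed
    show "\<one>\<^bsub>?T\<^esub> = ?b \<one>\<^bsub>?P\<^esub>" by (simp add: one A.basis_one cong: restrict_cong)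
  qed
qed

section \<open>The standard factors\<close>

text \<open>With A, B the basis elements of degrees a, b, that of degree \<open>(r, s)\<close> is
  A^r B^s, where A^2 = B^2 = 1 and BA = -AB. The sign is the cost of moving the B of the left factor
  past the A of the right one.\<close>

definition M2R_coeff :: "int \<times> int \<Rightarrow> int \<times> int \<Rightarrow> real"
  where "M2R_coeff s t = (if snd s = 1 \<and> fst t = 1 then - 1 else 1)"

text \<open>The basis element of degree \<open>(r, s)\<close> is i^r j^s, with k = ij. The three
  signs come from i^2 = -1, j^2 = -1 and ji = -ij.\<close>

definition HH_coeff :: "int \<times> int \<Rightarrow> int \<times> int \<Rightarrow> real"
  where "HH_coeff s t = (if fst s = 1 \<and> fst t = 1 then - 1 else 1) *
    (if snd s = 1 \<and> snd t = 1 then - 1 else 1) * (if snd s = 1 \<and> fst t = 1 then - 1 else 1)"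

definition CC_coeff :: "int \<Rightarrow> int \<Rightarrow> real"
  where "CC_coeff s t = (if s = 1 \<and> t = 1 then - 1 else 1)"

text \<open>With \<open>A, B\<close> the basis elements of degrees \<open>a, b\<close>, one has \<open>B A = - A B\<close> and \<open>B\<^sup>2 = 2 i\<close>, and the
  basis element of degree \<open>a\<^sup>r b\<^sup>s\<close> is \<open>A\<^sup>r B\<^sup>s\<close>, divided by \<open>2\<close> if \<open>s \<ge> 2\<close>.\<close>

definition M2C_coeff :: "int \<times> int \<Rightarrow> int \<times> int \<Rightarrow> real"
  where "M2C_coeff s t = (if odd (snd s) \<and> fst t = 1 then - 1 else 1) *
    (if odd (snd s) \<and> odd (snd t) then 2 else 1) * (if 4 \<le> snd s + snd t then - 1 else 1)"

lemma carrier_Z2: "carrier Z2 = {0, 1}" and carrier_Z4: "carrier Z4 = {0, 1, 2, 3}"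
  by (auto simp: carrier_integer_mod_group)

lemma carrier_Z2_Z2: "carrier (Z2 \<times>\<times> Z2) = {(0, 0), (0, 1), (1, 0), (1, 1)}"
  and carrier_Z2_Z4: "carrier (Z2 \<times>\<times> Z4) = {(0, 0), (0, 1), (0, 2), (0, 3), (1, 0), (1, 1), (1, 2), (1, 3)}"
  by (auto simp: carrier_Z2 carrier_Z4)

lemma group_Z2_Z2 [simp]: "group (Z2 \<times>\<times> Z2)" and group_Z2_Z4 [simp]: "group (Z2 \<times>\<times> Z4)"
  by (simp_all add: DirProd_group)

lemma real_algebra_matrix:
  assumes "carrier A = (UNIV :: ('a::real_algebra_1^'n^'n) set)" "monoid.mult A = (**)" "\<one>\<^bsub>A\<^esub> = mat 1"
  shows "real_algebra A"
proof -
  have "Group.monoid A" by (rule monoidI) (simp_all add: assms matrix_mul_assoc)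
  then show ?thesis
    unfolding real_algebra_def linear_on_def
    by (auto simp: assms matrix_matrix_mult_def vec_eq_iff sum.distrib distrib_right distrib_left
        scaleR_sum_right)
qed

lemma real_algebra_M2R: "real_algebra M2R" and real_algebra_M2C: "real_algebra M2C"
  by (rule real_algebra_matrix; simp add: M2R_def M2C_def)+

lemma real_algebra_CC: "real_algebra CC"
  unfolding real_algebra_def linear_on_def
  by (auto simp: CC_def algebra_simps intro!: monoidI)

lemma real_algebra_RR: "real_algebra RR"
  unfolding real_algebra_def linear_on_def
  by (auto simp: RR_def algebra_simps intro!: monoidI)

lemma real_algebra_HH: "real_algebra HH"
  unfolding real_algebra_def linear_on_def
  by (auto simp: HH_def algebra_simps intro!: monoidI)

lemma twisted_basisI:
  assumes "real_algebra A" "group G" "finite (carrier G)" "carrier A = UNIV"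
    and "\<And>x. \<exists>r. x = (\<Sum>i\<in>carrier G. r i *\<^sub>R e i)"
    and "\<And>r j. (\<Sum>i\<in>carrier G. r i *\<^sub>R e i) = 0 \<Longrightarrow> j \<in> carrier G \<Longrightarrow> r j = 0"
    and "\<And>s t. s \<in> carrier G \<Longrightarrow> t \<in> carrier G \<Longrightarrow> e s \<otimes>\<^bsub>A\<^esub> e t = c s t *\<^sub>R e (s \<otimes>\<^bsub>G\<^esub> t)"
    and "\<one>\<^bsub>A\<^esub> = e \<one>\<^bsub>G\<^esub>"
  shows "twisted_basis A G c e"
  by (rule twisted_basis.intro)
    (use assms span_image_eq_sums[OF assms(3), of e] in
      \<open>auto simp: real_algebra_def intro: group.is_monoid\<close>)

lemmas mat2_simps = vec_eq_iff forall_2 vector_2 matrix_matrix_mult_def sum_2 mat_def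

lemma twisted_basis_M2R: "twisted_basis M2R (Z2 \<times>\<times> Z2) M2R_coeff M2R_basis"
proof (rule twisted_basisI[OF real_algebra_M2R], goal_cases)
  \<comment> \<open>Goal 4 is spanning, 5 independence, 6 the multiplication table. The diagonal of
    \<open>x\<close> fixes the coefficients of degrees e and a, the antidiagonal those of b and
    ab.\<close>
  case (4 x)
  show ?case
    by (rule exI[of _ "(\<lambda>_. 0)((0,0) := (x$1$1 + x$2$2) / 2, (1,0) := (x$2$2 - x$1$1) / 2,
        (0,1) := (x$1$2 + x$2$1) / 2, (1,1) := (x$2$1 - x$1$2) / 2)"])
      (unfold carrier_Z2_Z2, simp add: M2R_basis_def mat2_simps field_simps)
next
  case (5 r j)
  have "(\<Sum>i\<in>carrier (Z2 \<times>\<times> Z2). r i *\<^sub>R M2R_basis i) $ p $ q = 0" for p q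
    unfolding 5 by simp
  from this[of 1 1] this[of 1 2] this[of 2 1] this[of 2 2]
  have "r (0, 0) = r (1, 0)" "r (0, 1) = r (1, 1)" "r (0, 1) = - r (1, 1)" "r (0, 0) = - r (1, 0)"
    unfolding carrier_Z2_Z2 by (simp_all add: M2R_basis_def mat2_simps)
  then show ?case using 5(2) unfolding carrier_Z2_Z2 by auto
next
  case (6 s t)
  then show ?case
    unfolding carrier_Z2_Z2 by (elim insertE emptyE; simp add: M2R_basis_def M2R_coeff_def mat2_simps M2R_def)
qed (auto simp: carrier_Z2 M2R_def M2R_basis_def mat2_simps)

lemma twisted_basis_HH: "twisted_basis HH (Z2 \<times>\<times> Z2) HH_coeff quat_basis"
proof (rule twisted_basisI[OF real_algebra_HH], goal_cases)
  case (4 x)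
  obtain p q r s where "x = (p, q, r, s)" by (cases x)
  then show ?case
    by (intro exI[of _ "(\<lambda>_. 0)((0,0) := p, (1,0) := q, (0,1) := r, (1,1) := s)"])
      (unfold carrier_Z2_Z2, simp add: quat_basis_def)
next
  case (5 r j)
  then show ?case
    unfolding carrier_Z2_Z2 by (auto simp: quat_basis_def zero_prod_def)
next
  case (6 s t)
  then show ?case
    unfolding carrier_Z2_Z2 by (elim insertE emptyE; simp add: quat_basis_def HH_coeff_def HH_def)
qed (auto simp: carrier_Z2 HH_def quat_basis_def)

lemma twisted_basis_CC: "twisted_basis CC Z2 CC_coeff CC_basis"
proof (rule twisted_basisI[OF real_algebra_CC], goal_cases)
  case (4 x)
  show ?case
    by (rule exI[of _ "(\<lambda>_. 0)(0 := Re x, 1 := Im x)"])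
      (simp add: carrier_Z2 CC_basis_def complex_eq_iff)
next
  case (5 r j)
  then show ?case
    unfolding carrier_Z2 by (auto simp: CC_basis_def complex_eq_iff)
next
  case (6 s t)
  then show ?case
    unfolding carrier_Z2 by (auto simp: CC_basis_def CC_coeff_def CC_def complex_eq_iff)
qed (auto simp: carrier_Z2 CC_def CC_basis_def)

lemma twisted_basis_M2C: "twisted_basis M2C (Z2 \<times>\<times> Z4) M2C_coeff M2C_basis"
proof (rule twisted_basisI[OF real_algebra_M2C], goal_cases)
  case (4 x)
  \<comment> \<open>The sums \<open>?s\<close>, \<open>?p\<close> see only the degrees with even
    second entry. The difference \<open>?d\<close> is 2((1 + i) r + (-1 + i) r') for the
    coefficients r, r' of degrees b, b^3, so real and imaginary part give r - r' and r + r';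
    \<open>?m\<close> does the same for ab, ab^3.\<close>
  let ?s = "x$1$1 + x$2$2" and ?d = "x$1$1 - x$2$2" and ?p = "x$1$2 + x$2$1" and ?m = "x$2$1 - x$1$2"
  show ?case
    by (rule exI[of _ "(\<lambda>_. 0)((0,0) := Re ?s / 2, (0,2) := Im ?s / 2, (1,0) := Re ?p / 2, (1,2) := Im ?p / 2,
        (0,1) := (Re ?d + Im ?d) / 4, (0,3) := (Im ?d - Re ?d) / 4,
        (1,1) := (Re ?m + Im ?m) / 4, (1,3) := (Im ?m - Re ?m) / 4)"])
      (unfold carrier_Z2_Z4, simp add: M2C_basis_def mat2_simps complex_eq_iff field_simps)
next
  case (5 r j)
  have "(\<Sum>i\<in>carrier (Z2 \<times>\<times> Z4). r i *\<^sub>R M2C_basis i) $ p $ q = 0" for p q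
    unfolding 5 by simp
  from this[of 1 1] this[of 1 2] this[of 2 1] this[of 2 2]
  have "r (0, 0) + r (0, 1) = r (0, 3)" "r (0, 1) + r (0, 2) + r (0, 3) = 0"
    "r (0, 0) - r (0, 1) + r (0, 3) = 0" "r (0, 2) - r (0, 1) - r (0, 3) = 0"
    "r (1, 0) + r (1, 1) = r (1, 3)" "r (1, 1) + r (1, 2) + r (1, 3) = 0"
    "r (1, 0) - r (1, 1) + r (1, 3) = 0" "r (1, 2) - r (1, 1) - r (1, 3) = 0"
    unfolding carrier_Z2_Z4 by (simp_all add: M2C_basis_def mat2_simps complex_eq_iff)
  then show ?case using 5(2) unfolding carrier_Z2_Z4 by auto
next
  case (6 s t)
  then show ?case
    unfolding carrier_Z2_Z4 by (elim insertE emptyE; simp add: M2C_basis_def M2C_coeff_def M2C_def mat2_simps complex_eq_iff)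
qed (auto simp: carrier_Z2 carrier_Z4 M2C_def M2C_basis_def mat2_simps)

section \<open>Index groups\<close>

lemma isoI_inverse:
  assumes "\<And>x. x \<in> carrier G \<Longrightarrow> f x \<in> carrier H" "\<And>y. y \<in> carrier H \<Longrightarrow> f' y \<in> carrier G"
    and "\<And>x. x \<in> carrier G \<Longrightarrow> f' (f x) = x" "\<And>y. y \<in> carrier H \<Longrightarrow> f (f' y) = y"
    and "\<And>x y. x \<in> carrier G \<Longrightarrow> y \<in> carrier G \<Longrightarrow> f (x \<otimes>\<^bsub>G\<^esub> y) = f x \<otimes>\<^bsub>H\<^esub> f y"
  shows "f \<in> iso G H"
  using assms by (auto simp: iso_def hom_def intro!: bij_betw_byWitness[where f' = f'])

lemma PiE_Suc_restrict:
  assumes "d \<in> {..<Suc m} \<rightarrow>\<^sub>E V"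
  shows "restrict d {..<m} \<in> {..<m} \<rightarrow>\<^sub>E V" "d m \<in> V" "(restrict d {..<m})(m := d m) = d"
  using assms by (auto simp: PiE_iff extensional_def fun_eq_iff less_Suc_eq)

lemma PiE_Suc_update:
  assumes "d \<in> {..<m} \<rightarrow>\<^sub>E V" "x \<in> V"
  shows "d(m := x) \<in> {..<Suc m} \<rightarrow>\<^sub>E V" "restrict (d(m := x)) {..<m} = d"
  using assms by (auto simp: PiE_iff extensional_def fun_eq_iff less_Suc_eq)

lemma product_group_Suc_iso:
  "(\<lambda>d. (restrict d {..<m}, d m)) \<in> iso (product_group {..<Suc m} (\<lambda>_. G)) (product_group {..<m} (\<lambda>_. G) \<times>\<times> G)"
proof (rule isoI_inverse[where f' = "\<lambda>(d, x). d(m := x)"])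
  fix d assume "d \<in> carrier (product_group {..<Suc m} (\<lambda>_. G))"
  from PiE_Suc_restrict[OF this[unfolded carrier_product_group]]
  show "(restrict d {..<m}, d m) \<in> carrier (product_group {..<m} (\<lambda>_. G) \<times>\<times> G)"
    "(case (restrict d {..<m}, d m) of (d, x) \<Rightarrow> d(m := x)) = d"
    by (simp_all del: restrict_apply)
next
  fix y assume "y \<in> carrier (product_group {..<m} (\<lambda>_. G) \<times>\<times> G)"
  then obtain d x where y: "y = (d, x)" "d \<in> {..<m} \<rightarrow>\<^sub>E carrier G" "x \<in> carrier G" by auto
  from PiE_Suc_update[OF y(2,3)]
  show "(case y of (d, x) \<Rightarrow> d(m := x)) \<in> carrier (product_group {..<Suc m} (\<lambda>_. G))"
    "(restrict (case y of (d, x) \<Rightarrow> d(m := x)) {..<m}, (case y of (d, x) \<Rightarrow> d(m := x)) m) = y"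
    by (simp_all add: y(1) del: restrict_apply)
qed (auto simp: fun_eq_iff)

lemma product_group_Suc: "product_group {..<Suc m} (\<lambda>_. G) \<cong> product_group {..<m} (\<lambda>_. G) \<times>\<times> G"
  using product_group_Suc_iso unfolding is_iso_def by blast

lemma DirProd_assoc': "(G \<times>\<times> H) \<times>\<times> K \<cong> G \<times>\<times> (H \<times>\<times> K)"
proof -
  have "(\<lambda>((x, y), z). (x, (y, z))) \<in> iso ((G \<times>\<times> H) \<times>\<times> K) (G \<times>\<times> (H \<times>\<times> K))"
    by (rule isoI_inverse[where f' = "\<lambda>(x, (y, z)). ((x, y), z)"]) auto
  then show ?thesis unfolding is_iso_def by blast
qed

lemma product_group_squares:
  fixes m :: nat
  shows "product_group {..<m} (\<lambda>_. Z2 \<times>\<times> Z2) \<cong> product_group {..<2 * m} (\<lambda>_. Z2)"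
proof (induction m)
  case 0
  \<comment> \<open>An empty product group has one element, the extensional function on the empty
    set, which is constantly \<open>undefined\<close>.\<close>
  have "(\<lambda>_ _. undefined) \<in> iso (product_group {..<0::nat} (\<lambda>_. Z2 \<times>\<times> Z2)) (product_group {..<0::nat} (\<lambda>_. Z2))"
    by (rule isoI_inverse[where f' = "\<lambda>_ _. undefined"]) auto
  then show ?case unfolding is_iso_def by auto
next
  case (Suc m)
  let ?P = "\<lambda>n. product_group {..<n::nat} (\<lambda>_. Z2)"
  have P: "group (?P n)" for n by simp
  have "product_group {..<Suc m} (\<lambda>_. Z2 \<times>\<times> Z2) \<cong> product_group {..<m} (\<lambda>_. Z2 \<times>\<times> Z2) \<times>\<times> (Z2 \<times>\<times> Z2)"
    by (rule product_group_Suc)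
  also have "\<dots> \<cong> ?P (2 * m) \<times>\<times> (Z2 \<times>\<times> Z2)"
    by (rule group.DirProd_iso_trans[OF _ Suc.IH]) simp_all
  also have "\<dots> \<cong> (?P (2 * m) \<times>\<times> Z2) \<times>\<times> Z2"
    by (rule group.iso_sym[OF _ DirProd_assoc']) (simp add: DirProd_group P)
  also have "\<dots> \<cong> ?P (Suc (2 * m)) \<times>\<times> Z2"
    by (rule group.DirProd_iso_trans[OF _ group.iso_sym[OF P product_group_Suc]]) (simp_all add: DirProd_group P)
  also have "\<dots> \<cong> ?P (Suc (Suc (2 * m)))"
    by (rule group.iso_sym[OF P product_group_Suc])
  finally show ?case by simp
qed

lemma product_group_squares_Z2:
  fixes m :: nat
  shows
  "product_group {..<m} (\<lambda>_. Z2 \<times>\<times> Z2) \<times>\<times> Z2 \<cong> product_group {..<2 * m + 1} (\<lambda>_. Z2)"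
proof -
  have "product_group {..<m} (\<lambda>_. Z2 \<times>\<times> Z2) \<times>\<times> Z2 \<cong> product_group {..<2 * m} (\<lambda>_. Z2) \<times>\<times> Z2"
    by (rule group.DirProd_iso_trans[OF _ product_group_squares]) simp_all
  also have "\<dots> \<cong> product_group {..<Suc (2 * m)} (\<lambda>_. Z2)"
    by (rule group.iso_sym[OF _ product_group_Suc]) simp
  finally show ?thesis by simp
qed

lemma product_group_squares_Z2_Z4:
  fixes m :: nat
  shows
  "product_group {..<m} (\<lambda>_. Z2 \<times>\<times> Z2) \<times>\<times> (Z2 \<times>\<times> Z4) \<cong> product_group {..<2 * m + 1} (\<lambda>_. Z2) \<times>\<times> Z4"
proof -
  have "product_group {..<m} (\<lambda>_. Z2 \<times>\<times> Z2) \<times>\<times> (Z2 \<times>\<times> Z4) \<cong> (product_group {..<m} (\<lambda>_. Z2 \<times>\<times> Z2) \<times>\<times> Z2) \<times>\<times> Z4"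
    by (rule group.iso_sym[OF _ DirProd_assoc']) (simp add: DirProd_group)
  also have "\<dots> \<cong> product_group {..<2 * m + 1} (\<lambda>_. Z2) \<times>\<times> Z4"
    by (rule group.DirProd_iso_trans[OF _ product_group_squares_Z2]) (simp_all add: DirProd_group)
  finally show ?thesis .
qed

abbreviation (input) Pauli_group :: "nat \<Rightarrow> (nat \<Rightarrow> int \<times> int) monoid"
  where "Pauli_group m \<equiv> product_group {..<m} (\<lambda>_. Z2 \<times>\<times> Z2)"

lemma Pauli_group_at:
  assumes "d \<in> carrier (Pauli_group m)" "i < m"
  shows "d i \<in> carrier (Z2 \<times>\<times> Z2)"
  using PiE_mem[of d "{..<m}" "\<lambda>_. carrier (Z2 \<times>\<times> Z2)" i] assms
  unfolding carrier_product_group by simp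

text \<open>Structure constants of \<open>m\<close> copies of \<open>M2R\<close> tensored with one
  last factor whose constants are \<open>c\<close>. All items take this shape; for (1-a) the last
  factor is \<open>\<real>\<close>, indexed by the trivial group.\<close>

definition Pauli_coeff ::
    "nat \<Rightarrow> ('i \<Rightarrow> 'i \<Rightarrow> real) \<Rightarrow> (nat \<Rightarrow> int \<times> int) \<times> 'i \<Rightarrow> (nat \<Rightarrow> int \<times> int) \<times> 'i \<Rightarrow> real"
  where "Pauli_coeff m c s t = (\<Prod>i<m. M2R_coeff (fst s i) (fst t i)) * c (snd s) (snd t)"

abbreviation (input) trivial_coeff :: "unit \<Rightarrow> unit \<Rightarrow> real"
  where "trivial_coeff \<equiv> \<lambda>_ _. 1"

section \<open>Matrix algebras\<close>

lemma carrier_matrix_algebra: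
  "carrier (matrix_algebra n F) = {M. \<forall>i j. if i < n \<and> j < n then M i j \<in> carrier F else M i j = 0}"
  and mult_matrix_algebra: "M \<otimes>\<^bsub>matrix_algebra n F\<^esub> N = (\<lambda>i j. if i < n \<and> j < n then \<Sum>k<n. M i k \<otimes>\<^bsub>F\<^esub> N k j else 0)"
  and one_matrix_algebra: "\<one>\<^bsub>matrix_algebra n F\<^esub> = (\<lambda>i j. if i < n \<and> i = j then \<one>\<^bsub>F\<^esub> else 0)"
  by (simp_all add: matrix_algebra_def)

lemma matrix_algebra_entry:
  "M \<in> carrier (matrix_algebra n F) \<Longrightarrow> i < n \<Longrightarrow> j < n \<Longrightarrow> M i j \<in> carrier F"
  "M \<in> carrier (matrix_algebra n F) \<Longrightarrow> \<not> (i < n \<and> j < n) \<Longrightarrow> M i j = 0"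
  unfolding carrier_matrix_algebra by (auto split: if_splits)

lemma real_algebra_mult:
  fixes F :: "('a::real_vector, 'x) monoid_scheme" (structure)
  assumes F: "real_algebra F" and "x \<in> carrier F" "y \<in> carrier F"
  shows "z \<in> carrier F \<Longrightarrow> x \<otimes> (y + z) = x \<otimes> y + x \<otimes> z"
    and "z \<in> carrier F \<Longrightarrow> (y + z) \<otimes> x = y \<otimes> x + z \<otimes> x"
    and "x \<otimes> (r *\<^sub>R y) = r *\<^sub>R (x \<otimes> y)" and "(r *\<^sub>R x) \<otimes> y = r *\<^sub>R (x \<otimes> y)"
  using real_algebraD(3,4)[OF F assms(2)] real_algebraD(4)[OF F assms(3)] assms(2,3)
  by (simp_all add: linear_on_def)

lemma matrix_algebra_linear:
  assumes F: "real_algebra F" and M: "M \<in> carrier (matrix_algebra n F)"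
  shows "linear_on (carrier (matrix_algebra n F)) (\<lambda>N. M \<otimes>\<^bsub>matrix_algebra n F\<^esub> N)"
    and "linear_on (carrier (matrix_algebra n F)) (\<lambda>N. N \<otimes>\<^bsub>matrix_algebra n F\<^esub> M)"
proof -
  note simps = real_algebra_mult[OF F] matrix_algebra_entry(1)[OF M] matrix_algebra_entry(1)
  show "linear_on (carrier (matrix_algebra n F)) (\<lambda>N. M \<otimes>\<^bsub>matrix_algebra n F\<^esub> N)"
    unfolding linear_on_def mult_matrix_algebra
    by (auto simp: fun_eq_iff simps scaleR_sum_right simp flip: sum.distrib intro!: sum.cong)
  show "linear_on (carrier (matrix_algebra n F)) (\<lambda>N. N \<otimes>\<^bsub>matrix_algebra n F\<^esub> M)"
    unfolding linear_on_def mult_matrix_algebra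
    by (auto simp: fun_eq_iff simps scaleR_sum_right simp flip: sum.distrib intro!: sum.cong)
qed

lemma twisted_basis_transport:
  assumes A: "twisted_basis A G c e" and lin: "linear \<psi>"
    and inj: "\<And>x. x \<in> carrier A \<Longrightarrow> \<psi> x = 0 \<Longrightarrow> x = 0"
    and img: "\<psi> ` carrier A = carrier B"
    and mult: "\<And>x y. x \<in> carrier A \<Longrightarrow> y \<in> carrier A \<Longrightarrow> \<psi> (x \<otimes>\<^bsub>A\<^esub> y) = \<psi> x \<otimes>\<^bsub>B\<^esub> \<psi> y"
    and one: "\<psi> \<one>\<^bsub>A\<^esub> = \<one>\<^bsub>B\<^esub>"
    and left: "\<And>a. a \<in> carrier B \<Longrightarrow> linear_on (carrier B) (\<lambda>x. a \<otimes>\<^bsub>B\<^esub> x)"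
    and right: "\<And>a. a \<in> carrier B \<Longrightarrow> linear_on (carrier B) (\<lambda>x. x \<otimes>\<^bsub>B\<^esub> a)"
  shows "twisted_basis B G c (\<lambda>s. \<psi> (e s))"
proof -
  interpret A: twisted_basis A G c e by fact
  show ?thesis
  proof (rule twisted_basis.intro)
    show "carrier B = span ((\<lambda>s. \<psi> (e s)) ` carrier G)"
      using linear_span_image[OF lin, of "e ` carrier G"]
      by (simp add: img[symmetric] A.carrier_eq_span image_image)
    show "r j = 0" if "(\<Sum>i\<in>carrier G. r i *\<^sub>R \<psi> (e i)) = 0" "j \<in> carrier G" for r j
    proof -
      have "\<psi> (\<Sum>i\<in>carrier G. r i *\<^sub>R e i) = 0"
        using that by (simp add: linear_sum[OF lin] linear_scale[OF lin])
      then have "(\<Sum>i\<in>carrier G. r i *\<^sub>R e i) = 0" by (intro inj A.sum_in_carrier) auto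
      then show ?thesis by (rule A.indep[OF _ that(2)])
    qed
  qed (use A.finite_index A.monoid_index left right in
      \<open>auto simp: mult[symmetric] A.basis_mult linear_scale[OF lin] one[symmetric] A.basis_one\<close>)
qed

lemma twisted_basis_matrix_1:
  assumes F: "real_algebra F" and b: "twisted_basis F G c e"
  shows "twisted_basis (matrix_algebra 1 F) G c (\<lambda>s i j. if i = 0 \<and> j = 0 then e s else 0)"
proof (rule twisted_basis_transport[OF b])
  show "linear (\<lambda>x i j. if i = 0 \<and> j = 0 then x else 0)" by (auto simp: linear_iff fun_eq_iff)
  show "(\<lambda>x i j. if i = 0 \<and> j = 0 then x else 0) ` carrier F = carrier (matrix_algebra 1 F)"
  proof (intro equalityI subsetI)
    fix M assume M: "M \<in> carrier (matrix_algebra 1 F)"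
    then have "M = (\<lambda>i j. if i = 0 \<and> j = 0 then M 0 0 else 0)"
      by (auto simp: fun_eq_iff carrier_matrix_algebra)
    then show "M \<in> (\<lambda>x i j. if i = 0 \<and> j = 0 then x else 0) ` carrier F"
      by (rule image_eqI) (use matrix_algebra_entry(1)[OF M, of 0 0] in simp)
  qed (auto simp: carrier_matrix_algebra)
  show "linear_on (carrier (matrix_algebra 1 F)) (\<lambda>x. a \<otimes>\<^bsub>matrix_algebra 1 F\<^esub> x)"
    "linear_on (carrier (matrix_algebra 1 F)) (\<lambda>x. x \<otimes>\<^bsub>matrix_algebra 1 F\<^esub> a)"
    if "a \<in> carrier (matrix_algebra 1 F)" for a
    using matrix_algebra_linear[OF F that] by simp_all
qed (auto simp: fun_eq_iff mult_matrix_algebra one_matrix_algebra split: if_splits)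

text \<open>An index \<open>i < 2 n\<close> splits into \<open>i div 2 < n\<close> and the parity of \<open>i\<close>, an index into a matrix
  of type \<open>real^2^2\<close>; in the index type, \<open>2\<close> and \<open>0\<close> are the same element.\<close>

definition index_parity :: "nat \<Rightarrow> 2"
  where "index_parity i = (if even i then 1 else 2)"

definition index_offset :: "2 \<Rightarrow> nat"
  where "index_offset p = (if p = 1 then 0 else 1)"

lemma index_parity_simps [simp]: "index_parity (2 * i + index_offset p) = p" "(2 * i + index_offset p) div 2 = i" "index_offset (index_parity i) = i mod 2"
  using exhaust_2[of p] by (auto simp: index_parity_def index_offset_def odd_iff_mod_2_eq_one)

lemma index_offset_less: "2 * i + index_offset p < 2 * n \<longleftrightarrow> i < n"
  by (auto simp: index_offset_def)

lemma sum_index_parity: "(\<Sum>k<2 * n. f (index_parity k) (k div 2)) = (\<Sum>k<n. \<Sum>p\<in>UNIV. f p k)" for n :: nat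
  by (induction n) (simp_all add: index_parity_def sum_2 add.assoc)

text \<open>The Kronecker product with the 2 by 2 factor inside: block
  \<open>(i div 2, j div 2)\<close> is the real matrix \<open>N\<close> times an entry of
  \<open>M\<close>. Entries of \<open>M\<close> may lie in any real algebra, since \<open>N\<close>
  acts on them by scalars.\<close>

definition kronecker :: "(nat \<Rightarrow> nat \<Rightarrow> 'a::real_vector) \<Rightarrow> real^2^2 \<Rightarrow> nat \<Rightarrow> nat \<Rightarrow> 'a"
  where "kronecker M N i j = N $ index_parity i $ index_parity j *\<^sub>R M (i div 2) (j div 2)"

lemma kronecker_sums:
  "kronecker (\<Sum>i\<in>I. p i *\<^sub>R M i) (\<Sum>j\<in>J. q j *\<^sub>R N j) = (\<Sum>i\<in>I. \<Sum>j\<in>J. (p i * q j) *\<^sub>R kronecker (M i) (N j))"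
  by (rule ext)+
    (simp add: kronecker_def fun_sum_apply scaleR_sum_left scaleR_sum_right sum_distrib_left mult_ac)

lemma kronecker_scale: "kronecker (p *\<^sub>R M) (q *\<^sub>R N) = (p * q) *\<^sub>R kronecker M N"
  by (rule ext)+ (simp add: kronecker_def)

lemma kronecker_in_carrier:
  assumes "subspace (carrier F)" "M \<in> carrier (matrix_algebra n F)"
  shows "kronecker M N \<in> carrier (matrix_algebra (2 * n) F)"
proof -
  have "i div 2 < n \<longleftrightarrow> i < 2 * n" for i by auto
  then show ?thesis
    using matrix_algebra_entry[OF assms(2)] assms(1)
    by (auto simp: kronecker_def carrier_matrix_algebra intro!: subspace_scale)
qed

text \<open>The mixed product rule: the summation index splits into quotient and parity, and the
  real entries of \<open>N\<close>, \<open>N'\<close> pull out of the product of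
  \<open>F\<close>.\<close>

lemma kronecker_mult:
  assumes F: "real_algebra F" and M: "M \<in> carrier (matrix_algebra n F)" "M' \<in> carrier (matrix_algebra n F)"
  shows "kronecker M N \<otimes>\<^bsub>matrix_algebra (2 * n) F\<^esub> kronecker M' N' = kronecker (M \<otimes>\<^bsub>matrix_algebra n F\<^esub> M') (N ** N')"
proof (intro ext)
  fix i j
  note F = real_algebraD[OF F]
  have scale: "(r *\<^sub>R x) \<otimes>\<^bsub>F\<^esub> (s *\<^sub>R y) = (r * s) *\<^sub>R (x \<otimes>\<^bsub>F\<^esub> y)" if "x \<in> carrier F" "y \<in> carrier F" for r s x y
    using F(3)[of "r *\<^sub>R x"] F(4)[of y] that subspace_scale[OF F(2)] by (simp add: linear_on_def mult.commute)
  have iff: "i div 2 < n \<longleftrightarrow> i < 2 * n" for i by auto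
  show "(kronecker M N \<otimes>\<^bsub>matrix_algebra (2 * n) F\<^esub> kronecker M' N') i j = kronecker (M \<otimes>\<^bsub>matrix_algebra n F\<^esub> M') (N ** N') i j"
  proof (cases "i < 2 * n \<and> j < 2 * n")
    case True
    then have "(kronecker M N \<otimes>\<^bsub>matrix_algebra (2 * n) F\<^esub> kronecker M' N') i j
      = (\<Sum>k<2 * n. (N $ index_parity i $ index_parity k * N' $ index_parity k $ index_parity j) *\<^sub>R (M (i div 2) (k div 2) \<otimes>\<^bsub>F\<^esub> M' (k div 2) (j div 2)))"
      using matrix_algebra_entry(1)[OF M(1)] matrix_algebra_entry(1)[OF M(2)]
      by (auto simp: mult_matrix_algebra kronecker_def scale iff intro!: sum.cong)
    also have "\<dots> = (\<Sum>k<n. \<Sum>p\<in>UNIV. (N $ index_parity i $ p * N' $ p $ index_parity j) *\<^sub>R (M (i div 2) k \<otimes>\<^bsub>F\<^esub> M' k (j div 2)))"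
      by (rule sum_index_parity)
    also have "\<dots> = kronecker (M \<otimes>\<^bsub>matrix_algebra n F\<^esub> M') (N ** N') i j"
      using True by (simp add: kronecker_def mult_matrix_algebra iff matrix_matrix_mult_def scaleR_sum_left scaleR_sum_right)
    finally show ?thesis .
  qed (auto simp: mult_matrix_algebra kronecker_def iff)
qed

lemma twisted_basis_kronecker:
  assumes F: "real_algebra F" and b: "twisted_basis (matrix_algebra n F) G c e"
  shows "twisted_basis (matrix_algebra (2 * n) F) (G \<times>\<times> (Z2 \<times>\<times> Z2))
    (\<lambda>s t. c (fst s) (fst t) * M2R_coeff (snd s) (snd t)) (\<lambda>s. kronecker (e (fst s)) (M2R_basis (snd s)))"
proof -
  interpret A: twisted_basis "matrix_algebra n F" G c e by fact
  interpret B: twisted_basis M2R "Z2 \<times>\<times> Z2" M2R_coeff M2R_basis by (rule twisted_basis_M2R)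
  let ?M = "matrix_algebra (2 * n) F" and ?H = "Z2 \<times>\<times> Z2"
  let ?b = "\<lambda>s. kronecker (e (fst s)) (M2R_basis (snd s))"
  have sub: "subspace (carrier F)" by (rule real_algebraD(2)[OF F])
  have in_span: "kronecker M N \<in> span (?b ` carrier (G \<times>\<times> ?H))" if M: "M \<in> carrier (matrix_algebra n F)" for M N
  proof -
    obtain r where r: "M = (\<Sum>i\<in>carrier G. r i *\<^sub>R e i)" using A.expand[OF M] by blast
    have "N \<in> carrier M2R" by (simp add: M2R_def)
    then obtain q where q: "N = (\<Sum>j\<in>carrier ?H. q j *\<^sub>R M2R_basis j)" using B.expand by blast
    have "kronecker M N = (\<Sum>i\<in>carrier G. \<Sum>j\<in>carrier ?H. (r i * q j) *\<^sub>R ?b (i, j))"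
      by (simp only: r q kronecker_sums fst_conv snd_conv)
    also have "\<dots> \<in> span (?b ` carrier (G \<times>\<times> ?H))"
    proof (intro span_sum span_scale span_base)
      fix i j assume "i \<in> carrier G" "j \<in> carrier ?H"
      then have "(i, j) \<in> carrier (G \<times>\<times> ?H)" by (simp del: carrier_DirProd add: carrier_DirProd[of G ?H])
      then show "?b (i, j) \<in> ?b ` carrier (G \<times>\<times> ?H)" by (rule imageI)
    qed
    finally show ?thesis .
  qed
  show ?thesis
  proof (rule twisted_basis.intro)
    show "finite (carrier (G \<times>\<times> ?H))" using A.finite_index B.finite_index by simp
    show "Group.monoid (G \<times>\<times> ?H)" by (rule DirProd_monoid[OF A.monoid_index B.monoid_index])
    show "carrier ?M = span (?b ` carrier (G \<times>\<times> ?H))"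
    proof (intro equalityI span_minimal subsetI)
      fix M assume M: "M \<in> carrier ?M"
      \<comment> \<open>\<open>?blk p q\<close> collects the entries of \<open>M\<close> whose
        indices have the parities \<open>p\<close>, \<open>q\<close>, and \<open>?u p q\<close> is
        the matching matrix unit; \<open>M\<close> is the sum of their Kronecker products.\<close>
      let ?blk = "\<lambda>p q i j. M (2 * i + index_offset p) (2 * j + index_offset q)"
      let ?u = "\<lambda>p q. (\<chi> r s. if r = p \<and> s = q then 1 else 0) :: real^2^2"
      have blk: "?blk p q \<in> carrier (matrix_algebra n F)" for p q
        using matrix_algebra_entry[OF M] by (auto simp: carrier_matrix_algebra index_offset_less)
      have "M = (\<Sum>p\<in>UNIV. \<Sum>q\<in>UNIV. kronecker (?blk p q) (?u p q))"
      proof (intro ext)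
        fix i j
        have "(\<Sum>p\<in>UNIV. \<Sum>q\<in>UNIV. kronecker (?blk p q) (?u p q)) i j
          = (\<Sum>p\<in>UNIV. \<Sum>q\<in>UNIV. if index_parity i = p then if index_parity j = q then ?blk p q (i div 2) (j div 2) else 0 else 0)"
          unfolding fun_sum_apply by (intro sum.cong refl) (simp add: kronecker_def)
        also have "\<dots> = (\<Sum>p\<in>UNIV. if index_parity i = p then (\<Sum>q\<in>UNIV. if index_parity j = q then ?blk p q (i div 2) (j div 2) else 0) else 0)"
          by (intro sum.cong refl) simp
        also have "\<dots> = M i j" by simp
        finally show "M i j = (\<Sum>p\<in>UNIV. \<Sum>q\<in>UNIV. kronecker (?blk p q) (?u p q)) i j" ..
      qed
      also have "\<dots> \<in> span (?b ` carrier (G \<times>\<times> ?H))"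
        by (intro span_sum in_span blk)
      finally show "M \<in> span (?b ` carrier (G \<times>\<times> ?H))" .
    next
      fix M assume "M \<in> ?b ` carrier (G \<times>\<times> ?H)"
      then show "M \<in> carrier ?M" by (auto intro!: kronecker_in_carrier[OF sub])
    next
      show "subspace (carrier ?M)"
        using sub by (auto simp: subspace_def carrier_matrix_algebra split: if_splits)
    qed
    show "r j = 0" if sum: "(\<Sum>i\<in>carrier (G \<times>\<times> ?H). r i *\<^sub>R ?b i) = 0" and j: "j \<in> carrier (G \<times>\<times> ?H)" for r j
    proof -
      \<comment> \<open>Independence is shown in two stages. Entries with fixed parities
        \<open>p\<close>, \<open>q\<close> give a relation among the \<open>e g\<close>, so each
        coefficient, the \<open>(p, q)\<close> entry of a combination of \<open>M2R_basis\<close>,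
        vanishes; then independence of \<open>M2R_basis\<close> applies.\<close>
      have eq: "(\<Sum>h\<in>carrier ?H. r (g, h) *\<^sub>R M2R_basis h) $ p $ q = 0" if g: "g \<in> carrier G" for g p q
      proof -
        have "(\<Sum>g\<in>carrier G. ((\<Sum>h\<in>carrier ?H. r (g, h) *\<^sub>R M2R_basis h) $ p $ q) *\<^sub>R e g) = 0"
        proof (intro ext)
          fix i j
          have "(\<Sum>g\<in>carrier G. ((\<Sum>h\<in>carrier ?H. r (g, h) *\<^sub>R M2R_basis h) $ p $ q) *\<^sub>R e g) i j
            = (\<Sum>g\<in>carrier G. \<Sum>h\<in>carrier ?H. (r (g, h) *\<^sub>R ?b (g, h)) (2 * i + index_offset p) (2 * j + index_offset q))"
            by (simp add: fun_sum_apply kronecker_def scaleR_sum_left)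
          also have "\<dots> = (\<Sum>s\<in>carrier (G \<times>\<times> ?H). r s *\<^sub>R ?b s) (2 * i + index_offset p) (2 * j + index_offset q)"
            unfolding fun_sum_apply carrier_DirProd[of G ?H] by (simp add: sum.cartesian_product split_def)
          finally show "(\<Sum>g\<in>carrier G. ((\<Sum>h\<in>carrier ?H. r (g, h) *\<^sub>R M2R_basis h) $ p $ q) *\<^sub>R e g) i j = 0 i j"
            unfolding sum by simp
        qed
        from A.indep[OF this g] show ?thesis .
      qed
      obtain g h where gh: "j = (g, h)" "g \<in> carrier G" "h \<in> carrier ?H"
        using j unfolding carrier_DirProd[of G ?H] by blast
      have "(\<Sum>h\<in>carrier ?H. r (g, h) *\<^sub>R M2R_basis h) = 0"
        using eq[OF gh(2)] by (simp only: vec_eq_iff zero_index)  simp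
      from B.indep[OF this gh(3)] show ?thesis by (simp add: gh(1))
    qed
    show "?b s \<otimes>\<^bsub>?M\<^esub> ?b t = (c (fst s) (fst t) * M2R_coeff (snd s) (snd t)) *\<^sub>R ?b (s \<otimes>\<^bsub>G \<times>\<times> ?H\<^esub> t)"
      if s: "s \<in> carrier (G \<times>\<times> ?H)" and t: "t \<in> carrier (G \<times>\<times> ?H)" for s t
    proof -
      have *: "fst s \<in> carrier G" "fst t \<in> carrier G" "snd s \<in> carrier ?H" "snd t \<in> carrier ?H"
        using s t unfolding carrier_DirProd[of G ?H] by auto
      have "?b s \<otimes>\<^bsub>?M\<^esub> ?b t = kronecker (e (fst s) \<otimes>\<^bsub>matrix_algebra n F\<^esub> e (fst t)) (M2R_basis (snd s) ** M2R_basis (snd t))"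
        by (intro kronecker_mult F A.basis_in_carrier *)
      also have "M2R_basis (snd s) ** M2R_basis (snd t) = M2R_coeff (snd s) (snd t) *\<^sub>R M2R_basis (snd s \<otimes>\<^bsub>?H\<^esub> snd t)"
        using B.basis_mult[OF *(3,4)] by (simp add: M2R_def)
      finally show ?thesis
        by (simp only: A.basis_mult[OF *(1,2)] mult_DirProd'[of G ?H] kronecker_scale fst_conv snd_conv)
    qed
    have "kronecker (\<one>\<^bsub>matrix_algebra n F\<^esub>) (mat 1) = \<one>\<^bsub>?M\<^esub>"
    proof (intro ext)
      fix i j :: nat
      have "index_parity i = index_parity j \<and> i div 2 = j div 2 \<longleftrightarrow> i = j"
        by (metis index_parity_simps(3) mult_div_mod_eq)
      then show "kronecker (\<one>\<^bsub>matrix_algebra n F\<^esub>) (mat 1) i j = \<one>\<^bsub>?M\<^esub> i j"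
        by (auto simp: kronecker_def one_matrix_algebra mat_def)
    qed
    then show "\<one>\<^bsub>?M\<^esub> = ?b \<one>\<^bsub>G \<times>\<times> ?H\<^esub>"
      using A.basis_one B.basis_one by (simp add: M2R_def)
  qed (use matrix_algebra_linear[OF F] in auto)
qed

text \<open>\<open>kronecker\<close> attaches the new copy of \<open>H\<close> behind
  \<open>G\<close>, while the index group of \<open>Pauli_coeff\<close> keeps \<open>G\<close> last;
  this map reorders.\<close>

lemma product_group_Suc_DirProd_iso:
  "(\<lambda>s. ((restrict (fst s) {..<m}, snd s), fst s m)) \<in>
    iso (product_group {..<Suc m} (\<lambda>_. H) \<times>\<times> G) ((product_group {..<m} (\<lambda>_. H) \<times>\<times> G) \<times>\<times> H)"
proof (rule isoI_inverse[where f' = "\<lambda>t. ((fst (fst t))(m := snd t), snd (fst t))"], goal_cases)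
  case (1 s)
  then show ?case
    using PiE_Suc_restrict(1,2)[of "fst s" m "carrier H"] by (simp add: mem_Times_iff del: restrict_apply)
next
  case (2 t)
  then show ?case
    using PiE_Suc_update(1)[of "fst (fst t)" m "carrier H" "snd t"] by (simp add: mem_Times_iff)
next
  case (3 s)
  then show ?case
    using PiE_Suc_restrict(3)[of "fst s" m "carrier H"] by (simp add: mem_Times_iff del: restrict_apply)
next
  case (4 t)
  then show ?case
    using PiE_Suc_update(2)[of "fst (fst t)" m "carrier H" "snd t"]
    by (simp add: mem_Times_iff del: restrict_apply)
next
  case (5 s t)
  then show ?case by (simp add: mult_DirProd' fun_eq_iff)
qed

text \<open>Each Kronecker product with 2 by 2 matrices doubles the size and adds one copy of
  \<open>Z2 \<times>\<times> Z2\<close>. The start is \<open>n = 1\<close> over \<open>RR\<close>,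
  \<open>HH\<close>, \<open>CC\<close>, and for (1-d) \<open>n = 2\<close> over \<open>CC\<close>,
  where the basis of \<open>M2C\<close> lives.\<close>

lemma twisted_basis_matrix_algebra:
  assumes F: "real_algebra F" and b: "twisted_basis (matrix_algebra n F) G c e"
  obtains e' where "twisted_basis (matrix_algebra (2 ^ m * n) F) (Pauli_group m \<times>\<times> G) (Pauli_coeff m c) e'"
proof -
  have G: "Group.monoid G" by (rule twisted_basis.monoid_index[OF b])
  have mon: "Group.monoid (Pauli_group m \<times>\<times> G)" for m
    by (rule DirProd_monoid[OF group.is_monoid G]) simp
  have "\<exists>e'. twisted_basis (matrix_algebra (2 ^ m * n) F) (Pauli_group m \<times>\<times> G) (Pauli_coeff m c) e'"
  proof (induction m)
    case 0
    have "snd \<in> iso (Pauli_group 0 \<times>\<times> G) G"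
      by (rule isoI_inverse[where f' = "Pair (\<lambda>_. undefined)"]) (auto simp: mult_DirProd')
    from twisted_basis_reindex[OF b this mon] show ?case
      by (auto simp: Pauli_coeff_def)
  next
    case (Suc m)
    then obtain e' where "twisted_basis (matrix_algebra (2 ^ m * n) F) (Pauli_group m \<times>\<times> G) (Pauli_coeff m c) e'" ..
    from twisted_basis_reindex[OF twisted_basis_kronecker[OF F this] product_group_Suc_DirProd_iso mon]
    have "twisted_basis (matrix_algebra (2 * (2 ^ m * n)) F) (Pauli_group (Suc m) \<times>\<times> G) (Pauli_coeff (Suc m) c)
      (\<lambda>s. kronecker (e' (restrict (fst s) {..<m}, snd s)) (M2R_basis (fst s m)))"
      by (rule twisted_basis_cong) (auto simp: Pauli_coeff_def mult_ac)
    note basis = this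
    show ?case unfolding power_Suc mult.assoc by (rule exI, rule basis)
  qed
  then show thesis using that by blast
qed

lemma twisted_basis_RR: "twisted_basis RR (singleton_group ()) trivial_coeff (\<lambda>_. 1)"
  by (rule twisted_basisI[OF real_algebra_RR]) (auto simp: RR_def)

lemma twisted_basis_matrix_CC_2:
  "twisted_basis (matrix_algebra 2 CC) (Z2 \<times>\<times> Z4) M2C_coeff
    (\<lambda>s i j. if i < 2 \<and> j < 2 then M2C_basis s $ index_parity i $ index_parity j else 0)"
proof (rule twisted_basis_transport[OF twisted_basis_M2C])
  let ?\<psi> = "\<lambda>(M :: complex^2^2) i j. if i < (2::nat) \<and> j < (2::nat) then M $ index_parity i $ index_parity j else 0"
  show "linear ?\<psi>" by (auto simp: linear_iff fun_eq_iff)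
  have off: "index_parity (index_offset p) = p" "index_offset p < 2" for p
    using exhaust_2[of p] by (auto simp: index_parity_def index_offset_def)
  have par: "index_offset (index_parity i) = i" if "i < 2" for i
    using that by (auto simp: index_parity_def index_offset_def less_2_cases_iff)
  show "M = 0" if "?\<psi> M = 0" for M
  proof -
    have "M $ p $ q = 0" for p q
      using fun_cong[OF fun_cong[OF that, of "index_offset p"], of "index_offset q"] by (simp add: off)
    then show ?thesis by (simp add: vec_eq_iff)
  qed
  show "?\<psi> ` carrier M2C = carrier (matrix_algebra 2 CC)"
  proof (intro equalityI subsetI)
    fix M assume M: "M \<in> carrier (matrix_algebra 2 CC)"
    have "M = ?\<psi> (\<chi> p q. M (index_offset p) (index_offset q))"
      using matrix_algebra_entry(2)[OF M] by (auto simp: fun_eq_iff par)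
    then show "M \<in> ?\<psi> ` carrier M2C" by (rule image_eqI) (simp add: M2C_def)
  qed (auto simp: carrier_matrix_algebra CC_def)
  have "{..<2::nat} = {0, 1}" by auto
  then show "?\<psi> (x \<otimes>\<^bsub>M2C\<^esub> y) = ?\<psi> x \<otimes>\<^bsub>matrix_algebra 2 CC\<^esub> ?\<psi> y" for x y
    by (auto simp: fun_eq_iff mult_matrix_algebra M2C_def CC_def matrix_matrix_mult_def sum_2 index_parity_def)
  show "?\<psi> \<one>\<^bsub>M2C\<^esub> = \<one>\<^bsub>matrix_algebra 2 CC\<^esub>"
    by (auto simp: fun_eq_iff one_matrix_algebra M2C_def CC_def mat_def index_parity_def less_2_cases_iff)
qed (use matrix_algebra_linear[OF real_algebra_CC] in auto)

section \<open>The items of the list\<close>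

text \<open>Items (1-a) to (1-d) correspond to \<open>G\<close> trivial, \<open>\<int>\<^sub>2\<^sup>2\<close>, \<open>\<int>\<^sub>2\<close> and \<open>\<int>\<^sub>2 \<times> \<int>\<^sub>4\<close>.\<close>

definition Pauli_type ::
    "('a::real_vector, 'g) graded_algebra \<Rightarrow> nat \<Rightarrow> 'i monoid \<Rightarrow> ('i \<Rightarrow> 'i \<Rightarrow> real) \<Rightarrow> bool"
  where "Pauli_type X m G c \<longleftrightarrow> (\<exists>e. twisted_basis X (Pauli_group m \<times>\<times> G) (Pauli_coeff m c) e \<and>
    component X ` support X = (\<lambda>s. span {e s}) ` carrier (Pauli_group m \<times>\<times> G))"

text \<open>Equivalence ignores the degrees, so it is enough that the isomorphism given by equal
  structure constants matches the two sets of lines.\<close>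

lemma Pauli_type_equivalent:
  assumes "Pauli_type X m G c" "Pauli_type Y m G c"
  shows "graded_equivalent X Y"
proof -
  let ?G = "Pauli_group m \<times>\<times> G"
  obtain e where e: "twisted_basis X ?G (Pauli_coeff m c) e"
    and compX: "component X ` support X = (\<lambda>s. span {e s}) ` carrier ?G"
    using assms(1) unfolding Pauli_type_def by blast
  obtain f where f: "twisted_basis Y ?G (Pauli_coeff m c) f"
    and compY: "component Y ` support Y = (\<lambda>s. span {f s}) ` carrier ?G"
    using assms(2) unfolding Pauli_type_def by blast
  obtain \<psi> where \<psi>: "\<psi> \<in> algebra_iso X Y" "linear \<psi>" "\<And>s. s \<in> carrier ?G \<Longrightarrow> \<psi> (e s) = f s"
    using twisted_basis_iso[OF e f] by blast
  have "\<exists>h\<in>carrier (grading_group Y). \<psi> ` component X g = component Y h" if "g \<in> support X" for g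
  proof -
    obtain s where s: "s \<in> carrier ?G" "component X g = span {e s}"
      using imageI[OF \<open>g \<in> support X\<close>, of "component X"] unfolding compX by blast
    have "\<psi> ` component X g = span {f s}"
      using linear_span_image[OF \<psi>(2), of "{e s}"] \<psi>(3)[OF s(1)] by (simp add: s(2))
    moreover obtain h where "h \<in> support Y" "component Y h = span {f s}"
      using imageI[OF s(1), of "\<lambda>s. span {f s}"] unfolding compY[symmetric] by blast
    ultimately show ?thesis unfolding support_def by auto
  qed
  then show ?thesis using \<psi>(1) unfolding graded_equivalent_def by blast
qed

text \<open>No explicit map from tensors to matrices is written down: both algebras have bases with
  the same structure constants.\<close>

lemma Pauli_type_matrix_algebra:
  assumes "Pauli_type X m G c" and F: "real_algebra F" and "twisted_basis (matrix_algebra n F) G c e"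
  shows "algebras_isomorphic X (matrix_algebra (2 ^ m * n) F)"
proof -
  obtain e' where e': "twisted_basis (matrix_algebra (2 ^ m * n) F) (Pauli_group m \<times>\<times> G) (Pauli_coeff m c) e'"
    using twisted_basis_matrix_algebra[OF F assms(3)] by blast
  obtain f where f: "twisted_basis X (Pauli_group m \<times>\<times> G) (Pauli_coeff m c) f"
    using assms(1) unfolding Pauli_type_def by blast
  show ?thesis
    using twisted_basis_iso[OF f e'] unfolding algebras_isomorphic_def by blast
qed

lemma components_eq_lines:
  assumes "twisted_basis X G c e" "bij_betw \<phi> (carrier G) (carrier (grading_group X))"
    and "\<And>s. s \<in> carrier G \<Longrightarrow> component X (\<phi> s) = span {e s}"
  shows "component X ` support X = (\<lambda>s. span {e s}) ` carrier G"
proof -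
  interpret twisted_basis X G c e by fact
  have "component X (\<phi> s) \<noteq> {0}" if "s \<in> carrier G" for s
    using basis_nonzero[OF that] assms(3)[OF that] span_base[of "e s" "{e s}"] by auto
  moreover have im: "\<phi> ` carrier G = carrier (grading_group X)" using assms(2) by (simp add: bij_betw_def)
  ultimately have "support X = \<phi> ` carrier G"
    unfolding support_def im[symmetric] by auto
  then show ?thesis using assms(3) by (simp add: image_image)
qed

lemma Pauli_type_tensor:
  assumes F: "real_algebra F" and b: "twisted_basis F G c f"
    and G: "grading_group F = G" and comp: "\<And>g. component F g = span {f g}"
  shows "Pauli_type (graded_tensor (graded_tensor_power m M2R) F) m G c"
proof -
  let ?P = "graded_tensor_power m M2R"
  let ?p = "\<lambda>d. pure_power m M2R (\<lambda>i\<in>{..<m}. M2R_basis (d i))"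
  let ?e = "\<lambda>s. pure_tensor ?P F (?p (fst s)) (f (snd s))"
  have P: "real_algebra ?P" by (rule real_algebra_graded_tensor_power[OF real_algebra_M2R])
  have bP: "twisted_basis ?P (Pauli_group m) (\<lambda>s t. \<Prod>i<m. M2R_coeff (s i) (t i)) ?p"
    by (rule twisted_basis_tensor_power[OF real_algebra_M2R twisted_basis_M2R])
  have e: "twisted_basis (graded_tensor ?P F) (Pauli_group m \<times>\<times> G) (Pauli_coeff m c) ?e"
    using twisted_basis_tensor[OF P F bP b] unfolding Pauli_coeff_def .
  have carM: "carrier M2R = UNIV" "component M2R g = span {M2R_basis g}" for g
    by (simp_all add: M2R_def)
  have "component (graded_tensor ?P F) s = span {?e s}" if s: "s \<in> carrier (Pauli_group m \<times>\<times> G)" for s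
  proof -
    have *: "fst s \<in> carrier (Pauli_group m)" "snd s \<in> carrier G"
      using s unfolding carrier_DirProd[of "Pauli_group m"] by (simp_all only: mem_Times_iff)
    have "component ?P (fst s) = span {?p (fst s)}"
      by (rule graded_tensor_power_component) (auto simp: carM)
    from graded_tensor_component[OF real_algebraD(2)[OF P] real_algebraD(2)[OF F]
        twisted_basis.basis_in_carrier[OF bP *(1)] twisted_basis.basis_in_carrier[OF b *(2)] this comp]
    show ?thesis by simp
  qed
  moreover have "grading_group (graded_tensor ?P F) = Pauli_group m \<times>\<times> G"
    by (simp add: graded_tensor_def graded_tensor_power_def M2R_def G)
  ultimately have "component (graded_tensor ?P F) ` support (graded_tensor ?P F)
      = (\<lambda>s. span {?e s}) ` carrier (Pauli_group m \<times>\<times> G)"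
    by (intro components_eq_lines[OF e, of id]) (simp_all del: carrier_DirProd)
  then show ?thesis using e unfolding Pauli_type_def by blast
qed

lemma DirProd_singleton_iso: "fst \<in> iso (G \<times>\<times> singleton_group ()) G"
  by (rule isoI_inverse[where f' = "\<lambda>d. (d, ())"]) (auto simp: mult_DirProd')

text \<open>(1-a) has no last factor, so its index group is padded with the trivial group to fit the
  common shape.\<close>

lemma Pauli_type_model_a: "Pauli_type (model_a m) m (singleton_group ()) trivial_coeff"
proof -
  let ?p = "\<lambda>d. pure_power m M2R (\<lambda>i\<in>{..<m}. M2R_basis (d i))"
  let ?G = "Pauli_group m \<times>\<times> singleton_group ()"
  have bP: "twisted_basis (model_a m) (Pauli_group m) (\<lambda>s t. \<Prod>i<m. M2R_coeff (s i) (t i)) ?p"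
    unfolding model_a_def by (rule twisted_basis_tensor_power[OF real_algebra_M2R twisted_basis_M2R])
  have iso: "fst \<in> iso ?G (Pauli_group m)"
    by (rule DirProd_singleton_iso)
  have "Group.monoid ?G" by (intro group.is_monoid DirProd_group) simp_all
  from twisted_basis_reindex[OF bP iso this]
  have e: "twisted_basis (model_a m) ?G (Pauli_coeff m trivial_coeff) (\<lambda>s. ?p (fst s))"
    by (simp add: Pauli_coeff_def[abs_def])
  have carM: "carrier M2R = UNIV" "component M2R g = span {M2R_basis g}" for g
    by (simp_all add: M2R_def)
  have "bij_betw fst (carrier ?G) (carrier (grading_group (model_a m)))"
    using iso by (simp add: iso_def model_a_def graded_tensor_power_def M2R_def)
  moreover have "component (model_a m) (fst s) = span {?p (fst s)}" for s :: "(nat \<Rightarrow> int \<times> int) \<times> unit"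
    unfolding model_a_def by (rule graded_tensor_power_component) (auto simp: carM)
  ultimately have "component (model_a m) ` support (model_a m) = (\<lambda>s. span {?p (fst s)}) ` carrier ?G"
    by (rule components_eq_lines[OF e])
  then show ?thesis using e unfolding Pauli_type_def by blast
qed

text \<open>Holds for \<open>m = 0\<close> too, where truncated subtraction makes
  \<open>model_b 0\<close> equal to \<open>model_b 1\<close>; the list avoids the repetition by
  \<open>m \<ge> 1\<close>. The same goes for \<open>model_d\<close>.\<close>

lemma Pauli_type_model_b: "Pauli_type (model_b m) (m - 1) (Z2 \<times>\<times> Z2) HH_coeff"
  unfolding model_b_def
  by (rule Pauli_type_tensor[OF real_algebra_HH twisted_basis_HH]) (simp_all add: HH_def)

lemma Pauli_type_model_c: "Pauli_type (model_c m) m Z2 CC_coeff"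
  unfolding model_c_def
  by (rule Pauli_type_tensor[OF real_algebra_CC twisted_basis_CC]) (simp_all add: CC_def)

lemma Pauli_type_model_d: "Pauli_type (model_d m) (m - 1) (Z2 \<times>\<times> Z4) M2C_coeff"
  unfolding model_d_def
  by (rule Pauli_type_tensor[OF real_algebra_M2C twisted_basis_M2C]) (simp_all add: M2C_def)

lemma model_a_matrix_algebra: "algebras_isomorphic (model_a m) (matrix_algebra (2 ^ m) RR)"
  using Pauli_type_matrix_algebra[OF Pauli_type_model_a real_algebra_RR
      twisted_basis_matrix_1[OF real_algebra_RR twisted_basis_RR]] by simp

lemma model_b_matrix_algebra: "m \<ge> 1 \<Longrightarrow> algebras_isomorphic (model_b m) (matrix_algebra (2 ^ m div 2) HH)"
  using Pauli_type_matrix_algebra[OF Pauli_type_model_b real_algebra_HH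
      twisted_basis_matrix_1[OF real_algebra_HH twisted_basis_HH], of m] by (cases m) simp_all

lemma model_c_matrix_algebra: "algebras_isomorphic (model_c m) (matrix_algebra (2 ^ m) CC)"
  using Pauli_type_matrix_algebra[OF Pauli_type_model_c real_algebra_CC
      twisted_basis_matrix_1[OF real_algebra_CC twisted_basis_CC]] by simp

lemma model_d_matrix_algebra: "m \<ge> 1 \<Longrightarrow> algebras_isomorphic (model_d m) (matrix_algebra (2 ^ m) CC)"
  using Pauli_type_matrix_algebra[OF Pauli_type_model_d real_algebra_CC twisted_basis_matrix_CC_2, of m]
  by (cases m) (simp_all add: mult.commute)

lemma grading_group_models:
  "grading_group (model_a m) = Pauli_group m"
  "grading_group (model_b m) = Pauli_group (m - 1) \<times>\<times> (Z2 \<times>\<times> Z2)"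
  "grading_group (model_c m) = Pauli_group m \<times>\<times> Z2"
  "grading_group (model_d m) = Pauli_group (m - 1) \<times>\<times> (Z2 \<times>\<times> Z4)"
  by (simp_all add: model_a_def model_b_def model_c_def model_d_def graded_tensor_def
      graded_tensor_power_def M2R_def HH_def CC_def M2C_def)

section \<open>Uniqueness\<close>

text \<open>An invariant of a line under isomorphism, as it mentions only product and unit.
  Rescaling multiplies squares by positive numbers, so at most one of the values 1 and -1 can apply
  to a line.\<close>

definition square_sign :: "('a::real_vector, 'x) monoid_scheme \<Rightarrow> 'a set \<Rightarrow> real"
  where "square_sign A L = (if \<exists>x\<in>L. x \<otimes>\<^bsub>A\<^esub> x = \<one>\<^bsub>A\<^esub> then 1
    else if \<exists>x\<in>L. x \<otimes>\<^bsub>A\<^esub> x = - \<one>\<^bsub>A\<^esub> then - 1 else 0)"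

lemma (in twisted_basis) basis_proportional:
  assumes "s \<in> carrier G" "t \<in> carrier G" "p *\<^sub>R e s = q *\<^sub>R e t" "q \<noteq> 0"
  shows "s = t"
proof -
  obtain \<delta> :: "'i \<Rightarrow> 'a \<Rightarrow> real" where "(\<forall>i. linear (\<delta> i)) \<and> (\<forall>i. \<forall>j\<in>carrier G. \<delta> i (e j) = (if i = j then 1 else 0))"
    using coord_functional by blast
  then have "p * (if t = s then 1 else 0) = q * 1"
    using arg_cong[OF assms(3), of "\<delta> t"] assms(1,2) by (simp add: linear_scale)
  with \<open>q \<noteq> 0\<close> show ?thesis by (auto split: if_splits)
qed

text \<open>The square of a multiple a of \<open>e s\<close> is a^2 \<open>c s s\<close> times a
  basis element. That is a nonzero multiple of the unit only if \<open>s\<close> squares to the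
  identity and \<open>c s s\<close> is nonzero, and then a adjusts the size but not the
  sign.\<close>

lemma (in twisted_basis) square_sign_line:
  assumes s: "s \<in> carrier G"
  shows "square_sign A (span {e s}) = (if s \<otimes>\<^bsub>G\<^esub> s = \<one>\<^bsub>G\<^esub> then sgn (c s s) else 0)"
proof -
  have sq: "(a *\<^sub>R e s) \<otimes>\<^bsub>A\<^esub> (a *\<^sub>R e s) = (a\<^sup>2 * c s s) *\<^sub>R e (s \<otimes>\<^bsub>G\<^esub> s)" for a
    using linear_left[of "a *\<^sub>R e s"] linear_right[of "e s"] s subspace_scale[OF subspace_carrier]
    by (simp add: linear_on_def basis_mult power2_eq_square)
  have ex: "(\<exists>x\<in>span {e s}. x \<otimes>\<^bsub>A\<^esub> x = r *\<^sub>R \<one>\<^bsub>A\<^esub>)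
    \<longleftrightarrow> s \<otimes>\<^bsub>G\<^esub> s = \<one>\<^bsub>G\<^esub> \<and> (\<exists>a. a\<^sup>2 * c s s = r)" if "r \<noteq> 0" for r
  proof -
    have "(\<exists>x\<in>span {e s}. x \<otimes>\<^bsub>A\<^esub> x = r *\<^sub>R \<one>\<^bsub>A\<^esub>)
      \<longleftrightarrow> (\<exists>a. (a\<^sup>2 * c s s) *\<^sub>R e (s \<otimes>\<^bsub>G\<^esub> s) = r *\<^sub>R e \<one>\<^bsub>G\<^esub>)"
      by (auto simp: in_span_singleton Bex_def sq basis_one)
    also have "\<dots> \<longleftrightarrow> s \<otimes>\<^bsub>G\<^esub> s = \<one>\<^bsub>G\<^esub> \<and> (\<exists>a. a\<^sup>2 * c s s = r)"
      using basis_proportional[of "s \<otimes>\<^bsub>G\<^esub> s" "\<one>\<^bsub>G\<^esub>"] s \<open>r \<noteq> 0\<close> basis_nonzero[of "\<one>\<^bsub>G\<^esub>"]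
      by (metis index_closed index_one scaleR_cancel_right)
    finally show ?thesis .
  qed
  have pos: "(\<exists>a. a\<^sup>2 * c s s = 1) \<longleftrightarrow> c s s > 0"
  proof
    assume "\<exists>a. a\<^sup>2 * c s s = 1"
    then show "c s s > 0" by (metis not_one_le_zero linorder_not_le mult_nonneg_nonpos zero_le_power2)
  next
    assume "c s s > 0"
    then show "\<exists>a. a\<^sup>2 * c s s = 1" by (intro exI[of _ "1 / sqrt (c s s)"]) (simp add: power_divide)
  qed
  have neg: "(\<exists>a. a\<^sup>2 * c s s = - 1) \<longleftrightarrow> c s s < 0"
  proof
    assume "\<exists>a. a\<^sup>2 * c s s = - 1"
    then obtain a where "a\<^sup>2 * c s s = - 1" ..
    then have "a\<^sup>2 * c s s < 0" by simp
    then show "c s s < 0" by (metis linorder_not_le mult_nonneg_nonneg zero_le_power2)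
  next
    assume "c s s < 0"
    then show "\<exists>a. a\<^sup>2 * c s s = - 1" by (intro exI[of _ "1 / sqrt (- c s s)"]) (simp add: power_divide)
  qed
  show ?thesis
    using ex[of 1] ex[of "- 1"] pos neg unfolding square_sign_def by (auto simp: sgn_if)
qed

lemma (in twisted_basis) lines_inj: "inj_on (\<lambda>s. span {e s}) (carrier G)"
proof (rule inj_onI)
  fix s t assume *: "s \<in> carrier G" "t \<in> carrier G" "span {e s} = span {e t}"
  then have "e s \<in> span {e t}" using span_base[of "e s" "{e s}"] by simp
  then obtain p where "e s = p *\<^sub>R e t" unfolding in_span_singleton ..
  then have "p *\<^sub>R e t = 1 *\<^sub>R e s" by simp
  from basis_proportional[OF *(2,1) this] show "s = t" by simp
qed

lemma graded_algebra_span_components: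
  assumes "is_graded_algebra X"
  shows "carrier X \<subseteq> span (\<Union>(component X ` support X))"
proof
  fix x assume "x \<in> carrier X"
  then obtain f where f: "\<forall>g\<in>carrier (grading_group X). f g \<in> component X g"
    "\<forall>g. g \<notin> carrier (grading_group X) \<longrightarrow> f g = 0" "x = (\<Sum>g | f g \<noteq> 0. f g)"
    using assms unfolding is_graded_algebra_def by blast
  have "f g \<in> \<Union>(component X ` support X)" if "f g \<noteq> 0" for g
    using f(1,2) that unfolding support_def by blast
  then show "x \<in> span (\<Union>(component X ` support X))"
    unfolding f(3) by (intro span_sum span_base) simp
qed

text \<open>An equivalence induces a bijection of lines that preserves \<open>square_sign\<close>.
  The function \<open>h\<close> is left open so that several invariants come from one statement; the
  sum runs over the components themselves because degrees are not preserved.\<close>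

lemma sum_square_sign:
  assumes X: "is_graded_algebra X" and eq: "graded_equivalent X Y"
    and b: "twisted_basis Y G c e" and comp: "component Y ` support Y = (\<lambda>s. span {e s}) ` carrier G"
  shows "(\<Sum>L\<in>component X ` support X. h (square_sign X L))
    = (\<Sum>s\<in>carrier G. h (if s \<otimes>\<^bsub>G\<^esub> s = \<one>\<^bsub>G\<^esub> then sgn (c s s) else 0 :: real) :: real)"
proof -
  interpret twisted_basis Y G c e by fact
  obtain \<psi> where \<psi>: "\<psi> \<in> algebra_iso X Y"
    and maps: "\<And>g. g \<in> support X \<Longrightarrow> \<exists>h\<in>carrier (grading_group Y). \<psi> ` component X g = component Y h"
    using eq unfolding graded_equivalent_def by blast
  have bij: "bij_betw \<psi> (carrier X) (carrier Y)" and lin: "linear_on (carrier X) \<psi>"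
    and mult: "\<And>x y. x \<in> carrier X \<Longrightarrow> y \<in> carrier X \<Longrightarrow> \<psi> (x \<otimes>\<^bsub>X\<^esub> y) = \<psi> x \<otimes>\<^bsub>Y\<^esub> \<psi> y"
    and one: "\<psi> \<one>\<^bsub>X\<^esub> = \<one>\<^bsub>Y\<^esub>"
    using \<psi> by (auto simp: algebra_iso_def)
  have alg: "real_algebra X" using X by (simp add: is_graded_algebra_def)
  have sub: "subspace (carrier X)" by (rule real_algebraD(2)[OF alg])
  have inj: "inj_on \<psi> (carrier X)" using bij by (simp add: bij_betw_def)
  have zero: "\<psi> 0 = 0" by (rule linear_on_zero[OF lin sub])
  let ?LX = "component X ` support X" and ?LY = "(\<lambda>s. span {e s}) ` carrier G"
  have LX: "L \<subseteq> carrier X" "subspace L" "L \<noteq> {0}" if "L \<in> ?LX" for L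
    using that X by (auto simp: support_def is_graded_algebra_def)
  \<comment> \<open>Equivalence only promises a component of \<open>Y\<close>; injectivity of
    \<open>\<psi>\<close> makes it nonzero, hence one of the lines.\<close>
  have into: "\<psi> ` L \<in> ?LY" if L: "L \<in> ?LX" for L
  proof -
    obtain h where h: "h \<in> carrier (grading_group Y)" "\<psi> ` L = component Y h" using maps L by blast
    obtain x where "x \<in> L" "x \<noteq> 0" using LX(2,3)[OF L] subspace_0 by blast
    then have "\<psi> x \<noteq> 0"
      using inj_onD[OF inj, of x 0] zero LX(1)[OF L] subspace_0[OF sub] by auto
    then have "component Y h \<noteq> {0}" using \<open>x \<in> L\<close> h(2) by blast
    then show ?thesis using h comp unfolding support_def by blast
  qed
  \<comment> \<open>If some line were missed, the image of \<open>\<psi>\<close> would lie in the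
    span of the other basis elements, against surjectivity and independence.\<close>
  have "span {e s} \<in> (`) \<psi> ` ?LX" if s: "s \<in> carrier G" for s
  proof (rule ccontr)
    assume no: "span {e s} \<notin> (`) \<psi> ` ?LX"
    let ?W = "span (e ` (carrier G - {s}))"
    have W: "\<psi> x \<in> ?W" if x: "x \<in> \<Union>?LX" for x
    proof -
      obtain L where L: "L \<in> ?LX" "x \<in> L" using x by blast
      obtain t where t: "t \<in> carrier G" "\<psi> ` L = span {e t}" using into[OF L(1)] by blast
      then have "t \<noteq> s" using no L(1) by blast
      then have "span {e t} \<subseteq> ?W" using t(1) by (intro span_mono) auto
      then show ?thesis using t(2) L(2) by blast
    qed
    have sp: "span (\<Union>?LX) = carrier X"
      by (intro equalityI span_minimal sub Union_least LX(1) graded_algebra_span_components[OF X])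
    have "e s \<in> \<psi> ` carrier X" using bij basis_in_carrier[OF s] by (simp add: bij_betw_def)
    then obtain x where "x \<in> carrier X" "e s = \<psi> x" by blast
    then have "e s \<in> ?W"
      using linear_on_span_in[of "\<Union>?LX" \<psi> ?W x] W lin unfolding sp by simp
    moreover have "e ` carrier G - {e s} = e ` (carrier G - {s})"
      using basis_inj s by (auto simp: inj_on_def)
    ultimately show False
      using basis_independent s unfolding dependent_def by auto
  qed
  then have img: "(`) \<psi> ` ?LX = ?LY" using into by blast
  have "inj_on ((`) \<psi>) ?LX"
  proof (rule inj_onI)
    fix L M assume "L \<in> ?LX" "M \<in> ?LX" "\<psi> ` L = \<psi> ` M"
    then show "L = M" using inj_on_image_eq_iff[OF inj LX(1) LX(1)] by blast
  qed
  then have bijL: "bij_betw ((`) \<psi>) ?LX ?LY" using img by (simp add: bij_betw_def)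
  have "square_sign Y (\<psi> ` L) = square_sign X L" if L: "L \<in> ?LX" for L
  proof -
    have one_in: "\<one>\<^bsub>X\<^esub> \<in> carrier X" by (rule monoid.one_closed[OF real_algebraD(1)[OF alg]])
    have "\<psi> x \<otimes>\<^bsub>Y\<^esub> \<psi> x = r *\<^sub>R \<one>\<^bsub>Y\<^esub> \<longleftrightarrow> x \<otimes>\<^bsub>X\<^esub> x = r *\<^sub>R \<one>\<^bsub>X\<^esub>" if "x \<in> L" for x r
    proof -
      have x: "x \<in> carrier X" using that LX(1)[OF L] by blast
      have "\<psi> x \<otimes>\<^bsub>Y\<^esub> \<psi> x = r *\<^sub>R \<one>\<^bsub>Y\<^esub> \<longleftrightarrow> \<psi> (x \<otimes>\<^bsub>X\<^esub> x) = \<psi> (r *\<^sub>R \<one>\<^bsub>X\<^esub>)"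
        using lin one_in by (simp add: mult[OF x x] one linear_on_def)
      also have "\<dots> \<longleftrightarrow> x \<otimes>\<^bsub>X\<^esub> x = r *\<^sub>R \<one>\<^bsub>X\<^esub>"
        using inj x one_in subspace_scale[OF sub] monoid.m_closed[OF real_algebraD(1)[OF alg]]
        by (intro inj_on_eq_iff) auto
      finally show ?thesis .
    qed
    from this[of _ 1] this[of _ "- 1"] show ?thesis
      unfolding square_sign_def by (simp add: image_iff bex_simps cong: bex_cong)
  qed
  then have "(\<Sum>L\<in>?LX. h (square_sign X L)) = (\<Sum>L\<in>?LX. h (square_sign Y (\<psi> ` L)))" by simp
  also have "\<dots> = (\<Sum>L\<in>?LY. h (square_sign Y L))" by (rule sum.reindex_bij_betw[OF bijL])
  also have "\<dots> = (\<Sum>s\<in>carrier G. h (square_sign Y (span {e s})))"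
    by (simp add: sum.reindex[OF lines_inj])
  finally show ?thesis by (simp add: square_sign_line cong: sum.cong)
qed

section \<open>Homogeneous elements of a simple graded division algebra\<close>

text \<open>\<open>Hm\<close> is the set of nonzero homogeneous elements. The last assumption says that the distinct
  lines spanned by elements of \<open>Hm\<close> are linearly independent.\<close>

locale division_lines =
  fixes X :: "('a::real_vector, 'x) monoid_scheme" (structure) and Hm :: "'a set"
  assumes alg: "real_algebra X"
    and simple: "simple_algebra X"
    and Hm_Units: "x \<in> Hm \<Longrightarrow> x \<in> Units X"
    and Hm_nonzero: "x \<in> Hm \<Longrightarrow> x \<noteq> 0"
    and Hm_mult [simp, intro]: "x \<in> Hm \<Longrightarrow> y \<in> Hm \<Longrightarrow> x \<otimes> y \<in> Hm"
    and Hm_scale [simp, intro]: "x \<in> Hm \<Longrightarrow> r \<noteq> 0 \<Longrightarrow> r *\<^sub>R x \<in> Hm"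
    and span_Hm: "span Hm = carrier X"
    and finite_lines: "finite ((\<lambda>x. span {x}) ` Hm)"
    and almost_commute: "x \<in> Hm \<Longrightarrow> y \<in> Hm \<Longrightarrow> \<exists>r. x \<otimes> y = r *\<^sub>R (y \<otimes> x)"
    and coordinate: "x \<in> Hm \<Longrightarrow>
      \<exists>\<phi> :: 'a \<Rightarrow> real. linear \<phi> \<and> \<phi> x \<noteq> 0 \<and> (\<forall>y\<in>Hm. y \<notin> span {x} \<longrightarrow> \<phi> y = 0)"
begin

sublocale Group.monoid X
  by (rule real_algebraD(1)[OF alg])

lemma subspace_X: "subspace (carrier X)"
  by (rule real_algebraD(2)[OF alg])

lemma Hm_carrier [simp]: "x \<in> Hm \<Longrightarrow> x \<in> carrier X"
  using Hm_Units Units_closed by blast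

lemma X_vector_closed [simp]:
  "x \<in> carrier X \<Longrightarrow> y \<in> carrier X \<Longrightarrow> x + y \<in> carrier X"
  "x \<in> carrier X \<Longrightarrow> y \<in> carrier X \<Longrightarrow> x - y \<in> carrier X"
  "x \<in> carrier X \<Longrightarrow> r *\<^sub>R x \<in> carrier X" "x \<in> carrier X \<Longrightarrow> - x \<in> carrier X"
  "0 \<in> carrier X"
  using subspace_X by (simp_all add: subspace_add subspace_diff subspace_scale subspace_neg subspace_0)

lemmas X_mult [simp] = real_algebra_mult[OF alg]

lemma X_mult_diff [simp]:
  assumes "x \<in> carrier X" "y \<in> carrier X" "z \<in> carrier X"
  shows "x \<otimes> (y - z) = x \<otimes> y - x \<otimes> z" "(y - z) \<otimes> x = y \<otimes> x - z \<otimes> x"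
  using X_mult(1)[of x y "(- 1) *\<^sub>R z"] X_mult(2)[of x y "(- 1) *\<^sub>R z"] assms
    X_mult(3)[of x z "- 1"] X_mult(4)[of z x "- 1"] by simp_all

lemma X_mult_minus [simp]:
  assumes "x \<in> carrier X" "y \<in> carrier X"
  shows "x \<otimes> (- y) = - (x \<otimes> y)" "(- x) \<otimes> y = - (x \<otimes> y)"
  using X_mult(3)[of x y "- 1"] X_mult(4)[of x y "- 1"] assms by simp_all

lemma X_mult_zero [simp]: "x \<in> carrier X \<Longrightarrow> x \<otimes> 0 = 0" "x \<in> carrier X \<Longrightarrow> 0 \<otimes> x = 0"
  using X_mult(3)[of x x 0] X_mult(4)[of x x 0] by simp_all

section \<open>Powers of homogeneous elements and the unit\<close>

lemma Hm_cancel: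
  assumes "x \<in> Hm" "y \<in> carrier X" "z \<in> carrier X" "x \<otimes> y = x \<otimes> z"
  shows "y = z"
  using Units_l_cancel[OF Hm_Units[OF assms(1)] assms(2,3)] assms(4) by simp

lemma Hm_pow_Suc: "x \<in> Hm \<Longrightarrow> x [^] Suc n \<in> Hm"
  by (induction n) auto

text \<open>Pigeonhole on the finitely many lines: two powers of \<open>x\<close> are proportional,
  and cancellation leaves the unit. Exponents start at \<open>Suc 0\<close> because
  \<open>\<one> \<in> Hm\<close> is itself derived from this lemma.\<close>

lemma one_eq_scaled_power:
  assumes "x \<in> Hm"
  obtains n r where "n \<ge> (1::nat)" "\<one> = r *\<^sub>R (x [^] n)"
proof -
  have "\<not> inj (\<lambda>i::nat. span {x [^] Suc i})"
  proof
    assume "inj (\<lambda>i::nat. span {x [^] Suc i})"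
    moreover have "range (\<lambda>i::nat. span {x [^] Suc i}) \<subseteq> (\<lambda>x. span {x}) ` Hm"
      using Hm_pow_Suc[OF assms] by blast
    ultimately show False using finite_lines finite_subset finite_imageD by blast
  qed
  then obtain i j :: nat where ij: "i < j" "span {x [^] Suc i} = span {x [^] Suc j}"
    unfolding inj_def by (metis linorder_neqE_nat)
  have "x [^] Suc i \<in> span {x [^] Suc j}" unfolding ij(2)[symmetric] by (simp add: span_base)
  then obtain r where r: "x [^] Suc i = r *\<^sub>R (x [^] Suc j)" unfolding in_span_singleton ..
  have "Suc j = Suc i + (j - i)" using ij by simp
  then have "x [^] Suc j = x [^] Suc i \<otimes> x [^] (j - i)"
    using nat_pow_mult[of x "Suc i" "j - i"] assms by (metis Hm_carrier)
  then have "x [^] Suc i \<otimes> \<one> = x [^] Suc i \<otimes> (r *\<^sub>R x [^] (j - i))"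
    using r assms by (simp del: nat_pow_Suc)
  then have "\<one> = r *\<^sub>R x [^] (j - i)"
    by (rule Hm_cancel[OF Hm_pow_Suc[OF assms], rotated 2]) (use assms in simp_all)
  then show thesis using that[of "j - i" r] ij by simp
qed

lemma Hm_nonempty: "Hm \<noteq> {}"
  using simple span_Hm by (auto simp: simple_algebra_def)

lemma one_Hm [simp, intro]: "\<one> \<in> Hm"
proof -
  obtain x where x: "x \<in> Hm" using Hm_nonempty by blast
  obtain n r where nr: "n \<ge> (1::nat)" "\<one> = r *\<^sub>R (x [^] n)" using one_eq_scaled_power[OF x] by blast
  have pow: "x [^] n \<in> Hm" using Hm_pow_Suc[OF x, of "n - 1"] nr by simp
  have "r \<noteq> 0"
  proof
    assume "r = 0"
    then have "x \<otimes> \<one> = x \<otimes> 0" using nr by simp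
    then show False using x Hm_nonzero[OF x] by simp
  qed
  then show ?thesis using nr(2) pow by (metis Hm_scale)
qed

lemma one_nonzero [simp]: "\<one> \<noteq> 0"
  using Hm_nonzero by blast

lemma Hm_pow [simp, intro]: "x \<in> Hm \<Longrightarrow> x [^] (n::nat) \<in> Hm"
  by (induction n) auto

definition scalar :: "'a \<Rightarrow> bool"
  where "scalar x \<longleftrightarrow> (\<exists>r. x = r *\<^sub>R \<one>)"

lemma scalar_span: "scalar x \<longleftrightarrow> x \<in> span {\<one>}"
  by (simp add: scalar_def in_span_singleton)

lemma scalar_scale: "scalar x \<Longrightarrow> scalar (r *\<^sub>R x)"
  unfolding scalar_def by (metis scaleR_scaleR)

lemma scalar_scale_iff [simp]: "r \<noteq> 0 \<Longrightarrow> scalar (r *\<^sub>R x) \<longleftrightarrow> scalar x"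
  using scalar_scale[of x r] scalar_scale[of "r *\<^sub>R x" "inverse r"] by auto

lemma scalar_mult: "scalar x \<Longrightarrow> scalar y \<Longrightarrow> scalar (x \<otimes> y)"
  unfolding scalar_def by force

lemma scalar_Hm:
  assumes "scalar x" "x \<in> Hm"
  obtains r where "r \<noteq> 0" "x = r *\<^sub>R \<one>"
proof -
  obtain r where "x = r *\<^sub>R \<one>" using assms(1) unfolding scalar_def ..
  moreover from this have "r \<noteq> 0" using Hm_nonzero[OF assms(2)] by auto
  ultimately show thesis using that by blast
qed

subsection \<open>Commutation signs\<close>

text \<open>On \<open>Hm\<close> the chosen factor is unique and multiplicative in each argument.
  That it is a sign depends on the finiteness of the set of lines, see
  \<open>comm_sign_cases\<close>.\<close>

definition comm_sign :: "'a \<Rightarrow> 'a \<Rightarrow> real"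
  where "comm_sign x y = (SOME r. x \<otimes> y = r *\<^sub>R (y \<otimes> x))"

lemma comm_sign: "x \<in> Hm \<Longrightarrow> y \<in> Hm \<Longrightarrow> x \<otimes> y = comm_sign x y *\<^sub>R (y \<otimes> x)"
  unfolding comm_sign_def using almost_commute by (rule someI_ex)

lemma comm_sign_eqI:
  assumes "x \<in> Hm" "y \<in> Hm" "x \<otimes> y = r *\<^sub>R (y \<otimes> x)"
  shows "comm_sign x y = r"
proof -
  have "comm_sign x y *\<^sub>R (y \<otimes> x) = r *\<^sub>R (y \<otimes> x)"
    unfolding comm_sign[OF assms(1,2), symmetric] by (rule assms(3))
  then show ?thesis using Hm_nonzero[OF Hm_mult[OF assms(2,1)]] by simp
qed

lemma comm_sign_mult_left:
  assumes "x \<in> Hm" "y \<in> Hm" "z \<in> Hm"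
  shows "comm_sign (x \<otimes> y) z = comm_sign x z * comm_sign y z"
proof (rule comm_sign_eqI)
  have "x \<otimes> y \<otimes> z = x \<otimes> (y \<otimes> z)" using assms by (simp add: m_assoc)
  also have "\<dots> = comm_sign y z *\<^sub>R (x \<otimes> z \<otimes> y)"
    using assms by (simp add: comm_sign[of y z] m_assoc)
  also have "\<dots> = (comm_sign x z * comm_sign y z) *\<^sub>R (z \<otimes> (x \<otimes> y))"
    using assms by (simp add: comm_sign[of x z] m_assoc mult.commute)
  finally show "x \<otimes> y \<otimes> z = (comm_sign x z * comm_sign y z) *\<^sub>R (z \<otimes> (x \<otimes> y))" .
qed (use assms in auto)

lemma comm_sign_one [simp]: "y \<in> Hm \<Longrightarrow> comm_sign \<one> y = 1"
  by (rule comm_sign_eqI) auto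

lemma comm_sign_scale_left [simp]:
  assumes "x \<in> Hm" "y \<in> Hm" "r \<noteq> 0"
  shows "comm_sign (r *\<^sub>R x) y = comm_sign x y"
  by (rule comm_sign_eqI) (use assms comm_sign[OF assms(1,2)] in \<open>auto simp: mult.commute\<close>)

text \<open>A power of \<open>x\<close> is proportional to the unit, so by multiplicativity the
  factor is a real root of unity.\<close>

lemma comm_sign_cases:
  assumes "x \<in> Hm" "y \<in> Hm"
  shows "comm_sign x y = 1 \<or> comm_sign x y = - 1"
proof -
  obtain n r where nr: "n \<ge> (1::nat)" "\<one> = r *\<^sub>R (x [^] n)" using one_eq_scaled_power[OF assms(1)] by blast
  then have "r \<noteq> 0" using one_nonzero by auto
  have "comm_sign (x [^] k) y = comm_sign x y ^ k" for k :: nat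
    using assms by (induction k) (simp_all add: comm_sign_mult_left mult.commute)
  then have "comm_sign x y ^ n = comm_sign (r *\<^sub>R x [^] n) y"
    using \<open>r \<noteq> 0\<close> assms by simp
  also have "\<dots> = 1" using assms by (simp flip: nr(2))
  finally have "\<bar>comm_sign x y\<bar> = 1" using nr(1) power_eq_1_iff[of "comm_sign x y" n] by auto
  then show ?thesis by linarith
qed

lemma comm_sign_square [simp]: "x \<in> Hm \<Longrightarrow> y \<in> Hm \<Longrightarrow> comm_sign x y * comm_sign x y = 1"
  using comm_sign_cases[of x y] by auto

lemma comm_sign_sym: "x \<in> Hm \<Longrightarrow> y \<in> Hm \<Longrightarrow> comm_sign y x = comm_sign x y"
  by (rule comm_sign_eqI) (simp_all add: comm_sign[of x y])

lemma comm_sign_mult_right: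
  "x \<in> Hm \<Longrightarrow> y \<in> Hm \<Longrightarrow> z \<in> Hm \<Longrightarrow> comm_sign z (x \<otimes> y) = comm_sign z x * comm_sign z y"
  using comm_sign_mult_left[of x y z] comm_sign_sym[of z] by (simp add: Hm_mult)

lemma comm_sign_scale_right [simp]:
  "x \<in> Hm \<Longrightarrow> y \<in> Hm \<Longrightarrow> r \<noteq> 0 \<Longrightarrow> comm_sign y (r *\<^sub>R x) = comm_sign y x"
  using comm_sign_scale_left[of x y r] comm_sign_sym[of y] by simp

lemma comm_sign_self [simp]: "x \<in> Hm \<Longrightarrow> comm_sign x x = 1"
  by (rule comm_sign_eqI) auto

lemma comm_sign_eq_1: "x \<in> Hm \<Longrightarrow> y \<in> Hm \<Longrightarrow> comm_sign x y = 1 \<longleftrightarrow> x \<otimes> y = y \<otimes> x"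
  using comm_sign[of x y] comm_sign_eqI[of x y 1] by auto

lemma comm_sign_span:
  assumes "x \<in> Hm" "y \<in> Hm" "x \<in> span {z}" "z \<in> Hm"
  shows "comm_sign x y = comm_sign z y"
proof -
  obtain r where "x = r *\<^sub>R z" using assms(3) unfolding in_span_singleton ..
  moreover have "r \<noteq> 0" using calculation Hm_nonzero[OF assms(1)] by auto
  ultimately show ?thesis using assms by simp
qed

text \<open>The polar identity: squaring behaves like a quadratic form with \<open>comm_sign\<close>
  as its polar form.\<close>

lemma product_square:
  assumes "x \<in> Hm" "y \<in> Hm"
  shows "(x \<otimes> y) \<otimes> (x \<otimes> y) = comm_sign x y *\<^sub>R ((x \<otimes> x) \<otimes> (y \<otimes> y))"
proof -
  have "(x \<otimes> y) \<otimes> (x \<otimes> y) = x \<otimes> (y \<otimes> x) \<otimes> y" using assms by (simp add: m_assoc)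
  also have "\<dots> = comm_sign x y *\<^sub>R (x \<otimes> (x \<otimes> y) \<otimes> y)"
    using assms comm_sign[of y x] comm_sign_sym[of x y] by simp
  finally show ?thesis using assms by (simp add: m_assoc)
qed

subsection \<open>The centre\<close>

definition central :: "'a \<Rightarrow> bool"
  where "central z \<longleftrightarrow> z \<in> Hm \<and> (\<forall>y\<in>Hm. comm_sign z y = 1)"

lemma central_Hm [simp]: "central z \<Longrightarrow> z \<in> Hm"
  by (simp add: central_def)

lemma central_sign [simp]: "central z \<Longrightarrow> y \<in> Hm \<Longrightarrow> comm_sign z y = 1"
  unfolding central_def by blast

text \<open>The sign of \<open>x\<close> enters twice and cancels.\<close>

lemma central_square: "x \<in> Hm \<Longrightarrow> central (x \<otimes> x)"
  unfolding central_def by (auto simp: comm_sign_mult_left)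

lemma central_mult: "central x \<Longrightarrow> central y \<Longrightarrow> central (x \<otimes> y)"
  unfolding central_def by (auto simp: comm_sign_mult_left)

lemma central_scale: "central x \<Longrightarrow> r \<noteq> 0 \<Longrightarrow> central (r *\<^sub>R x)"
  unfolding central_def by auto

lemma central_one [simp]: "central \<one>"
  unfolding central_def by auto

lemma scalar_central:
  assumes "scalar x" "x \<in> Hm"
  shows "central x"
proof -
  obtain r where "r \<noteq> 0" "x = r *\<^sub>R \<one>" by (rule scalar_Hm[OF assms])
  then show ?thesis using central_scale[OF central_one] by simp
qed

definition centre :: "'a set"
  where "centre = {p \<in> carrier X. \<forall>x\<in>carrier X. p \<otimes> x = x \<otimes> p}"

lemma central_centre:
  assumes "central z"
  shows "z \<in> centre"
proof -
  have z: "z \<in> Hm" using assms by simp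
  have "z \<otimes> x = x \<otimes> z" if "x \<in> carrier X" for x
  proof (rule linear_on_span_eq[of Hm "\<lambda>x. z \<otimes> x" "\<lambda>x. x \<otimes> z"])
    show "linear_on (span Hm) (\<lambda>x. z \<otimes> x)" "linear_on (span Hm) (\<lambda>x. x \<otimes> z)"
      using real_algebraD(3,4)[OF alg] z by (simp_all add: span_Hm)
    show "z \<otimes> x = x \<otimes> z" if "x \<in> Hm" for x
      using comm_sign[OF z that] central_sign[OF assms that] by simp
  qed (use that span_Hm in simp)
  then show ?thesis using z by (simp add: centre_def)
qed

lemma centre_closed [intro]:
  "p \<in> centre \<Longrightarrow> q \<in> centre \<Longrightarrow> p + q \<in> centre" "p \<in> centre \<Longrightarrow> q \<in> centre \<Longrightarrow> p - q \<in> centre"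
  "p \<in> centre \<Longrightarrow> r *\<^sub>R p \<in> centre"
  by (auto simp: centre_def)

text \<open>The annihilator of a central element is a two-sided ideal.\<close>

lemma centre_no_zero_divisors:
  assumes p: "p \<in> centre" and q: "q \<in> carrier X" and pq: "p \<otimes> q = 0"
  shows "p = 0 \<or> q = 0"
proof -
  have pc: "p \<in> carrier X" using p by (simp add: centre_def)
  let ?I = "{x \<in> carrier X. p \<otimes> x = 0}"
  have "two_sided_ideal ?I X"
    unfolding two_sided_ideal_def
  proof (intro conjI ballI)
    show "subspace ?I" using pc by (auto simp: subspace_def)
    fix a x assume a: "a \<in> carrier X" and x: "x \<in> ?I"
    have "p \<otimes> (a \<otimes> x) = (p \<otimes> a) \<otimes> x" using pc a x by (simp add: m_assoc)
    also have "p \<otimes> a = a \<otimes> p" using p a by (simp add: centre_def)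
    finally have "p \<otimes> (a \<otimes> x) = a \<otimes> (p \<otimes> x)" using pc a x by (simp add: m_assoc)
    then show "a \<otimes> x \<in> ?I" using a x by simp
    have "p \<otimes> (x \<otimes> a) = 0" using a x pc by (simp flip: m_assoc)
    then show "x \<otimes> a \<in> ?I" using a x by simp
  qed auto
  then consider "?I = {0}" | "?I = carrier X" using simple by (auto simp: simple_algebra_def)
  then show ?thesis
  proof cases
    case 1
    then show ?thesis using q pq by blast
  next
    case 2
    then have "p \<otimes> \<one> = 0" using one_closed by blast
    then show ?thesis using pc by simp
  qed
qed

text \<open>The polynomial z^2 - r splits over the reals, and one of its linear factors must vanish
  because the centre has no zero divisors.\<close>

lemma central_positive_square:
  assumes z: "central z" and sq: "z \<otimes> z = r *\<^sub>R \<one>" and r: "r > 0"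
  shows "scalar z"
proof -
  let ?p = "z - sqrt r *\<^sub>R \<one>" and ?q = "z + sqrt r *\<^sub>R \<one>"
  have "?p \<in> centre" "?q \<in> carrier X" using central_centre[OF z] central_centre[OF central_one] z by auto
  moreover have "?p \<otimes> ?q = 0" using z sq r by (simp add: algebra_simps)
  ultimately have "?p = 0 \<or> ?q = 0" by (rule centre_no_zero_divisors)
  then have "z = sqrt r *\<^sub>R \<one> \<or> z = (- sqrt r) *\<^sub>R \<one>" by (auto simp: eq_neg_iff_add_eq_0)
  then show ?thesis unfolding scalar_def by blast
qed

text \<open>The scalar part of a combination of homogeneous elements. It serves to show that certain
  factors in the centre are nonzero.\<close>

lemma coordinate_one:
  obtains \<phi> :: "'a \<Rightarrow> real" where "linear \<phi>" "\<phi> \<one> = 1" "\<And>y. y \<in> Hm \<Longrightarrow> \<not> scalar y \<Longrightarrow> \<phi> y = 0"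
proof -
  obtain \<phi> :: "'a \<Rightarrow> real" where \<phi>: "linear \<phi>" "\<phi> \<one> \<noteq> 0" "\<forall>y\<in>Hm. y \<notin> span {\<one>} \<longrightarrow> \<phi> y = 0"
    using coordinate[OF one_Hm] by blast
  show thesis
  proof (rule that[of "\<lambda>x. \<phi> x / \<phi> \<one>"])
    show "linear (\<lambda>x. \<phi> x / \<phi> \<one>)"
      using \<phi>(1) by (auto simp: linear_iff add_divide_distrib)
  qed (use \<phi>(2,3) in \<open>auto simp: scalar_span\<close>)
qed

lemma pow_minus_one_factor:
  fixes n :: nat
  assumes "y \<in> carrier X"
  shows "(y - \<one>) \<otimes> (\<Sum>i<n. y [^] i) = y [^] n - \<one>"
proof (induction n)
  case (Suc n)
  have sum: "(\<Sum>i<n. y [^] i) \<in> carrier X" for n :: nat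
    using assms by (intro subspace_sum[OF subspace_X]) simp
  have "(y - \<one>) \<otimes> (\<Sum>i<Suc n. y [^] i) = (y - \<one>) \<otimes> (\<Sum>i<n. y [^] i) + (y - \<one>) \<otimes> y [^] n"
    using assms sum[of n] by simp
  also have "(y - \<one>) \<otimes> y [^] n = y [^] Suc n - y [^] n"
    using assms nat_pow_Suc2[of y n] by simp
  finally show ?case using Suc by simp
qed (use assms in simp)

lemma scale_pow: "x \<in> carrier X \<Longrightarrow> (r *\<^sub>R x) [^] (n::nat) = r ^ n *\<^sub>R x [^] n"
  by (induction n) (simp_all add: mult.commute)

text \<open>In y^n - 1 = (y - 1)(1 + y + ... + y^(n-1)) the second factor is nonzero: a scalar power
  y^i = c has c^n = 1 with n odd, so c > 0, and the term i = 0 makes the scalar part at least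
  1.\<close>

lemma central_odd_root_of_unity:
  fixes n :: nat
  assumes y: "central y" and pow: "y [^] n = \<one>" and n: "odd n"
  shows "scalar y"
proof -
  have yc: "y \<in> carrier X" using y by simp
  have "y - \<one> \<in> centre" using central_centre[OF y] central_centre[OF central_one] by auto
  moreover have "(\<Sum>i<n. y [^] i) \<in> carrier X"
    using yc by (intro subspace_sum[OF subspace_X]) simp
  moreover have "(y - \<one>) \<otimes> (\<Sum>i<n. y [^] i) = 0" using pow_minus_one_factor[OF yc] pow by simp
  ultimately have "y - \<one> = 0 \<or> (\<Sum>i<n. y [^] i) = 0" by (rule centre_no_zero_divisors)
  moreover have "(\<Sum>i<n. y [^] i) \<noteq> 0"
  proof
    assume sum: "(\<Sum>i<n. y [^] i) = 0"
    obtain \<phi> :: "'a \<Rightarrow> real" where \<phi>: "linear \<phi>" "\<phi> \<one> = 1" "\<And>y. y \<in> Hm \<Longrightarrow> \<not> scalar y \<Longrightarrow> \<phi> y = 0"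
      using coordinate_one by blast
    have nonneg: "\<phi> (y [^] i) \<ge> 0" for i :: nat
    proof (cases "scalar (y [^] i)")
      case True
      then obtain c where c: "y [^] i = c *\<^sub>R \<one>" unfolding scalar_def ..
      have "c ^ n *\<^sub>R \<one> = (y [^] i) [^] n" unfolding c by (simp add: scale_pow)
      also have "\<dots> = (y [^] n) [^] i" using yc by (simp add: nat_pow_pow mult.commute)
      also have "\<dots> = 1 *\<^sub>R \<one>" by (simp add: pow)
      finally have "c ^ n = 1" using one_nonzero scaleR_cancel_right by blast
      then have "0 < c ^ n" by simp
      then have "c > 0" using n by (auto simp: zero_less_power_eq)
      then show ?thesis using c \<phi>(1,2) by (simp add: linear_scale)
    next
      case False
      then show ?thesis using \<phi>(3) y by simp
    qed
    have "0 < n" using n by (auto intro: Nat.gr0I)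
    have "0 = (\<Sum>i<n. \<phi> (y [^] i))" using sum \<phi>(1) by (metis linear_0 linear_sum)
    moreover have "(\<Sum>i<n. \<phi> (y [^] i)) \<ge> \<phi> (y [^] (0::nat))"
      using nonneg \<open>0 < n\<close> by (intro member_le_sum) auto
    ultimately show False using \<phi>(2) by simp
  qed
  ultimately show ?thesis unfolding scalar_def by (metis right_minus_eq scaleR_one)
qed

text \<open>The case of a negative fourth power uses Sophie Germain's factorisation
  $z^4 + 4 \mu^4 = (z^2 + 2 \mu z + 2 \mu^2) (z^2 - 2 \mu z + 2 \mu^2)$.\<close>

lemma central_fourth_power:
  assumes z: "central z" and pow: "(z \<otimes> z) \<otimes> (z \<otimes> z) = r *\<^sub>R \<one>"
  shows "scalar (z \<otimes> z)"
proof (rule ccontr)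
  assume nonscalar: "\<not> scalar (z \<otimes> z)"
  then have z1: "\<not> scalar z" using scalar_mult by blast
  have zc: "z \<in> carrier X" using z by simp
  have zz: "central (z \<otimes> z)" by (rule central_mult[OF z z])
  have "(z \<otimes> z) \<otimes> (z \<otimes> z) \<noteq> 0" using z Hm_nonzero by (metis Hm_mult central_Hm)
  then have "r \<noteq> 0" using pow by auto
  moreover have "\<not> r > 0" using central_positive_square[OF zz pow] nonscalar by blast
  ultimately have r: "r < 0" by simp
  \<comment> \<open>Chosen with \<open>4 * m ^ 4 = - r\<close>, so that the quartic to be factored
    is zero at \<open>z\<close>.\<close>
  define m where "m = sqrt (sqrt (- r / 4))"
  have m4: "m ^ 4 = - r / 4" and m: "m > 0"
  proof -
    have "m ^ 4 = (m\<^sup>2)\<^sup>2" by simp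
    also have "\<dots> = - r / 4" using r by (simp add: m_def)
    finally show "m ^ 4 = - r / 4" .
    show "m > 0" using r by (simp add: m_def)
  qed
  let ?s = "z \<otimes> z"
  let ?f = "\<lambda>e. ?s + (2 * e * m) *\<^sub>R z + (2 * m\<^sup>2) *\<^sub>R \<one>"
  have s: "?s \<in> carrier X" using zc by simp
  have sz: "?s \<otimes> z = z \<otimes> ?s" using zc by (simp add: m_assoc)
  have "?f 1 \<otimes> ?f (- 1) = ?s \<otimes> ?s + (4 * m ^ 4) *\<^sub>R \<one>"
    using zc s sz by (simp add: algebra_simps power2_eq_square power4_eq_xxxx flip: scaleR_add_left)
  also have "\<dots> = 0" by (simp add: pow m4)
  finally have prod0: "?f 1 \<otimes> ?f (- 1) = 0" .
  have "?f 1 \<in> centre" "?f (- 1) \<in> carrier X"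
    using central_centre[OF z] central_centre[OF zz] central_centre[OF central_one] zc s
    by (auto intro!: centre_closed X_vector_closed)
  from centre_no_zero_divisors[OF this prod0] obtain e where e: "?f e = 0" by blast
  obtain \<phi> :: "'a \<Rightarrow> real" where \<phi>: "linear \<phi>" "\<phi> \<one> = 1" "\<And>y. y \<in> Hm \<Longrightarrow> \<not> scalar y \<Longrightarrow> \<phi> y = 0"
    using coordinate_one by blast
  \<comment> \<open>Neither \<open>z\<close> nor its square is scalar, so both vanish under
    \<open>\<phi>\<close>, and the positive constant term of the factor survives.\<close>
  have "\<phi> (?f e) = 2 * m\<^sup>2"
    using \<phi> z1 nonscalar z by (simp add: linear_add linear_scale)
  then show False using e \<phi>(1) m by (simp add: linear_0)
qed

text \<open>Induction on an exponent that makes \<open>z\<close> scalar. An even exponent is halved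
  by passing to the square of \<open>z\<close>, after which \<open>central_fourth_power\<close>
  descends from \<open>z\<close> to the fourth to its square; an odd exponent makes \<open>z\<close>
  itself scalar.\<close>

lemma central_scalar_square:
  assumes "central z"
  shows "scalar (z \<otimes> z)"
proof -
  have main: "scalar (z \<otimes> z)" if "central z" "scalar (z [^] n)" "n \<ge> 1" for n :: nat and z
    using that
  proof (induction n arbitrary: z rule: less_induct)
    case (less n)
    have z: "z \<in> Hm" using less.prems by simp
    show ?case
    proof (cases "even n")
      case True
      then obtain k where k: "n = 2 * k" by blast
      have "z [^] n = (z \<otimes> z) [^] k"
        using z nat_pow_pow[of z 2 k] by (simp add: k numeral_2_eq_2)
      then have "scalar ((z \<otimes> z) \<otimes> (z \<otimes> z))"
        using less.IH[of k "z \<otimes> z"] less.prems k central_mult by auto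
      then show ?thesis using central_fourth_power[OF less.prems(1)] unfolding scalar_def by blast
    next
      case False
      obtain r where r: "r \<noteq> 0" "z [^] n = r *\<^sub>R \<one>" using scalar_Hm[OF less.prems(2)] z by blast
      \<comment> \<open>A real root of odd order exists for either sign of \<open>r\<close>.\<close>
      let ?y = "(1 / root n r) *\<^sub>R z"
      have "root n r \<noteq> 0" using r less.prems(3) by simp
      moreover have "?y [^] n = \<one>"
        using z r False odd_real_root_pow[of n r] by (simp add: scale_pow power_one_over)
      ultimately have "scalar z"
        using central_odd_root_of_unity[of ?y n] central_scale[OF less.prems(1)] False by simp
      then show ?thesis by (simp add: scalar_mult)
    qed
  qed
  obtain n r where nr: "n \<ge> (1::nat)" "\<one> = r *\<^sub>R (z [^] n)"
    by (rule one_eq_scaled_power[OF central_Hm[OF assms]])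
  have "r \<noteq> 0"
  proof
    assume "r = 0"
    with nr(2) have "\<one> = 0" by (simp only: scaleR_zero_left)
    then show False using one_nonzero by contradiction
  qed
  moreover have "scalar (r *\<^sub>R z [^] n)"
    unfolding scalar_def nr(2)[symmetric] by (rule exI[of _ 1]) simp
  ultimately have "scalar (z [^] n)" by (rule scalar_scale_iff[THEN iffD1])
  then show ?thesis by (rule main[OF assms _ nr(1)])
qed

lemma central_nonscalar_normalize:
  assumes z: "central z" and nonscalar: "\<not> scalar z"
  obtains r where "r > 0" "(r *\<^sub>R z) \<otimes> (r *\<^sub>R z) = - \<one>"
proof -
  have "z \<otimes> z \<in> Hm" using z by simp
  then obtain s where s: "s \<noteq> 0" "z \<otimes> z = s *\<^sub>R \<one>"
    by (rule scalar_Hm[OF central_scalar_square[OF z]])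
  moreover have "\<not> s > 0" using central_positive_square[OF z s(2)] nonscalar by blast
  ultimately have "s < 0" by simp
  define t where "t = 1 / sqrt (- s)"
  have t: "t > 0" "t * (t * s) = - 1" using \<open>s < 0\<close> by (simp_all add: t_def field_simps)
  show thesis
  proof (rule that[OF t(1)])
    have "(t *\<^sub>R z) \<otimes> (t *\<^sub>R z) = (t * (t * s)) *\<^sub>R \<one>" using z by (simp add: s(2))
    then show "(t *\<^sub>R z) \<otimes> (t *\<^sub>R z) = - \<one>" unfolding t(2) by simp
  qed
qed

text \<open>If \<open>w\<close> is not scalar, rescale it to have square -1. Then fw has square 1
  and is central, hence scalar, and multiplying by f again puts w on the line of f.\<close>

lemma central_scalar_or_multiple:
  assumes f: "central f" and ff: "f \<otimes> f = - \<one>" and w: "central w"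
  shows "scalar w \<or> w \<in> span {f}"
proof (cases "scalar w")
  case False
  obtain r where r: "r > 0" "(r *\<^sub>R w) \<otimes> (r *\<^sub>R w) = - \<one>"
    by (rule central_nonscalar_normalize[OF w False])
  let ?w = "r *\<^sub>R w"
  have w': "central ?w" using central_scale[OF w] r by simp
  then have sign: "comm_sign f ?w = 1" using f by simp
  have "(f \<otimes> ?w) \<otimes> (f \<otimes> ?w) = comm_sign f ?w *\<^sub>R ((f \<otimes> f) \<otimes> (?w \<otimes> ?w))"
    using f w' by (intro product_square) auto
  also have "\<dots> = 1 *\<^sub>R \<one>" unfolding sign ff r(2) by simp
  finally have "scalar (f \<otimes> ?w)"
    by (rule central_positive_square[OF central_mult[OF f w']]) simp
  then obtain c where c: "f \<otimes> ?w = c *\<^sub>R \<one>" unfolding scalar_def ..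
  have "(f \<otimes> f) \<otimes> ?w = f \<otimes> (f \<otimes> ?w)" using f w' by (intro m_assoc) auto
  then have "- ?w = c *\<^sub>R f" unfolding ff c using f w by simp
  then have "r *\<^sub>R w = (- c) *\<^sub>R f" by (metis minus_minus scaleR_minus_left)
  then have "(1 / r) *\<^sub>R r *\<^sub>R w = (1 / r) *\<^sub>R (- c) *\<^sub>R f" by (simp only:)
  then have "w = (1 / r * - c) *\<^sub>R f" using r by simp
  then show ?thesis unfolding in_span_singleton by blast
qed simp

end

context division_lines
begin

subsection \<open>Hyperbolic systems\<close>

text \<open>Each pair is a hyperbolic plane spanned by two vectors on which the square is 1, and
  distinct planes are orthogonal for the commutation sign.\<close>

definition hyperbolic_system :: "nat \<Rightarrow> (nat \<Rightarrow> 'a) \<Rightarrow> (nat \<Rightarrow> 'a) \<Rightarrow> bool"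
  where "hyperbolic_system k a b \<longleftrightarrow>
    (\<forall>i<k. a i \<in> Hm \<and> b i \<in> Hm \<and> a i \<otimes> a i = \<one> \<and> b i \<otimes> b i = \<one> \<and> comm_sign (a i) (b i) = - 1) \<and>
    (\<forall>i<k. \<forall>j<k. i \<noteq> j \<longrightarrow> comm_sign (a i) (a j) = 1 \<and> comm_sign (a i) (b j) = 1 \<and>
      comm_sign (b i) (a j) = 1 \<and> comm_sign (b i) (b j) = 1)"

definition commutant :: "nat \<Rightarrow> (nat \<Rightarrow> 'a) \<Rightarrow> (nat \<Rightarrow> 'a) \<Rightarrow> 'a set"
  where "commutant k a b = {x \<in> Hm. \<forall>i<k. comm_sign x (a i) = 1 \<and> comm_sign x (b i) = 1}"

definition positive :: "'a \<Rightarrow> bool"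
  where "positive x \<longleftrightarrow> (\<exists>r>0. x \<otimes> x = r *\<^sub>R \<one>)"

text \<open>The \<open>a i\<close> lie on distinct lines, because \<open>b i\<close> anticommutes
  with \<open>a i\<close> and with no other \<open>a j\<close>. The bound makes a system of greatest
  length available.\<close>

lemma hyperbolic_system_bound:
  assumes "hyperbolic_system k a b"
  shows "k \<le> card ((\<lambda>x. span {x}) ` Hm)"
proof -
  have "inj_on (\<lambda>i. span {a i}) {..<k}"
  proof (rule inj_onI)
    fix i j assume ij: "i \<in> {..<k}" "j \<in> {..<k}" "span {a i} = span {a j}"
    have Hm: "a i \<in> Hm" "a j \<in> Hm" "b i \<in> Hm"
      using assms ij unfolding hyperbolic_system_def by auto
    have "a i \<in> span {a j}" unfolding ij(3)[symmetric] by (simp add: span_base)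
    then have "comm_sign (a i) (b i) = comm_sign (a j) (b i)" by (rule comm_sign_span[OF Hm(1,3) _ Hm(2)])
    then show "i = j" using assms ij unfolding hyperbolic_system_def by force
  qed
  moreover have "(\<lambda>i. span {a i}) ` {..<k} \<subseteq> (\<lambda>x. span {x}) ` Hm"
    using assms unfolding hyperbolic_system_def by auto
  ultimately have "card {..<k} \<le> card ((\<lambda>x. span {x}) ` Hm)"
    by (rule card_inj_on_le) (rule finite_lines)
  then show ?thesis by simp
qed

lemma positive_normalize:
  assumes "positive x" "x \<in> Hm"
  obtains r where "r > 0" "(r *\<^sub>R x) \<otimes> (r *\<^sub>R x) = \<one>"
proof -
  obtain s where s: "s > 0" "x \<otimes> x = s *\<^sub>R \<one>" using assms(1) unfolding positive_def by blast
  define t where "t = 1 / sqrt s"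
  have t: "t > 0" "t * (t * s) = 1" using s(1) by (simp_all add: t_def)
  show thesis
  proof (rule that[OF t(1)])
    have "(t *\<^sub>R x) \<otimes> (t *\<^sub>R x) = (t * (t * s)) *\<^sub>R \<one>" using assms(2) by (simp add: s(2))
    then show "(t *\<^sub>R x) \<otimes> (t *\<^sub>R x) = \<one>" unfolding t(2) by simp
  qed
qed

lemma hyperbolic_system_extend:
  assumes h: "hyperbolic_system k a b"
    and x: "x \<in> commutant k a b" and y: "y \<in> commutant k a b"
    and sq: "x \<otimes> x = \<one>" "y \<otimes> y = \<one>" and xy: "comm_sign x y = - 1"
  shows "hyperbolic_system (Suc k) (a(k := x)) (b(k := y))"
proof -
  have Hm: "x \<in> Hm" "y \<in> Hm" using x y by (auto simp: commutant_def)
  have ab: "a i \<in> Hm" "b i \<in> Hm" if "i < k" for i using h that unfolding hyperbolic_system_def by auto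
  have c: "comm_sign x (a i) = 1" "comm_sign x (b i) = 1" "comm_sign y (a i) = 1" "comm_sign y (b i) = 1"
    if "i < k" for i using x y that unfolding commutant_def by auto
  have c': "comm_sign (a i) x = 1" "comm_sign (b i) x = 1" "comm_sign (a i) y = 1" "comm_sign (b i) y = 1"
    if "i < k" for i using c[OF that] Hm ab[OF that] comm_sign_sym by metis+
  show ?thesis
    using h Hm sq xy c c' unfolding hyperbolic_system_def by (auto simp: less_Suc_eq)
qed

text \<open>Two anticommuting positive elements of the commutant could be rescaled to square 1 and
  appended as one more pair.\<close>

lemma maximal_hyperbolic_system:
  obtains k a b where "hyperbolic_system k a b"
    "\<And>x y. x \<in> commutant k a b \<Longrightarrow> y \<in> commutant k a b \<Longrightarrow> positive x \<Longrightarrow> positive y \<Longrightarrow> comm_sign x y = 1"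
proof -
  let ?P = "\<lambda>k. \<exists>a b. hyperbolic_system k a b"
  have "?P 0" by (simp add: hyperbolic_system_def)
  moreover have "\<forall>k. ?P k \<longrightarrow> k \<le> card ((\<lambda>x. span {x}) ` Hm)" using hyperbolic_system_bound by blast
  ultimately obtain k where k: "?P k" "\<forall>l. ?P l \<longrightarrow> l \<le> k"
    using Nat.ex_has_greatest_nat[of ?P 0] by blast
  then obtain a b where h: "hyperbolic_system k a b" by blast
  show thesis
  proof (rule that[OF h])
    fix x y assume x: "x \<in> commutant k a b" and y: "y \<in> commutant k a b" and pos: "positive x" "positive y"
    have Hm: "x \<in> Hm" "y \<in> Hm" using x y by (auto simp: commutant_def)
    have ab: "a i \<in> Hm" "b i \<in> Hm" if "i < k" for i using h that unfolding hyperbolic_system_def by auto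
    obtain r where r: "r > 0" "(r *\<^sub>R x) \<otimes> (r *\<^sub>R x) = \<one>" by (rule positive_normalize[OF pos(1) Hm(1)])
    obtain s where s: "s > 0" "(s *\<^sub>R y) \<otimes> (s *\<^sub>R y) = \<one>" by (rule positive_normalize[OF pos(2) Hm(2)])
    have "r *\<^sub>R x \<in> commutant k a b" "s *\<^sub>R y \<in> commutant k a b"
      using x y r(1) s(1) Hm ab by (auto simp: commutant_def)
    from hyperbolic_system_extend[OF h this r(2) s(2)]
    have "comm_sign (r *\<^sub>R x) (s *\<^sub>R y) \<noteq> - 1" using k(2) by (metis Suc_n_not_le_n)
    then show "comm_sign x y = 1" using comm_sign_cases[OF Hm] Hm r(1) s(1) by auto
  qed
qed

end

locale hyperbolic = division_lines +
  fixes k :: nat and a b :: "nat \<Rightarrow> 'a"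
  assumes system: "hyperbolic_system k a b"
begin

lemma ab_Hm [simp, intro]: "i < k \<Longrightarrow> a i \<in> Hm" "i < k \<Longrightarrow> b i \<in> Hm"
  and ab_square: "i < k \<Longrightarrow> a i \<otimes> a i = \<one>" "i < k \<Longrightarrow> b i \<otimes> b i = \<one>"
  and ab_sign: "i < k \<Longrightarrow> comm_sign (a i) (b i) = - 1"
  using system unfolding hyperbolic_system_def by auto

lemma ba_sign: "i < k \<Longrightarrow> comm_sign (b i) (a i) = - 1"
  using ab_sign[of i] comm_sign_sym[of "a i" "b i"] by simp

lemma ab_sign_distinct:
  assumes "i < k" "j < k" "i \<noteq> j"
  shows "comm_sign (a i) (a j) = 1" "comm_sign (a i) (b j) = 1"
    "comm_sign (b i) (a j) = 1" "comm_sign (b i) (b j) = 1"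
  using system assms unfolding hyperbolic_system_def by auto

section \<open>Products of the elements of the pairs\<close>

definition unit_at :: "nat \<Rightarrow> int \<times> int \<Rightarrow> 'a"
  where "unit_at i g = (if fst g = 1 then a i else \<one>) \<otimes> (if snd g = 1 then b i else \<one>)"

lemma unit_at_Hm [simp, intro]: "i < k \<Longrightarrow> unit_at i g \<in> Hm"
  by (simp add: unit_at_def)

lemma unit_at_one: "unit_at i (0, 0) = \<one>"
  by (simp add: unit_at_def)

lemma unit_at_sign:
  assumes "i < k" "x \<in> Hm"
  shows "comm_sign (unit_at i g) x =
    (if fst g = 1 then comm_sign (a i) x else 1) * (if snd g = 1 then comm_sign (b i) x else 1)"
  using assms by (simp add: unit_at_def comm_sign_mult_left)

lemma unit_at_distinct:
  assumes "i < k" "j < k" "i \<noteq> j"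
  shows "comm_sign (unit_at i g) (unit_at j h) = 1"
proof -
  have "comm_sign (unit_at i g) (a j) = 1" "comm_sign (unit_at i g) (b j) = 1"
    using assms by (simp_all add: unit_at_sign ab_sign_distinct)
  then have "comm_sign (a j) (unit_at i g) = 1" "comm_sign (b j) (unit_at i g) = 1"
    using assms comm_sign_sym[of "unit_at i g"] by simp_all
  then have "comm_sign (unit_at j h) (unit_at i g) = 1" using assms by (simp add: unit_at_sign)
  then show ?thesis using assms comm_sign_sym[of "unit_at i g"] by simp
qed

lemma unit_at_mult:
  assumes i: "i < k" and g: "g \<in> carrier (Z2 \<times>\<times> Z2)" and h: "h \<in> carrier (Z2 \<times>\<times> Z2)"
  shows "unit_at i g \<otimes> unit_at i h = M2R_coeff g h *\<^sub>R unit_at i (g \<otimes>\<^bsub>Z2 \<times>\<times> Z2\<^esub> h)"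
proof -
  have ba: "b i \<otimes> a i = - (a i \<otimes> b i)" using comm_sign[of "b i" "a i"] ba_sign[OF i] i by simp
  have carr: "a i \<in> carrier X" "b i \<in> carrier X" using i by auto
  \<comment> \<open>Together with associativity these rules bring every product of
    \<open>a i\<close> and \<open>b i\<close> into the normal form in which \<open>a i\<close>
    precedes \<open>b i\<close>.\<close>
  have aa: "a i \<otimes> (a i \<otimes> x) = x" if "x \<in> carrier X" for x
    using ab_square(1)[OF i] carr that by (simp flip: m_assoc)
  have bb: "b i \<otimes> (b i \<otimes> x) = x" if "x \<in> carrier X" for x
    using ab_square(2)[OF i] carr that by (simp flip: m_assoc)
  have bab: "b i \<otimes> (a i \<otimes> x) = - (a i \<otimes> (b i \<otimes> x))" if "x \<in> carrier X" for x
    using ba carr that X_mult_minus(2)[of "a i \<otimes> b i" x] by (simp flip: m_assoc)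
  show ?thesis
    using g h unfolding carrier_Z2_Z2
    by (elim insertE emptyE)
      (simp_all add: unit_at_def M2R_coeff_def ab_square[OF i] carr ba aa bb bab m_assoc)
qed

primrec unit_product :: "nat \<Rightarrow> (nat \<Rightarrow> int \<times> int) \<Rightarrow> 'a"
  where "unit_product 0 d = \<one>"
  | "unit_product (Suc n) d = unit_product n d \<otimes> unit_at n (d n)"

lemma unit_product_Hm [simp, intro]: "n \<le> k \<Longrightarrow> unit_product n d \<in> Hm"
  by (induction n) auto

lemma unit_product_cong: "(\<And>i. i < n \<Longrightarrow> d i = d' i) \<Longrightarrow> unit_product n d = unit_product n d'"
  by (induction n) auto

lemma unit_product_zero: "unit_product n (\<lambda>_. (0, 0)) = \<one>"
  by (induction n) (simp_all add: unit_at_one)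

lemma unit_product_sign:
  assumes "n \<le> k" "x \<in> Hm"
  shows "comm_sign (unit_product n d) x = (\<Prod>i<n. comm_sign (unit_at i (d i)) x)"
  using assms(1) by (induction n) (simp_all add: assms(2) comm_sign_mult_left)

lemma unit_product_mult:
  assumes "n \<le> k" "\<And>i. i < n \<Longrightarrow> d i \<in> carrier (Z2 \<times>\<times> Z2)" "\<And>i. i < n \<Longrightarrow> d' i \<in> carrier (Z2 \<times>\<times> Z2)"
  shows "unit_product n d \<otimes> unit_product n d'
    = (\<Prod>i<n. M2R_coeff (d i) (d' i)) *\<^sub>R unit_product n (\<lambda>i. d i \<otimes>\<^bsub>Z2 \<times>\<times> Z2\<^esub> d' i)"
  using assms
proof (induction n)
  case (Suc n)
  have n: "n \<le> k" "n < k" using Suc.prems by auto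
  let ?p = "unit_product n d" and ?q = "unit_product n d'" and ?u = "unit_at n (d n)" and ?v = "unit_at n (d' n)"
  have "comm_sign ?q ?u = 1"
    using n by (auto simp: unit_product_sign unit_at_distinct intro!: prod.neutral)
  then have comm: "?u \<otimes> ?q = ?q \<otimes> ?u" using n comm_sign_eq_1[of ?q ?u] by simp
  have "(?p \<otimes> ?u) \<otimes> (?q \<otimes> ?v) = ?p \<otimes> (?u \<otimes> ?q) \<otimes> ?v" using n by (simp add: m_assoc)
  also have "\<dots> = (?p \<otimes> ?q) \<otimes> (?u \<otimes> ?v)" unfolding comm using n by (simp add: m_assoc)
  also have "\<dots> = ((\<Prod>i<n. M2R_coeff (d i) (d' i)) * M2R_coeff (d n) (d' n)) *\<^sub>R
      (unit_product n (\<lambda>i. d i \<otimes>\<^bsub>Z2 \<times>\<times> Z2\<^esub> d' i) \<otimes> unit_at n (d n \<otimes>\<^bsub>Z2 \<times>\<times> Z2\<^esub> d' n))"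
    using Suc.IH[OF n(1)] Suc.prems unit_at_mult[OF n(2), of "d n" "d' n"] n by (simp add: mult.commute)
  finally show ?case by simp
qed simp

text \<open>Only slot \<open>j\<close> matters, and there the roles cross: \<open>a j\<close>
  detects the exponent of \<open>b j\<close>, and \<open>b j\<close> that of \<open>a j\<close>. So
  these signs determine \<open>d\<close>.\<close>

lemma unit_product_sign_ab:
  assumes j: "j < k"
  shows "comm_sign (unit_product k d) (a j) = (if snd (d j) = 1 then - 1 else 1)"
    and "comm_sign (unit_product k d) (b j) = (if fst (d j) = 1 then - 1 else 1)"
proof -
  have "comm_sign (unit_at i (d i)) (a j) = (if i = j then if snd (d j) = 1 then - 1 else 1 else 1)"
    "comm_sign (unit_at i (d i)) (b j) = (if i = j then if fst (d j) = 1 then - 1 else 1 else 1)"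
    if "i < k" for i
    using that j by (auto simp: unit_at_sign ab_sign ba_sign ab_sign_distinct)
  then show "comm_sign (unit_product k d) (a j) = (if snd (d j) = 1 then - 1 else 1)"
    "comm_sign (unit_product k d) (b j) = (if fst (d j) = 1 then - 1 else 1)"
    using j by (simp_all add: unit_product_sign)
qed

section \<open>The commutant of the pairs\<close>

abbreviation "S \<equiv> commutant k a b"

lemma S_Hm [simp]: "x \<in> S \<Longrightarrow> x \<in> Hm"
  by (simp add: commutant_def)

lemma S_mult [simp, intro]: "x \<in> S \<Longrightarrow> y \<in> S \<Longrightarrow> x \<otimes> y \<in> S"
  unfolding commutant_def by (auto simp: comm_sign_mult_left)

lemma S_scale [simp, intro]: "x \<in> S \<Longrightarrow> r \<noteq> 0 \<Longrightarrow> r *\<^sub>R x \<in> S"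
  unfolding commutant_def by auto

lemma central_S [simp]: "central x \<Longrightarrow> x \<in> S"
  unfolding commutant_def by auto

lemma S_sign:
  assumes "x \<in> S" "i < k"
  shows "comm_sign x (a i) = 1" "comm_sign x (b i) = 1" "comm_sign (a i) x = 1" "comm_sign (b i) x = 1"
proof -
  show "comm_sign x (a i) = 1" "comm_sign x (b i) = 1" using assms unfolding commutant_def by auto
  then show "comm_sign (a i) x = 1" "comm_sign (b i) x = 1"
    using assms comm_sign_sym[of x] by simp_all
qed

lemma S_unit_product:
  assumes "x \<in> S"
  shows "comm_sign x (unit_product k d) = 1"
proof -
  have "comm_sign (unit_at i (d i)) x = 1" if "i < k" for i
    using assms that by (simp add: unit_at_sign S_sign)
  then have "comm_sign (unit_product k d) x = 1" using assms by (simp add: unit_product_sign)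
  then show ?thesis using comm_sign_sym[of "unit_product k d" x] assms by simp
qed

text \<open>A product p of the \<open>a i\<close>, \<open>b i\<close> can be given the same signs as
  \<open>x\<close> against all of them; then px lies in the commutant. As p^2 is a nonzero scalar,
  \<open>x\<close> is a multiple of p(px).\<close>

lemma decompose:
  assumes x: "x \<in> Hm"
  obtains d s where "d \<in> carrier (Pauli_group k)" "s \<in> S" "x \<in> span {unit_product k d \<otimes> s}"
proof -
  \<comment> \<open>The exponent of \<open>a i\<close> is read from the sign against
    \<open>b i\<close>, and conversely.\<close>
  define d where "d = (\<lambda>i\<in>{..<k}. (if comm_sign x (b i) = 1 then 0 else 1, if comm_sign x (a i) = 1 then 0 else 1) :: int \<times> int)"
  let ?p = "unit_product k d"
  let ?s = "?p \<otimes> x"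
  have d: "d \<in> carrier (Pauli_group k)" by (auto simp: d_def carrier_Z2)
  have s: "?s \<in> S"
    unfolding commutant_def using x comm_sign_cases[OF x]
    by (auto simp: comm_sign_mult_left unit_product_sign_ab d_def)
  have dm: "d i \<in> carrier (Z2 \<times>\<times> Z2)" if "i < k" for i using d that by (auto simp: PiE_iff)
  have "d i \<otimes>\<^bsub>Z2 \<times>\<times> Z2\<^esub> d i = (0, 0)" if "i < k" for i
    using dm[OF that] unfolding carrier_Z2_Z2 by auto
  then have "unit_product k (\<lambda>i. d i \<otimes>\<^bsub>Z2 \<times>\<times> Z2\<^esub> d i) = unit_product k (\<lambda>_. (0, 0))"
    by (rule unit_product_cong)
  also have "\<dots> = \<one>" by (rule unit_product_zero)
  finally have pp: "?p \<otimes> ?p = (\<Prod>i<k. M2R_coeff (d i) (d i)) *\<^sub>R \<one>"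
    using unit_product_mult[of k d d] dm by simp
  have nz: "(\<Prod>i<k. M2R_coeff (d i) (d i)) \<noteq> 0" by (simp add: M2R_coeff_def)
  have "?p \<otimes> ?s = (?p \<otimes> ?p) \<otimes> x" using x by (simp add: m_assoc)
  also have "\<dots> = (\<Prod>i<k. M2R_coeff (d i) (d i)) *\<^sub>R x" using pp x by simp
  finally have "x = (1 / (\<Prod>i<k. M2R_coeff (d i) (d i))) *\<^sub>R (?p \<otimes> ?s)" using nz by simp
  then have "x \<in> span {?p \<otimes> ?s}" unfolding in_span_singleton ..
  then show thesis by (rule that[OF d s])
qed

text \<open>Elements of \<open>S\<close> commute with every \<open>unit_product\<close>, and by
  \<open>decompose\<close> these together with \<open>S\<close> account for all homogeneous
  lines.\<close>

lemma S_radical: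
  assumes s: "s \<in> S" and rad: "\<And>t. t \<in> S \<Longrightarrow> comm_sign s t = 1"
  shows "central s"
proof -
  have "comm_sign s y = 1" if y: "y \<in> Hm" for y
  proof -
    obtain d t where dt: "d \<in> carrier (Pauli_group k)" "t \<in> S" "y \<in> span {unit_product k d \<otimes> t}"
      by (rule decompose[OF y])
    have "comm_sign y s = comm_sign (unit_product k d \<otimes> t) s"
      by (rule comm_sign_span[OF y _ dt(3)]) (use s dt(2) in auto)
    also have "\<dots> = comm_sign s (unit_product k d) * comm_sign s t"
      using s dt(2) comm_sign_sym[of s "unit_product k d \<otimes> t"] by (simp add: comm_sign_mult_right)
    also have "\<dots> = 1" using S_unit_product[OF s] rad[OF dt(2)] by simp
    finally show ?thesis using comm_sign_sym[of s y] s y by simp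
  qed
  then show ?thesis using s unfolding central_def by simp
qed

end

subsection \<open>The classification of the homogeneous lines\<close>

lemma span_singleton_eq:
  assumes "x \<in> span {y}" "x \<noteq> 0"
  shows "span {x} = span {y}"
proof -
  obtain r where r: "x = r *\<^sub>R y" using assms(1) unfolding in_span_singleton ..
  then have "r \<noteq> 0" using assms(2) by auto
  then have "y = (1 / r) *\<^sub>R x" using r by simp
  then have "y \<in> span {x}" unfolding in_span_singleton ..
  then show ?thesis using assms(1) by (intro equalityI span_minimal) auto
qed

context division_lines
begin

text \<open>The counterpart of \<open>Pauli_type\<close> where only the lines of \<open>Hm\<close>
  are available and no degrees.\<close>

definition lines_of_type :: "nat \<Rightarrow> 'i monoid \<Rightarrow> ('i \<Rightarrow> 'i \<Rightarrow> real) \<Rightarrow> bool"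
  where "lines_of_type m G c \<longleftrightarrow> (\<exists>e. twisted_basis X (Pauli_group m \<times>\<times> G) (Pauli_coeff m c) e \<and>
    (\<lambda>x. span {x}) ` Hm = (\<lambda>s. span {e s}) ` carrier (Pauli_group m \<times>\<times> G))"

lemma square_normalize:
  assumes "x \<in> Hm" "x \<otimes> x = r *\<^sub>R \<one>" "r \<noteq> 0"
  obtains q where "q > 0" "(q *\<^sub>R x) \<otimes> (q *\<^sub>R x) = sgn r *\<^sub>R \<one>"
proof -
  define q where "q = 1 / sqrt \<bar>r\<bar>"
  have q: "q > 0" "q * (q * r) = sgn r"
    using assms(3) by (simp_all add: q_def sgn_if)
  show thesis
  proof (rule that[OF q(1)])
    show "(q *\<^sub>R x) \<otimes> (q *\<^sub>R x) = sgn r *\<^sub>R \<one>"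
      unfolding q(2)[symmetric] using assms by simp
  qed
qed

lemma scalar_square_Hm:
  assumes "x \<in> Hm" "scalar (x \<otimes> x)"
  obtains r where "r \<noteq> 0" "x \<otimes> x = r *\<^sub>R \<one>"
  by (rule scalar_Hm[OF assms(2) Hm_mult[OF assms(1,1)]])

lemma mult_in_span:
  assumes "u \<in> span {x}" "v \<in> span {y}" "x \<in> carrier X" "y \<in> carrier X"
  shows "u \<otimes> v \<in> span {x \<otimes> y}"
proof -
  obtain p q where "u = p *\<^sub>R x" "v = q *\<^sub>R y" using assms(1,2) unfolding in_span_singleton by blast
  then have "u \<otimes> v = (p * q) *\<^sub>R (x \<otimes> y)" using assms(3,4) by (simp add: mult.commute)
  then show ?thesis unfolding in_span_singleton ..
qed

end

context hyperbolic
begin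

text \<open>Reduces the classification to the commutant: representatives \<open>w\<close> of its
  lines with structure constants \<open>c\<close>, multiplied by the products of the pairs, give a
  basis of the whole algebra.\<close>

lemma lines_of_typeI:
  assumes G: "group G" "finite (carrier G)"
    and w: "\<And>g. g \<in> carrier G \<Longrightarrow> w g \<in> S"
    and mult: "\<And>g h. g \<in> carrier G \<Longrightarrow> h \<in> carrier G \<Longrightarrow> w g \<otimes> w h = c g h *\<^sub>R w (g \<otimes>\<^bsub>G\<^esub> h)"
    and one: "w \<one>\<^bsub>G\<^esub> = \<one>"
    and full: "\<And>s. s \<in> S \<Longrightarrow> \<exists>g\<in>carrier G. s \<in> span {w g}"
    and ker: "\<And>g. g \<in> carrier G \<Longrightarrow> scalar (w g) \<Longrightarrow> g = \<one>\<^bsub>G\<^esub>"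
  shows "lines_of_type k G c"
proof -
  interpret G: group G by (rule G(1))
  let ?P = "Pauli_group k"
  let ?I = "?P \<times>\<times> G"
  define e where "e = (\<lambda>s. unit_product k (fst s) \<otimes> w (snd s))"
  have mem: "fst s \<in> carrier ?P" "snd s \<in> carrier G" if "s \<in> carrier ?I" for s
    using that unfolding carrier_DirProd[of ?P G] by (simp_all only: mem_Times_iff)
  have w_Hm: "w g \<in> Hm" if "g \<in> carrier G" for g using w[OF that] by simp
  have e_Hm: "e s \<in> Hm" if "s \<in> carrier ?I" for s
    unfolding e_def using w_Hm[OF mem(2)[OF that]] by simp
  \<comment> \<open>Multiplying by \<open>w\<close> at the inverse of \<open>h\<close> turns
    proportionality into being scalar, which \<open>ker\<close> settles.\<close>
  have w_inj: "g = h" if g: "g \<in> carrier G" and h: "h \<in> carrier G" and gh: "w g \<in> span {w h}" for g h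
  proof -
    let ?h = "inv\<^bsub>G\<^esub> h"
    have hinv: "?h \<in> carrier G" using h by simp
    have "w g \<otimes> w ?h \<in> span {w h \<otimes> w ?h}"
      using gh w_Hm[OF h] w_Hm[OF hinv] by (intro mult_in_span) (auto simp: span_base)
    moreover have "scalar (w h \<otimes> w ?h)"
      unfolding scalar_def mult[OF h hinv] G.r_inv[OF h] one by blast
    ultimately have "scalar (w g \<otimes> w ?h)" unfolding in_span_singleton by (auto intro: scalar_scale)
    moreover have "c g ?h \<noteq> 0"
      using mult[OF g hinv] Hm_nonzero[OF Hm_mult[OF w_Hm[OF g] w_Hm[OF hinv]]] by auto
    ultimately have "scalar (w (g \<otimes>\<^bsub>G\<^esub> ?h))" unfolding mult[OF g hinv] by simp
    then have "g \<otimes>\<^bsub>G\<^esub> ?h = \<one>\<^bsub>G\<^esub>" using ker g hinv by blast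
    then have "inv\<^bsub>G\<^esub> ?h = g" using g hinv by (intro G.inv_equality) auto
    then show ?thesis using h by simp
  qed
  have e_inj: "s = t" if s: "s \<in> carrier ?I" and t: "t \<in> carrier ?I" and st: "e s \<in> span {e t}" for s t
  proof -
    note ms = mem[OF s] and mt = mem[OF t]
    have sign: "comm_sign (e s) (a i) = (if snd (fst s i) = 1 then - 1 else 1)"
      "comm_sign (e s) (b i) = (if fst (fst s i) = 1 then - 1 else 1)"
      if "s \<in> carrier ?I" "i < k" for s i
      unfolding e_def using w_Hm[OF mem(2)[OF that(1)]] S_sign[OF w[OF mem(2)[OF that(1)]] that(2)] that(2)
      by (simp_all add: comm_sign_mult_left unit_product_sign_ab)
    \<comment> \<open>Proportional elements have equal signs against all \<open>a i\<close> and
      \<open>b i\<close>, and the factor from \<open>S\<close> does not affect these signs.\<close>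
    have "fst s = fst t"
    proof (rule PiE_ext)
      show "fst s \<in> {..<k} \<rightarrow>\<^sub>E carrier (Z2 \<times>\<times> Z2)" "fst t \<in> {..<k} \<rightarrow>\<^sub>E carrier (Z2 \<times>\<times> Z2)"
        using ms(1) mt(1) unfolding carrier_product_group .
      fix i assume "i \<in> {..<k}"
      then have i: "i < k" by simp
      have "comm_sign (e s) (a i) = comm_sign (e t) (a i)" "comm_sign (e s) (b i) = comm_sign (e t) (b i)"
        using i st e_Hm[OF s] e_Hm[OF t] by (auto intro: comm_sign_span)
      then show "fst s i = fst t i"
        using Pauli_group_at[OF ms(1) i] Pauli_group_at[OF mt(1) i] unfolding carrier_Z2_Z2 sign[OF s i] sign[OF t i]
        by (auto split: if_splits)
    qed
    moreover have "snd s = snd t"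
    proof (rule w_inj[OF ms(2) mt(2)])
      obtain r where "e s = r *\<^sub>R e t" using st unfolding in_span_singleton ..
      then have "unit_product k (fst t) \<otimes> w (snd s) = unit_product k (fst t) \<otimes> (r *\<^sub>R w (snd t))"
        unfolding e_def calculation using w_Hm[OF mt(2)] by simp
      then have "w (snd s) = r *\<^sub>R w (snd t)"
        by (rule Hm_cancel[OF unit_product_Hm[OF order_refl], rotated 2])
          (use w_Hm[OF mt(2)] w_Hm[OF ms(2)] in simp_all)
      then show "w (snd s) \<in> span {w (snd t)}" unfolding in_span_singleton ..
    qed
    ultimately show ?thesis by (rule prod_eqI)
  qed
  have lines: "\<exists>s\<in>carrier ?I. x \<in> span {e s}" if x: "x \<in> Hm" for x
  proof -
    obtain d s where ds: "d \<in> carrier ?P" "s \<in> S" "x \<in> span {unit_product k d \<otimes> s}" by (rule decompose[OF x])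
    obtain g where g: "g \<in> carrier G" "s \<in> span {w g}" using full[OF ds(2)] by blast
    have "unit_product k d \<otimes> s \<in> span {e (d, g)}"
      unfolding e_def fst_conv snd_conv
      by (rule mult_in_span) (use g(2) w_Hm[OF g(1)] in \<open>simp_all add: span_base\<close>)
    then have "span {unit_product k d \<otimes> s} \<subseteq> span {e (d, g)}" by (intro span_minimal) auto
    moreover have "(d, g) \<in> carrier ?I" using ds(1) g(1) unfolding carrier_DirProd[of ?P G] by blast
    ultimately show ?thesis using ds(3) by blast
  qed
  have "twisted_basis X ?I (Pauli_coeff k c) e"
  proof (rule twisted_basis.intro)
    show "finite (carrier ?I)" using G(2) by (simp add: finite_PiE carrier_Z2)
    show "Group.monoid ?I" by (intro group.is_monoid DirProd_group G(1)) simp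
    show "linear_on (carrier X) (\<lambda>y. x \<otimes> y)" "linear_on (carrier X) (\<lambda>y. y \<otimes> x)" if "x \<in> carrier X" for x
      using real_algebraD(3,4)[OF alg that] .
    have "Hm \<subseteq> span (e ` carrier ?I)"
    proof
      fix x assume "x \<in> Hm"
      then obtain s where s: "s \<in> carrier ?I" "x \<in> span {e s}" using lines by blast
      have "span {e s} \<subseteq> span (e ` carrier ?I)" using s(1) by (intro span_mono) blast
      then show "x \<in> span (e ` carrier ?I)" using s(2) by blast
    qed
    then have "carrier X \<subseteq> span (e ` carrier ?I)" unfolding span_Hm[symmetric] by (intro span_minimal) auto
    moreover have "span (e ` carrier ?I) \<subseteq> carrier X"
      by (intro span_minimal subspace_X image_subsetI Hm_carrier e_Hm)
    ultimately show "carrier X = span (e ` carrier ?I)" by (rule equalityI)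
    show "r t = 0" if sum: "(\<Sum>s\<in>carrier ?I. r s *\<^sub>R e s) = 0" and t: "t \<in> carrier ?I" for r t
    proof -
      obtain \<phi> :: "'a \<Rightarrow> real" where \<phi>: "linear \<phi>" "\<phi> (e t) \<noteq> 0" "\<forall>y\<in>Hm. y \<notin> span {e t} \<longrightarrow> \<phi> y = 0"
        using coordinate[OF e_Hm[OF t]] by blast
      \<comment> \<open>\<open>\<phi>\<close> vanishes off the line of \<open>e t\<close>, and by
        \<open>e_inj\<close> other indices give other lines.\<close>
      have "\<phi> (e s) = (if s = t then \<phi> (e t) else 0)" if "s \<in> carrier ?I" for s
        using \<phi>(3) e_Hm[OF that] e_inj[OF that t] by auto
      then have "\<phi> (\<Sum>s\<in>carrier ?I. r s *\<^sub>R e s) = (\<Sum>s\<in>carrier ?I. if s = t then r t * \<phi> (e t) else 0)"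
        unfolding linear_sum[OF \<phi>(1)] linear_scale[OF \<phi>(1)] by (intro sum.cong refl) simp
      also have "\<dots> = r t * \<phi> (e t)"
        using t \<open>finite (carrier ?I)\<close> by (simp only: sum.delta' sum.delta if_True)
      finally show ?thesis using sum \<phi>(2) linear_0[OF \<phi>(1)] by simp
    qed
    show "e s \<otimes> e t = Pauli_coeff k c s t *\<^sub>R e (s \<otimes>\<^bsub>?I\<^esub> t)" if s: "s \<in> carrier ?I" and t: "t \<in> carrier ?I" for s t
    proof -
      note ms = mem[OF s] and mt = mem[OF t]
      let ?p = "unit_product k (fst s)" and ?q = "unit_product k (fst t)" and ?u = "w (snd s)" and ?v = "w (snd t)"
      have Hm: "?p \<in> Hm" "?q \<in> Hm" "?u \<in> Hm" "?v \<in> Hm" using w_Hm[OF ms(2)] w_Hm[OF mt(2)] by simp_all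
      have comm: "?u \<otimes> ?q = ?q \<otimes> ?u"
        using S_unit_product[OF w[OF ms(2)]] comm_sign_eq_1[OF Hm(3,2)] by blast
      have "(?p \<otimes> ?u) \<otimes> (?q \<otimes> ?v) = ?p \<otimes> (?u \<otimes> ?q) \<otimes> ?v" using Hm by (simp add: m_assoc)
      also have "\<dots> = (?p \<otimes> ?q) \<otimes> (?u \<otimes> ?v)" unfolding comm using Hm by (simp add: m_assoc)
      also have "?p \<otimes> ?q = (\<Prod>i<k. M2R_coeff (fst s i) (fst t i)) *\<^sub>R
          unit_product k (\<lambda>i. fst s i \<otimes>\<^bsub>Z2 \<times>\<times> Z2\<^esub> fst t i)"
        by (rule unit_product_mult) (use Pauli_group_at[OF ms(1)] Pauli_group_at[OF mt(1)] in blast)+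
      also have "unit_product k (\<lambda>i. fst s i \<otimes>\<^bsub>Z2 \<times>\<times> Z2\<^esub> fst t i) = unit_product k (fst s \<otimes>\<^bsub>?P\<^esub> fst t)"
        by (rule unit_product_cong) simp
      also have "?u \<otimes> ?v = c (snd s) (snd t) *\<^sub>R w (snd s \<otimes>\<^bsub>G\<^esub> snd t)" by (rule mult[OF ms(2) mt(2)])
      finally show ?thesis
        using w_Hm[OF G.m_closed[OF ms(2) mt(2)]]
        by (simp add: e_def Pauli_coeff_def mult_DirProd'[of ?P G] mult.commute del: mult_product_group)
    qed
    show "\<one> = e \<one>\<^bsub>?I\<^esub>"
    proof -
      have "unit_product k \<one>\<^bsub>?P\<^esub> = unit_product k (\<lambda>_. (0, 0))" by (rule unit_product_cong) simp
      also have "\<dots> = \<one>" by (rule unit_product_zero)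
      finally show ?thesis by (simp add: e_def one del: one_product_group)
    qed
  qed
  moreover have "(\<lambda>x. span {x}) ` Hm = (\<lambda>s. span {e s}) ` carrier ?I"
  proof (intro equalityI subsetI)
    fix L assume "L \<in> (\<lambda>x. span {x}) ` Hm"
    then obtain x where x: "L = span {x}" "x \<in> Hm" by blast
    obtain s where s: "s \<in> carrier ?I" "x \<in> span {e s}" using lines[OF x(2)] by blast
    have "L = span {e s}" unfolding x(1) by (rule span_singleton_eq[OF s(2) Hm_nonzero[OF x(2)]])
    then show "L \<in> (\<lambda>s. span {e s}) ` carrier ?I" using s(1) by blast
  next
    fix L assume "L \<in> (\<lambda>s. span {e s}) ` carrier ?I"
    then show "L \<in> (\<lambda>x. span {x}) ` Hm" using e_Hm by blast
  qed
  ultimately show ?thesis unfolding lines_of_type_def by blast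
qed

end

locale maximal_hyperbolic = hyperbolic +
  assumes maximal: "\<And>x y. x \<in> S \<Longrightarrow> y \<in> S \<Longrightarrow> positive x \<Longrightarrow> positive y \<Longrightarrow> comm_sign x y = 1"
begin

lemma product_square_scalars:
  assumes "x \<in> Hm" "y \<in> Hm" "x \<otimes> x = p *\<^sub>R \<one>" "y \<otimes> y = q *\<^sub>R \<one>"
  shows "(x \<otimes> y) \<otimes> (x \<otimes> y) = (comm_sign x y * (p * q)) *\<^sub>R \<one>"
  unfolding product_square[OF assms(1,2)] assms(3,4) by simp

lemma in_span_of_scalar_product:
  assumes "u \<in> Hm" "v \<in> Hm" "v \<otimes> v = r *\<^sub>R \<one>" "scalar (u \<otimes> v)"
  shows "u \<in> span {v}"
proof -
  have "r \<noteq> 0" using Hm_nonzero[OF Hm_mult[OF assms(2,2)]] assms(3) by auto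
  obtain c where c: "u \<otimes> v = c *\<^sub>R \<one>" using assms(4) unfolding scalar_def ..
  have "r *\<^sub>R u = u \<otimes> (v \<otimes> v)" using assms(1,3) by simp
  also have "\<dots> = (u \<otimes> v) \<otimes> v" using assms(1,2) by (simp add: m_assoc)
  also have "\<dots> = c *\<^sub>R v" using assms(2) c by simp
  finally have "(1 / r) *\<^sub>R r *\<^sub>R u = (1 / r) *\<^sub>R c *\<^sub>R v" by (simp only:)
  then have "u = (1 / r * c) *\<^sub>R v" using \<open>r \<noteq> 0\<close> by simp
  then show ?thesis unfolding in_span_singleton ..
qed

lemma not_central_partner:
  assumes "s \<in> S" "\<not> central s"
  obtains t where "t \<in> S" "comm_sign s t = - 1"
proof -
  obtain t where t: "t \<in> S" "comm_sign s t \<noteq> 1" using S_radical[OF assms(1)] assms(2) by blast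
  then show thesis using that comm_sign_cases[of s t] assms(1) by auto
qed

section \<open>Scalar centre: the commutant is \<open>\<real>\<close> or the quaternions\<close>

lemma lines_of_type_real_scalar:
  assumes S: "\<And>s. s \<in> S \<Longrightarrow> scalar s"
  shows "lines_of_type k (singleton_group ()) trivial_coeff"
proof (rule lines_of_typeI[where w = "\<lambda>_. \<one>"])
  fix s assume "s \<in> S"
  then show "\<exists>g\<in>carrier (singleton_group ()). s \<in> span {\<one>}" using S by (simp add: scalar_span)
qed simp_all

lemma lines_of_type_real_nonscalar:
  assumes centre: "\<And>z. central z \<Longrightarrow> scalar z" and s0: "s0 \<in> S" "\<not> scalar s0"
  shows "lines_of_type k (Z2 \<times>\<times> Z2) HH_coeff"
proof -
  have sq: "scalar (x \<otimes> x)" if "x \<in> Hm" for x using centre central_square that by blast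
  \<comment> \<open>Suppose x^2 > 0. A partner t anticommuting with x has t^2 < 0 by maximality, so
    (xt)^2 = -x^2 t^2 > 0. But xt anticommutes with x as well, which maximality forbids.\<close>
  have negative: "x \<otimes> x = r *\<^sub>R \<one> \<Longrightarrow> r < 0" if x: "x \<in> S" "\<not> scalar x" for x r
  proof (rule ccontr)
    assume r: "x \<otimes> x = r *\<^sub>R \<one>" and "\<not> r < 0"
    have xH: "x \<in> Hm" using x by simp
    have "r \<noteq> 0" using r Hm_nonzero[OF Hm_mult[OF xH xH]] by auto
    then have "r > 0" using \<open>\<not> r < 0\<close> by simp
    have "\<not> central x" using x centre by blast
    then obtain t where t: "t \<in> S" "comm_sign x t = - 1" by (rule not_central_partner[OF x(1)])
    have tH: "t \<in> Hm" using t by simp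
    obtain q where q: "q \<noteq> 0" "t \<otimes> t = q *\<^sub>R \<one>" by (rule scalar_square_Hm[OF tH sq[OF tH]])
    have px: "positive x" using r \<open>r > 0\<close> unfolding positive_def by blast
    have "\<not> positive t" using maximal[OF x(1) t(1) px] t(2) by auto
    then have "q < 0" using q unfolding positive_def by (meson linorder_neqE_linordered_idom)
    have "positive (x \<otimes> t)"
      unfolding positive_def product_square_scalars[OF xH tH r q(2)] t(2)
      using \<open>r > 0\<close> \<open>q < 0\<close> by (intro exI[of _ "- 1 * (r * q)"]) (simp add: mult_pos_neg)
    then have "comm_sign x (x \<otimes> t) = 1" using maximal[OF x(1) _ px] x(1) t(1) by blast
    then show False using xH tH t(2) by (simp add: comm_sign_mult_right)
  qed
  have normal: "\<exists>q>0. (q *\<^sub>R x) \<otimes> (q *\<^sub>R x) = - \<one>" if x: "x \<in> S" "\<not> scalar x" for x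
  proof -
    have xH: "x \<in> Hm" using x by simp
    obtain r where r: "r \<noteq> 0" "x \<otimes> x = r *\<^sub>R \<one>" by (rule scalar_square_Hm[OF xH sq[OF xH]])
    obtain q where q: "q > 0" "(q *\<^sub>R x) \<otimes> (q *\<^sub>R x) = sgn r *\<^sub>R \<one>" by (rule square_normalize[OF xH r(2,1)])
    have "sgn r = - 1" using negative[OF x r(2)] by simp
    then show ?thesis using q by (intro exI[of _ q]) simp
  qed
  have nonscalar: "\<not> scalar x" if "x \<in> S" "y \<in> S" "comm_sign x y = - 1 \<or> comm_sign y x = - 1" for x y
  proof
    assume "scalar x"
    then have "central x" using that by (intro scalar_central) auto
    then show False using that comm_sign_sym[of x y] by auto
  qed
  have "\<not> central s0" using s0 centre by blast
  then obtain t0 where t0: "t0 \<in> S" "comm_sign s0 t0 = - 1" by (rule not_central_partner[OF s0(1)])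
  obtain p where p: "p > 0" "(p *\<^sub>R s0) \<otimes> (p *\<^sub>R s0) = - \<one>" using normal[OF s0] by blast
  obtain q where q: "q > 0" "(q *\<^sub>R t0) \<otimes> (q *\<^sub>R t0) = - \<one>"
    using normal[OF t0(1) nonscalar[OF t0(1) s0(1)]] t0(2) by blast
  define s t where "s = p *\<^sub>R s0" and "t = q *\<^sub>R t0"
  have st: "s \<in> S" "t \<in> S" "s \<otimes> s = - \<one>" "t \<otimes> t = - \<one>" "comm_sign s t = - 1"
    using p q s0(1) t0 by (simp_all add: s_def t_def)
  have H: "s \<in> Hm" "t \<in> Hm" using st by simp_all
  have carr: "s \<in> carrier X" "t \<in> carrier X" using H by simp_all
  have ts_sign: "comm_sign t s = - 1" using st(5) comm_sign_sym[OF H] by simp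
  have ts: "t \<otimes> s = - (s \<otimes> t)" using comm_sign[OF H(2,1)] ts_sign by simp
  have assoc: "s \<otimes> (s \<otimes> x) = - x" "t \<otimes> (t \<otimes> x) = - x" "t \<otimes> (s \<otimes> x) = - (s \<otimes> (t \<otimes> x))"
    if "x \<in> carrier X" for x
  proof -
    show "s \<otimes> (s \<otimes> x) = - x" "t \<otimes> (t \<otimes> x) = - x"
      using that carr st(3,4) by (simp_all flip: m_assoc)
    have "t \<otimes> (s \<otimes> x) = (t \<otimes> s) \<otimes> x" using that carr by (simp add: m_assoc)
    also have "\<dots> = - (s \<otimes> (t \<otimes> x))" unfolding ts using that carr by (simp add: m_assoc)
    finally show "t \<otimes> (s \<otimes> x) = - (s \<otimes> (t \<otimes> x))" .
  qed
  \<comment> \<open>\<open>s\<close>, \<open>t\<close> and \<open>s \<otimes> t\<close> play the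
    parts of i, j and k, in the degrees of \<open>quat_basis\<close>.\<close>
  define w where "w = (\<lambda>g :: int \<times> int. (if fst g = 1 then s else \<one>) \<otimes> (if snd g = 1 then t else \<one>))"
  have one_S: "\<one> \<in> S" by simp
  \<comment> \<open>For commuting \<open>u\<close>, \<open>v\<close> the square of their product is
    a product of two negative numbers, so by \<open>negative\<close> the product must be
    scalar.\<close>
  have member: "u \<in> span {v}" if u: "u \<in> S" "\<not> scalar u" and v: "v \<in> S" "\<not> scalar v" and uv: "comm_sign u v = 1" for u v
  proof -
    have Hm: "u \<in> Hm" "v \<in> Hm" using u v by simp_all
    obtain p where p: "p \<noteq> 0" "u \<otimes> u = p *\<^sub>R \<one>" by (rule scalar_square_Hm[OF Hm(1) sq[OF Hm(1)]])
    obtain q where q: "q \<noteq> 0" "v \<otimes> v = q *\<^sub>R \<one>" by (rule scalar_square_Hm[OF Hm(2) sq[OF Hm(2)]])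
    have "p * q > 0" using negative[OF u p(2)] negative[OF v q(2)] by (simp add: mult_neg_neg)
    then have "scalar (u \<otimes> v)"
      using negative[of "u \<otimes> v", OF _ _ product_square_scalars[OF Hm p(2) q(2)]] u v uv by force
    then show ?thesis by (rule in_span_of_scalar_product[OF Hm q(2)])
  qed
  have stS: "s \<otimes> t \<in> S" using st by simp
  have "comm_sign (s \<otimes> t) t = - 1" using H st(5) by (simp add: comm_sign_mult_left)
  then have ns: "\<not> scalar s" "\<not> scalar t" "\<not> scalar (s \<otimes> t)"
    using nonscalar[OF st(1,2)] nonscalar[OF st(2,1)] nonscalar[OF stS st(2)] st(5) by blast+
  show ?thesis
  proof (rule lines_of_typeI[where w = w])
    show "w g \<otimes> w h = HH_coeff g h *\<^sub>R w (g \<otimes>\<^bsub>Z2 \<times>\<times> Z2\<^esub> h)"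
      if "g \<in> carrier (Z2 \<times>\<times> Z2)" "h \<in> carrier (Z2 \<times>\<times> Z2)" for g h
      using that unfolding carrier_Z2_Z2
      by (elim insertE emptyE) (simp_all add: w_def HH_coeff_def carr st(3,4) ts assoc m_assoc)
    show "\<exists>g\<in>carrier (Z2 \<times>\<times> Z2). u \<in> span {w g}" if u: "u \<in> S" for u
    proof -
      have uH: "u \<in> Hm" using u by simp
      \<comment> \<open>A \<open>u\<close> that anticommutes with both \<open>s\<close> and
        \<open>t\<close> commutes with \<open>s \<otimes> t\<close>, so \<open>member\<close>
        applies in each nonscalar case.\<close>
      consider "scalar u" | "\<not> scalar u" "comm_sign u s = 1" | "\<not> scalar u" "comm_sign u t = 1"
        | "\<not> scalar u" "comm_sign u s = - 1" "comm_sign u t = - 1"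
        using comm_sign_cases[OF uH H(1)] comm_sign_cases[OF uH H(2)] by blast
      then show ?thesis
      proof cases
        case 1
        then have "u \<in> span {w (0, 0)}" by (simp add: w_def scalar_span)
        then show ?thesis unfolding carrier_Z2_Z2 by blast
      next
        case 2
        then have "u \<in> span {w (1, 0)}" using member[OF u _ st(1) ns(1)] carr by (simp add: w_def)
        then show ?thesis unfolding carrier_Z2_Z2 by blast
      next
        case 3
        then have "u \<in> span {w (0, 1)}" using member[OF u _ st(2) ns(2)] carr by (simp add: w_def)
        then show ?thesis unfolding carrier_Z2_Z2 by blast
      next
        case 4
        then have "comm_sign u (s \<otimes> t) = 1" using uH H by (simp add: comm_sign_mult_right)
        then have "u \<in> span {w (1, 1)}" using member[OF u _ stS ns(3)] 4 by (simp add: w_def)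
        then show ?thesis unfolding carrier_Z2_Z2 by blast
      qed
    qed
    show "g = \<one>\<^bsub>Z2 \<times>\<times> Z2\<^esub>" if "g \<in> carrier (Z2 \<times>\<times> Z2)" "scalar (w g)" for g
      using that ns carr unfolding carrier_Z2_Z2 by (elim insertE emptyE) (simp_all add: w_def)
    show "w g \<in> S" for g using st one_S by (simp add: w_def)
    show "finite (carrier (Z2 \<times>\<times> Z2))" unfolding carrier_Z2_Z2 by simp
  qed (simp_all add: w_def)
qed

end

section \<open>Centre spanned by \<open>\<one>\<close> and \<open>f\<close>: the commutant is
  \<open>\<complex>\<close> or \<open>M2C\<close>\<close>

locale complex_maximal_hyperbolic = maximal_hyperbolic +
  fixes f :: 'a
  assumes f_central: "central f" and f_square: "f \<otimes> f = - \<one>"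
begin

lemma f_Hm [simp]: "f \<in> Hm"
  using f_central by simp

lemma f_S [simp]: "f \<in> S"
  using f_central by simp

lemma f_sign [simp]: "x \<in> Hm \<Longrightarrow> comm_sign f x = 1" "x \<in> Hm \<Longrightarrow> comm_sign x f = 1"
  using f_central comm_sign_sym[of f x] by simp_all

lemma f_nonscalar: "\<not> scalar f"
proof
  assume "scalar f"
  then obtain r where r: "f = r *\<^sub>R \<one>" unfolding scalar_def ..
  have "f \<otimes> f = (r * r) *\<^sub>R \<one>" unfolding r by simp
  then have "(r * r) *\<^sub>R \<one> = (- 1) *\<^sub>R \<one>" using f_square by simp
  then have "r * r = - 1" using one_nonzero scaleR_cancel_right by blast
  then show False using zero_le_square[of r] by linarith
qed

lemma square_cases: "x \<in> Hm \<Longrightarrow> scalar (x \<otimes> x) \<or> x \<otimes> x \<in> span {f}"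
  using central_scalar_or_multiple[OF f_central f_square] central_square by blast

lemma span_f_mult:
  assumes "x \<in> span {f}" "y \<in> span {f}"
  shows "scalar (x \<otimes> y)"
proof -
  obtain p q where "x = p *\<^sub>R f" "y = q *\<^sub>R f" using assms unfolding in_span_singleton by blast
  then have "x \<otimes> y = (- (p * q)) *\<^sub>R \<one>" by (simp add: f_square mult.commute)
  then show ?thesis unfolding scalar_def ..
qed

lemma scalar_product_square:
  assumes "x \<in> Hm" "y \<in> Hm" "x \<otimes> x \<in> span {f}" "y \<otimes> y \<in> span {f}"
  shows "scalar ((x \<otimes> y) \<otimes> (x \<otimes> y))"
  unfolding product_square[OF assms(1,2)] by (intro scalar_scale span_f_mult assms)

text \<open>A negative square is repaired by passing to \<open>f \<otimes> x\<close>, which has the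
  same commutation signs because \<open>f\<close> is central.\<close>

lemma adjust_sign:
  assumes x: "x \<in> S" "scalar (x \<otimes> x)"
  obtains x' where "x' \<in> S" "positive x'" "\<forall>y\<in>Hm. comm_sign x' y = comm_sign x y"
proof -
  have xH: "x \<in> Hm" using x by simp
  obtain r where r: "r \<noteq> 0" "x \<otimes> x = r *\<^sub>R \<one>" by (rule scalar_square_Hm[OF xH x(2)])
  show thesis
  proof (cases "r > 0")
    case True
    then have "positive x" using r unfolding positive_def by blast
    then show thesis using that[of x] x by blast
  next
    case False
    have "f \<otimes> f = (- 1) *\<^sub>R \<one>" using f_square by simp
    from product_square_scalars[OF f_Hm xH this r(2)]
    have "(f \<otimes> x) \<otimes> (f \<otimes> x) = (- r) *\<^sub>R \<one>" using xH by simp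
    then have "positive (f \<otimes> x)" using False r(1) unfolding positive_def by (intro exI[of _ "- r"]) simp
    then show thesis using that[of "f \<otimes> x"] x xH by (simp add: comm_sign_mult_left)
  qed
qed

text \<open>Maximality speaks of positive elements only; \<open>adjust_sign\<close> makes both
  positive without touching the sign in question.\<close>

lemma scalar_squares_commute:
  assumes "x \<in> S" "y \<in> S" "scalar (x \<otimes> x)" "scalar (y \<otimes> y)"
  shows "comm_sign x y = 1"
proof -
  obtain x' where x': "x' \<in> S" "positive x'" "\<forall>z\<in>Hm. comm_sign x' z = comm_sign x z"
    by (rule adjust_sign[OF assms(1,3)])
  obtain y' where y': "y' \<in> S" "positive y'" "\<forall>z\<in>Hm. comm_sign y' z = comm_sign y z"
    by (rule adjust_sign[OF assms(2,4)])
  have Hm: "x \<in> Hm" "y \<in> Hm" "x' \<in> Hm" "y' \<in> Hm" using assms x' y' by simp_all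
  have "comm_sign x y = comm_sign y x" by (rule comm_sign_sym[OF Hm(2,1)])
  also have "\<dots> = comm_sign y' x" using y'(3) Hm(1) by simp
  also have "\<dots> = comm_sign x y'" by (rule comm_sign_sym[OF Hm(1,4)])
  also have "\<dots> = comm_sign x' y'" using x'(3) Hm(4) by simp
  also have "\<dots> = 1" by (rule maximal[OF x'(1) y'(1) x'(2) y'(2)])
  finally show ?thesis .
qed

lemma lines_of_type_complex_central:
  assumes S: "\<And>s. s \<in> S \<Longrightarrow> central s"
  shows "lines_of_type k Z2 CC_coeff"
proof (rule lines_of_typeI[where w = "\<lambda>g. if g = 1 then f else \<one>"])
  show "\<exists>g\<in>carrier Z2. s \<in> span {if g = 1 then f else \<one>}" if "s \<in> S" for s
    using central_scalar_or_multiple[OF f_central f_square S[OF that]]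
    unfolding carrier_Z2 by (auto simp: scalar_span)
qed (use f_nonscalar in \<open>auto simp: carrier_Z2 CC_coeff_def f_square\<close>)

text \<open>An anticommuting pair cannot have two scalar squares. If both squares are multiples of
  f, the first element s is replaced by st: its square is -s^2 t^2, a scalar, and it still
  anticommutes with t.\<close>

lemma anticommuting_pair:
  assumes s: "s \<in> S" "\<not> central s"
  obtains x y where "x \<in> S" "y \<in> S" "comm_sign x y = - 1" "scalar (x \<otimes> x)" "y \<otimes> y \<in> span {f}"
proof -
  obtain t where t: "t \<in> S" "comm_sign s t = - 1" by (rule not_central_partner[OF s])
  have Hm: "s \<in> Hm" "t \<in> Hm" using s t by simp_all
  have ts: "comm_sign t s = - 1" using t(2) comm_sign_sym[OF Hm] by simp
  consider "scalar (s \<otimes> s)" "t \<otimes> t \<in> span {f}" | "s \<otimes> s \<in> span {f}" "scalar (t \<otimes> t)"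
    | "s \<otimes> s \<in> span {f}" "t \<otimes> t \<in> span {f}"
    using square_cases[OF Hm(1)] square_cases[OF Hm(2)] scalar_squares_commute[OF s(1) t(1)] t(2) by auto
  then show thesis
  proof cases
    case 1
    then show thesis using that s(1) t by blast
  next
    case 2
    then show thesis using that s(1) t(1) ts by blast
  next
    case 3
    have "comm_sign (s \<otimes> t) t = - 1" using Hm t(2) by (simp add: comm_sign_mult_left)
    then show thesis using that[of "s \<otimes> t" t] s(1) t(1) scalar_product_square[OF Hm 3] 3(2) by blast
  qed
qed

text \<open>After rescaling, $x$ and $y$ satisfy the relations of the generators of $M_2(\mathbb{C})$ of
  degrees $a$ and $b$, with $y^2 = 2 f$.\<close>

lemma lines_of_type_complex_noncentral:
  assumes xy: "x \<in> S" "y \<in> S" "x \<otimes> x = \<one>" "y \<otimes> y = 2 *\<^sub>R f" and sign: "comm_sign x y = - 1"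
  shows "lines_of_type k (Z2 \<times>\<times> Z4) M2C_coeff"
proof -
  have H: "x \<in> Hm" "y \<in> Hm" using xy by simp_all
  have carr: "x \<in> carrier X" "y \<in> carrier X" "f \<in> carrier X" using H by simp_all
  have yx_sign: "comm_sign y x = - 1" using sign comm_sign_sym[OF H] by simp
  have yx: "y \<otimes> x = - (x \<otimes> y)" using comm_sign[OF H(2,1)] yx_sign by simp
  have fx: "x \<otimes> f = f \<otimes> x" "y \<otimes> f = f \<otimes> y"
    using comm_sign_eq_1[OF H(1) f_Hm] comm_sign_eq_1[OF H(2) f_Hm] H by simp_all
  have assoc: "x \<otimes> (x \<otimes> z) = z" "f \<otimes> (f \<otimes> z) = - z" "y \<otimes> (y \<otimes> z) = 2 *\<^sub>R (f \<otimes> z)"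
    "y \<otimes> (x \<otimes> z) = - (x \<otimes> (y \<otimes> z))" "x \<otimes> (f \<otimes> z) = f \<otimes> (x \<otimes> z)" "y \<otimes> (f \<otimes> z) = f \<otimes> (y \<otimes> z)"
    if z: "z \<in> carrier X" for z
  proof -
    have m: "u \<otimes> (v \<otimes> z) = (u \<otimes> v) \<otimes> z" if "u \<in> carrier X" "v \<in> carrier X" for u v
      using that z by (simp add: m_assoc)
    show "x \<otimes> (x \<otimes> z) = z" "f \<otimes> (f \<otimes> z) = - z" "y \<otimes> (y \<otimes> z) = 2 *\<^sub>R (f \<otimes> z)"
      "x \<otimes> (f \<otimes> z) = f \<otimes> (x \<otimes> z)" "y \<otimes> (f \<otimes> z) = f \<otimes> (y \<otimes> z)"
      by (simp_all add: m carr z xy(3,4) f_square fx)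
    have "y \<otimes> (x \<otimes> z) = - ((x \<otimes> y) \<otimes> z)" by (simp add: m carr z yx)
    then show "y \<otimes> (x \<otimes> z) = - (x \<otimes> (y \<otimes> z))" using carr z by (simp add: m_assoc)
  qed
  \<comment> \<open>Follows \<open>M2C_basis\<close>, where B^2 / 2 = i and B^3 / 2 = iB: second
    degrees 2 and 3 carry a factor \<open>f\<close>, odd ones a factor \<open>y\<close>.\<close>
  define w where "w = (\<lambda>g :: int \<times> int. (if fst g = 1 then x else \<one>) \<otimes>
    ((if 2 \<le> snd g then f else \<one>) \<otimes> (if odd (snd g) then y else \<one>)))"
  have one_S: "\<one> \<in> S" by simp
  have wS: "w g \<in> S" for g using xy(1,2) one_S by (simp add: w_def)
  have wH: "w g \<in> Hm" for g using wS by simp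
  have w_sign: "comm_sign (w g) x = (if odd (snd g) then - 1 else 1)"
    "comm_sign (w g) y = (if fst g = 1 then - 1 else 1)" for g
    using H sign yx_sign by (simp_all add: w_def comm_sign_mult_left)
  have w_mult: "w g \<otimes> w h = M2C_coeff g h *\<^sub>R w (g \<otimes>\<^bsub>Z2 \<times>\<times> Z4\<^esub> h)"
    if "g \<in> carrier (Z2 \<times>\<times> Z4)" "h \<in> carrier (Z2 \<times>\<times> Z4)" for g h
    using that unfolding carrier_Z2_Z4
    by (elim insertE emptyE)
      (simp_all add: w_def M2C_coeff_def carr xy(3,4) f_square yx fx assoc m_assoc)
  \<comment> \<open>Shows that \<open>x\<close>, \<open>y\<close> and the centre exhaust the
    commutant up to scalars: what commutes with \<open>x\<close> and \<open>y\<close> commutes with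
    all of \<open>S\<close>.\<close>
  have central_if: "central s" if s: "s \<in> S" and sx: "comm_sign s x = 1" and sy: "comm_sign s y = 1" for s
  proof (rule S_radical[OF s])
    fix t assume t: "t \<in> S"
    have Hm: "s \<in> Hm" "t \<in> Hm" using s t by simp_all
    \<comment> \<open>Multiplication by \<open>x\<close> makes \<open>t\<close> commute with
      \<open>y\<close> and keeps its sign against \<open>s\<close>, because \<open>s\<close>
      commutes with \<open>x\<close>.\<close>
    define t1 where "t1 = (if comm_sign t y = 1 then t else x \<otimes> t)"
    have t1: "t1 \<in> S" "comm_sign t1 y = 1" "comm_sign s t1 = comm_sign s t"
      using t xy(1) H Hm sx sign comm_sign_cases[OF Hm(2) H(2)]
      by (auto simp: t1_def comm_sign_mult_left comm_sign_mult_right)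
    have t1H: "t1 \<in> Hm" using t1 by simp
    \<comment> \<open>If the square of \<open>z\<close> is a multiple of \<open>f\<close>,
      multiplying by \<open>y\<close> makes it scalar. Both \<open>s\<close> and \<open>t1\<close>
      commute with \<open>y\<close>, so their mutual sign is unchanged and
      \<open>scalar_squares_commute\<close> applies.\<close>
    define adj where "adj = (\<lambda>z. if scalar (z \<otimes> z) then z else z \<otimes> y)"
    have adj: "adj z \<in> S" "scalar (adj z \<otimes> adj z)" if "z \<in> S" for z
      using that xy(2) scalar_product_square[of z y] square_cases[of z] H
      by (auto simp: adj_def xy(4) in_span_singleton)
    have ys: "comm_sign y t1 = 1" using t1(2) comm_sign_sym[OF t1H H(2)] by simp
    have "comm_sign (adj s) (adj t1) = comm_sign s t1"
      using Hm t1H H sy ys by (simp add: adj_def comm_sign_mult_left comm_sign_mult_right)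
    moreover have "comm_sign (adj s) (adj t1) = 1"
      by (rule scalar_squares_commute[OF adj(1)[OF s] adj(1)[OF t1(1)] adj(2)[OF s] adj(2)[OF t1(1)]])
    ultimately show "comm_sign s t = 1" using t1(3) by simp
  qed
  interpret T: group "Z2 \<times>\<times> Z4" by (rule group_Z2_Z4)
  have full: "\<exists>g\<in>carrier (Z2 \<times>\<times> Z4). s \<in> span {w g}" if s: "s \<in> S" for s
  proof -
    have sH: "s \<in> Hm" using s by simp
    \<comment> \<open>The signs against \<open>y\<close> and \<open>x\<close> prescribe the
      exponents of \<open>x\<close> and \<open>y\<close>. Then \<open>w g \<otimes> s\<close>
      commutes with both, so it is central and lies on the line of \<open>w (0, 0)\<close> or
      \<open>w (0, 2)\<close>; exponents 0 and 1 of \<open>y\<close> suffice because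
      \<open>f\<close> is central.\<close>
    define g :: "int \<times> int" where "g = (if comm_sign s y = 1 then 0 else 1, if comm_sign s x = 1 then 0 else 1)"
    have g: "g \<in> carrier (Z2 \<times>\<times> Z4)" by (simp add: g_def carrier_Z2 carrier_Z4)
    let ?i = "inv\<^bsub>Z2 \<times>\<times> Z4\<^esub> g"
    have i: "?i \<in> carrier (Z2 \<times>\<times> Z4)" by (rule T.inv_closed[OF g])
    have "central (w g \<otimes> s)"
    proof (rule central_if)
      show "w g \<otimes> s \<in> S" using wS s by simp
      show "comm_sign (w g \<otimes> s) x = 1" "comm_sign (w g \<otimes> s) y = 1"
        using wH sH H comm_sign_cases[OF sH H(1)] comm_sign_cases[OF sH H(2)]
        by (auto simp: comm_sign_mult_left w_sign g_def)
    qed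
    then have "scalar (w g \<otimes> s) \<or> w g \<otimes> s \<in> span {f}"
      by (rule central_scalar_or_multiple[OF f_central f_square])
    moreover have "w (0, 0) = \<one>" "w (0, 2) = f" using carr by (simp_all add: w_def)
    ultimately obtain h where h: "h \<in> carrier (Z2 \<times>\<times> Z4)" "w g \<otimes> s \<in> span {w h}"
      unfolding scalar_span carrier_Z2_Z4 by (metis insertI1 insertI2)
    have "w ?i \<otimes> (w g \<otimes> s) \<in> span {w ?i \<otimes> w h}"
      by (rule mult_in_span[OF _ h(2)]) (use wH in \<open>simp_all add: span_base\<close>)
    also have "w ?i \<otimes> w h = M2C_coeff ?i h *\<^sub>R w (?i \<otimes>\<^bsub>Z2 \<times>\<times> Z4\<^esub> h)" by (rule w_mult[OF i h(1)])
    also have "w ?i \<otimes> (w g \<otimes> s) = (w ?i \<otimes> w g) \<otimes> s" using wH sH by (simp add: m_assoc)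
    also have "w ?i \<otimes> w g = M2C_coeff ?i g *\<^sub>R \<one>"
      using w_mult[OF i g] T.l_inv[OF g] carr by (simp add: w_def)
    finally have "M2C_coeff ?i g *\<^sub>R s \<in> span {M2C_coeff ?i h *\<^sub>R w (?i \<otimes>\<^bsub>Z2 \<times>\<times> Z4\<^esub> h)}"
      using sH by simp
    then obtain r where "M2C_coeff ?i g *\<^sub>R s = r *\<^sub>R M2C_coeff ?i h *\<^sub>R w (?i \<otimes>\<^bsub>Z2 \<times>\<times> Z4\<^esub> h)"
      unfolding in_span_singleton ..
    then have "(1 / M2C_coeff ?i g) *\<^sub>R M2C_coeff ?i g *\<^sub>R s
        = (1 / M2C_coeff ?i g) *\<^sub>R r *\<^sub>R M2C_coeff ?i h *\<^sub>R w (?i \<otimes>\<^bsub>Z2 \<times>\<times> Z4\<^esub> h)"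
      by (simp only:)
    moreover have "M2C_coeff ?i g \<noteq> 0" by (simp add: M2C_coeff_def)
    ultimately have "s = (1 / M2C_coeff ?i g * r * M2C_coeff ?i h) *\<^sub>R w (?i \<otimes>\<^bsub>Z2 \<times>\<times> Z4\<^esub> h)"
      by simp
    then have "s \<in> span {w (?i \<otimes>\<^bsub>Z2 \<times>\<times> Z4\<^esub> h)}" unfolding in_span_singleton ..
    then show ?thesis using T.m_closed[OF i h(1)] by blast
  qed
  show ?thesis
  proof (rule lines_of_typeI[where w = w])
    show "g = \<one>\<^bsub>Z2 \<times>\<times> Z4\<^esub>" if "g \<in> carrier (Z2 \<times>\<times> Z4)" "scalar (w g)" for g
    proof -
      have "central (w g)" by (rule scalar_central[OF that(2) wH])
      then have "comm_sign (w g) x = 1" "comm_sign (w g) y = 1" using H by simp_all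
      then have "even (snd g)" "fst g \<noteq> 1" unfolding w_sign by (auto split: if_splits)
      then show ?thesis
        using that f_nonscalar carr unfolding carrier_Z2_Z4 by (elim insertE emptyE) (simp_all add: w_def)
    qed
    show "finite (carrier (Z2 \<times>\<times> Z4))" unfolding carrier_Z2_Z4 by simp
    show "w \<one>\<^bsub>Z2 \<times>\<times> Z4\<^esub> = \<one>" by (simp add: w_def)
  qed (use wS w_mult full in blast)+
qed

end

context division_lines
begin

lemma classification_of_lines:
  obtains m where "lines_of_type m (singleton_group ()) trivial_coeff"
  | m where "lines_of_type m (Z2 \<times>\<times> Z2) HH_coeff"
  | m where "lines_of_type m Z2 CC_coeff"
  | m where "lines_of_type m (Z2 \<times>\<times> Z4) M2C_coeff"
proof -
  obtain k a b where kab: "hyperbolic_system k a b"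
    "\<And>x y. x \<in> commutant k a b \<Longrightarrow> y \<in> commutant k a b \<Longrightarrow> positive x \<Longrightarrow> positive y \<Longrightarrow> comm_sign x y = 1"
    by (rule maximal_hyperbolic_system) blast
  interpret maximal_hyperbolic X Hm k a b
    by unfold_locales (use kab in blast)+
  show thesis
  proof (cases "\<forall>z. central z \<longrightarrow> scalar z")
    case True
    show thesis
    proof (cases "\<forall>s\<in>S. scalar s")
      case True
      then show thesis using that(1) lines_of_type_real_scalar by blast
    next
      case False
      then show thesis using that(2) lines_of_type_real_nonscalar True by blast
    qed
  next
    case False
    then obtain z where z: "central z" "\<not> scalar z" by blast
    obtain r where r: "r > 0" "(r *\<^sub>R z) \<otimes> (r *\<^sub>R z) = - \<one>" by (rule central_nonscalar_normalize[OF z])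
    interpret C: complex_maximal_hyperbolic X Hm k a b "r *\<^sub>R z"
      by unfold_locales (use r central_scale[OF z(1)] in auto)
    let ?f = "r *\<^sub>R z"
    show thesis
    proof (cases "\<forall>s\<in>S. central s")
      case True
      then show thesis using that(3) C.lines_of_type_complex_central by blast
    next
      case False
      then obtain s where s: "s \<in> S" "\<not> central s" by blast
      obtain x0 y0 where xy: "x0 \<in> S" "y0 \<in> S" "comm_sign x0 y0 = - 1" "scalar (x0 \<otimes> x0)" "y0 \<otimes> y0 \<in> span {?f}"
        by (rule C.anticommuting_pair[OF s])
      have H: "x0 \<in> Hm" "y0 \<in> Hm" using xy by simp_all
      obtain x1 where x1: "x1 \<in> S" "positive x1" "\<forall>y\<in>Hm. comm_sign x1 y = comm_sign x0 y"
        by (rule C.adjust_sign[OF xy(1,4)])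
      have x1H: "x1 \<in> Hm" using x1 by simp
      obtain p where p: "p > 0" "(p *\<^sub>R x1) \<otimes> (p *\<^sub>R x1) = \<one>" by (rule positive_normalize[OF x1(2) x1H])
      obtain l where l: "y0 \<otimes> y0 = l *\<^sub>R ?f" using xy(5) unfolding in_span_singleton ..
      have "l \<noteq> 0" using l Hm_nonzero[OF Hm_mult[OF H(2,2)]] by auto
      \<comment> \<open>The target is a square equal to 2f, as for \<open>M2C_basis (0, 1)\<close>.
        Scaling \<open>y0\<close> can fix the size of \<open>l\<close> but not its sign, so a
        negative sign is absorbed by replacing \<open>?f\<close> with its negative.\<close>
      define q where "q = sqrt (2 / \<bar>l\<bar>)"
      have q: "q > 0" "q * (q * l) = 2 * sgn l"
        using \<open>l \<noteq> 0\<close> by (simp_all add: q_def sgn_if flip: mult.assoc)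
      have sgn: "sgn l * sgn l = 1" "sgn l \<noteq> 0" using \<open>l \<noteq> 0\<close> by (simp_all add: sgn_if)
      let ?f' = "sgn l *\<^sub>R ?f"
      have "(u *\<^sub>R v) \<otimes> (u *\<^sub>R v) = (u * u) *\<^sub>R (v \<otimes> v)" if "v \<in> Hm" for u v
        using that by simp
      from this[OF C.f_Hm, of "sgn l"] have f': "?f' \<otimes> ?f' = - \<one>" unfolding sgn r(2) by simp
      interpret C': complex_maximal_hyperbolic X Hm k a b ?f'
        by unfold_locales (use f' central_scale[OF C.f_central sgn(2)] in auto)
      have "(q *\<^sub>R y0) \<otimes> (q *\<^sub>R y0) = (q * (q * l)) *\<^sub>R ?f" using H l by simp
      then have "(q *\<^sub>R y0) \<otimes> (q *\<^sub>R y0) = 2 *\<^sub>R ?f'" unfolding q(2) by simp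
      moreover have "comm_sign (p *\<^sub>R x1) (q *\<^sub>R y0) = - 1"
        using p q x1H H x1(3) xy(3) by simp
      ultimately have "lines_of_type k (Z2 \<times>\<times> Z4) M2C_coeff"
        using C'.lines_of_type_complex_noncentral[of "p *\<^sub>R x1" "q *\<^sub>R y0"] p q x1(1) xy(2) by simp
      then show thesis by (rule that(4))
    qed
  qed
qed

end

section \<open>From gradings to homogeneous lines\<close>

text \<open>Independence of homogeneous elements of distinct degrees comes from uniqueness of the
  decomposition; finite dimension then bounds the support, and one-dimensional components become the
  lines of \<open>Hm\<close>.\<close>

lemma division_grading_lines:
  fixes X :: "('a::real_vector, 'g) graded_algebra"
  assumes comm: "comm_group (grading_group X)" and div: "division_grading X"
    and simple: "simple_algebra X" and fin: "finite_dim_algebra X"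
    and dim: "\<forall>g\<in>support X. dim (component X g) = 1"
  defines "Hm \<equiv> {x. x \<noteq> 0 \<and> (\<exists>g\<in>carrier (grading_group X). x \<in> component X g)}"
  shows "division_lines X Hm" "component X ` support X = (\<lambda>x. span {x}) ` Hm"
proof -
  let ?G = "carrier (grading_group X)"
  have graded: "is_graded_algebra X" using div unfolding division_grading_def by blast
  have alg: "real_algebra X" and group: "group (grading_group X)"
    and comp: "\<And>g. g \<in> ?G \<Longrightarrow> subspace (component X g) \<and> component X g \<subseteq> carrier X"
    and decomp: "\<And>x. x \<in> carrier X \<Longrightarrow> \<exists>!f. (\<forall>g\<in>?G. f g \<in> component X g) \<and>
        (\<forall>g. g \<notin> ?G \<longrightarrow> f g = 0) \<and> finite {g. f g \<noteq> 0} \<and> x = (\<Sum>g | f g \<noteq> 0. f g)"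
    and mult: "\<And>g h x y. g \<in> ?G \<Longrightarrow> h \<in> ?G \<Longrightarrow> x \<in> component X g \<Longrightarrow> y \<in> component X h \<Longrightarrow>
        x \<otimes>\<^bsub>X\<^esub> y \<in> component X (g \<otimes>\<^bsub>grading_group X\<^esub> h)"
    using graded unfolding is_graded_algebra_def by blast+
  \<comment> \<open>Names the decomposition property so that uniqueness can be applied to explicit
    families.\<close>
  define D where "D x f \<longleftrightarrow> (\<forall>g\<in>?G. f g \<in> component X g) \<and> (\<forall>g. g \<notin> ?G \<longrightarrow> f g = 0) \<and>
      finite {g. f g \<noteq> 0} \<and> x = (\<Sum>g | f g \<noteq> 0. f g)" for x f
  have decomp_unique: "f = f'" if "x \<in> carrier X" "D x f" "D x f'" for x f f'
    using decomp[OF that(1), folded D_def] that(2,3) by blast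
  interpret X: Group.monoid X by (rule real_algebraD(1)[OF alg])
  interpret G: comm_group "grading_group X" by (rule comm)
  have unit: "x \<in> Units X" if "x \<in> Hm" for x
    using that div unfolding Hm_def division_grading_def by blast
  have line: "component X g = span {x}" if x: "x \<noteq> 0" "x \<in> component X g" and g: "g \<in> ?G" for g x
  proof -
    have "g \<in> support X" using x g unfolding support_def by blast
    then have "dim (component X g) = 1" using dim by blast
    moreover obtain B where B: "B \<subseteq> component X g" "independent B" "component X g \<subseteq> span B" "card B = dim (component X g)"
      using basis_exists by blast
    ultimately obtain y where y: "B = {y}" by (metis card_1_singletonE)
    have "component X g = span {y}"
      using B(1,3) comp[OF g] span_minimal[of "{y}" "component X g"] unfolding y by blast
    then show ?thesis using span_singleton_eq[of x y] x by simp
  qed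
  have zero_comp: "0 \<in> component X g" if "g \<in> ?G" for g using comp[OF that] subspace_0 by blast
  have degree_unique: "g = h" if "x \<noteq> 0" "x \<in> component X g" "x \<in> component X h" "g \<in> ?G" "h \<in> ?G" for g h x
  proof -
    have "x \<in> carrier X" using comp that by blast
    moreover have "D x (\<lambda>i. if i = j then x else 0)" if "x \<in> component X j" "j \<in> ?G" for j
    proof -
      have "{i. (if i = j then x else 0) \<noteq> 0} = {j}" using \<open>x \<noteq> 0\<close> by auto
      then show ?thesis unfolding D_def using that zero_comp by auto
    qed
    ultimately have "(\<lambda>i. if i = g then x else 0) = (\<lambda>i. if i = h then x else 0)"
      using that by (intro decomp_unique[of x]) blast+
    then show ?thesis using \<open>x \<noteq> 0\<close> by (metis (full_types))
  qed
  have "\<exists>e. \<forall>g\<in>support X. e g \<in> component X g \<and> e g \<noteq> 0"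
  proof (rule bchoice, rule ballI)
    fix g assume "g \<in> support X"
    then have "g \<in> ?G" "component X g \<noteq> {0}" unfolding support_def by auto
    then show "\<exists>x. x \<in> component X g \<and> x \<noteq> 0" using zero_comp by blast
  qed
  then obtain e where e: "\<And>g. g \<in> support X \<Longrightarrow> e g \<in> component X g" "\<And>g. g \<in> support X \<Longrightarrow> e g \<noteq> 0"
    by blast
  have supp: "g \<in> ?G" if "g \<in> support X" for g using that unfolding support_def by blast
  have e_inj: "inj_on e (support X)"
    by (rule inj_onI) (metis e supp degree_unique)
  \<comment> \<open>A linear relation is a second decomposition of \<open>0\<close>, so it equals
    the zero family.\<close>
  have indep: "independent (e ` F)" if F: "F \<subseteq> support X" "finite F" for F
  proof (rule independent_if_scalars_zero)
    show "finite (e ` F)" using F by simp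
    fix r x assume sum: "(\<Sum>x\<in>e ` F. r x *\<^sub>R x) = 0" and x: "x \<in> e ` F"
    let ?f = "\<lambda>g. if g \<in> F then r (e g) *\<^sub>R e g else 0"
    have inj: "inj_on e F" using e_inj F(1) by (rule inj_on_subset)
    have sub: "{g. ?f g \<noteq> 0} \<subseteq> F" by auto
    have "(\<Sum>g | ?f g \<noteq> 0. ?f g) = (\<Sum>g\<in>F. ?f g)"
      using F(2) sub by (intro sum.mono_neutral_left) auto
    also have "\<dots> = (\<Sum>g\<in>F. r (e g) *\<^sub>R e g)" by simp
    also have "\<dots> = 0" using sum by (simp add: sum.reindex[OF inj])
    finally have f_sum: "0 = (\<Sum>g | ?f g \<noteq> 0. ?f g)" by (rule sym)
    have f_comp: "?f g \<in> component X g" if "g \<in> ?G" for g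
    proof (cases "g \<in> F")
      case True
      then have "r (e g) *\<^sub>R e g \<in> component X g"
        using comp[OF that] e(1) F(1) by (intro subspace_scale) auto
      then show ?thesis using True by simp
    qed (simp add: zero_comp[OF that])
    have f_out: "?f g = 0" if "g \<notin> ?G" for g using that F(1) supp by auto
    have f_fin: "finite {g. ?f g \<noteq> 0}" by (rule finite_subset[OF sub F(2)])
    have "0 \<in> carrier X" using real_algebraD(2)[OF alg] by (rule subspace_0)
    moreover have "D 0 ?f" unfolding D_def by (intro conjI ballI allI impI f_comp f_out f_fin f_sum)
    moreover have "D 0 (\<lambda>_. 0)" unfolding D_def using zero_comp by simp
    ultimately have "?f = (\<lambda>_. 0)" by (rule decomp_unique)
    moreover obtain g where g: "g \<in> F" "x = e g" using x by blast
    ultimately have "r (e g) *\<^sub>R e g = 0" by (metis (full_types))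
    then show "r x = 0" using e(2) g F(1) by auto
  qed
  obtain B where B: "finite B" "span B = carrier X" using fin unfolding finite_dim_algebra_def by blast
  have fin_supp: "finite (support X)"
  proof (rule ccontr)
    assume "infinite (support X)"
    then obtain F where F: "F \<subseteq> support X" "finite F" "card F = Suc (card B)"
      using infinite_arbitrarily_large by blast
    have "e ` F \<subseteq> span B" unfolding B(2) using e(1) F(1) supp comp by blast
    then have "card (e ` F) \<le> card B" using independent_span_bound[OF B(1) indep[OF F(1,2)]] by blast
    then show False using F(3) card_image[OF inj_on_subset[OF e_inj F(1)]] by simp
  qed
  have sub: "subspace (carrier X)" by (rule real_algebraD(2)[OF alg])
  have Hm_mult: "x \<otimes>\<^bsub>X\<^esub> y \<in> Hm" if x: "x \<in> Hm" and y: "y \<in> Hm" for x y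
  proof -
    obtain g h where gh: "g \<in> ?G" "h \<in> ?G" "x \<in> component X g" "y \<in> component X h"
      using x y unfolding Hm_def by blast
    have y_car: "y \<in> carrier X" using gh comp by blast
    have "x \<otimes>\<^bsub>X\<^esub> y \<noteq> 0"
    proof
      assume "x \<otimes>\<^bsub>X\<^esub> y = 0"
      also have "0 = x \<otimes>\<^bsub>X\<^esub> 0"
        using linear_on_zero[OF real_algebraD(3)[OF alg, of x] sub] X.Units_closed[OF unit[OF x]] by simp
      finally have "y = 0"
        using X.Units_l_cancel[OF unit[OF x] y_car subspace_0[OF sub]] by blast
      then show False using y unfolding Hm_def by blast
    qed
    then show ?thesis using mult[OF gh] gh(1,2) unfolding Hm_def by blast
  qed
  show lines: "component X ` support X = (\<lambda>x. span {x}) ` Hm"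
  proof (intro equalityI subsetI)
    fix L assume "L \<in> component X ` support X"
    then obtain g where g: "g \<in> support X" "L = component X g" by blast
    have "L = span {e g}" unfolding g(2) by (rule line[OF e(2)[OF g(1)] e(1)[OF g(1)] supp[OF g(1)]])
    moreover have "e g \<in> Hm" unfolding Hm_def using e[OF g(1)] supp[OF g(1)] by blast
    ultimately show "L \<in> (\<lambda>x. span {x}) ` Hm" by blast
  next
    fix L assume "L \<in> (\<lambda>x. span {x}) ` Hm"
    then obtain x g where x: "L = span {x}" "x \<noteq> 0" "g \<in> ?G" "x \<in> component X g" unfolding Hm_def by blast
    have "L = component X g" unfolding x(1) by (rule line[OF x(2,4,3), symmetric])
    moreover have "g \<in> support X" unfolding support_def using x(2-4) by blast
    ultimately show "L \<in> component X ` support X" by blast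
  qed
  show "division_lines X Hm"
  proof (rule division_lines.intro)
    show "real_algebra X" by (rule alg)
    show "simple_algebra X" by (rule simple)
    show "x \<in> Units X" if "x \<in> Hm" for x by (rule unit[OF that])
    show "x \<noteq> 0" if "x \<in> Hm" for x using that unfolding Hm_def by blast
    show "x \<otimes>\<^bsub>X\<^esub> y \<in> Hm" if "x \<in> Hm" "y \<in> Hm" for x y by (rule Hm_mult[OF that])
    show "r *\<^sub>R x \<in> Hm" if "x \<in> Hm" "r \<noteq> 0" for x and r :: real
      using that comp unfolding Hm_def by (auto intro: subspace_scale)
    show "span Hm = carrier X"
    proof (rule equalityI)
      show "span Hm \<subseteq> carrier X" by (intro span_minimal sub) (use comp in \<open>auto simp: Hm_def\<close>)
      have "\<Union>(component X ` support X) \<subseteq> span Hm"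
      proof
        fix x assume "x \<in> \<Union>(component X ` support X)"
        then show "x \<in> span Hm"
          using supp by (cases "x = 0") (auto simp: Hm_def span_zero intro!: span_base)
      qed
      then have "span (\<Union>(component X ` support X)) \<subseteq> span Hm" by (intro span_minimal subspace_span)
      then show "carrier X \<subseteq> span Hm" using graded_algebra_span_components[OF graded] by blast
    qed
    show "finite ((\<lambda>x. span {x}) ` Hm)" unfolding lines[symmetric] using fin_supp by simp
    \<comment> \<open>Here commutativity of the grading group enters: both products lie in the same
      one-dimensional component.\<close>
    show "\<exists>r. x \<otimes>\<^bsub>X\<^esub> y = r *\<^sub>R (y \<otimes>\<^bsub>X\<^esub> x)" if x: "x \<in> Hm" and y: "y \<in> Hm" for x y
    proof -
      obtain g h where gh: "g \<in> ?G" "h \<in> ?G" "x \<in> component X g" "y \<in> component X h"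
        using x y unfolding Hm_def by blast
      have "y \<otimes>\<^bsub>X\<^esub> x \<in> component X (g \<otimes>\<^bsub>grading_group X\<^esub> h)"
        using mult[OF gh(2,1,4,3)] G.m_comm[OF gh(1,2)] by simp
      moreover have "y \<otimes>\<^bsub>X\<^esub> x \<noteq> 0" using Hm_mult[OF y x] unfolding Hm_def by blast
      ultimately have "component X (g \<otimes>\<^bsub>grading_group X\<^esub> h) = span {y \<otimes>\<^bsub>X\<^esub> x}"
        using line gh(1,2) by blast
      then show ?thesis using mult[OF gh] unfolding in_span_singleton[symmetric] by blast
    qed
    show "\<exists>\<phi>::'a \<Rightarrow> real. linear \<phi> \<and> \<phi> x \<noteq> 0 \<and> (\<forall>y\<in>Hm. y \<notin> span {x} \<longrightarrow> \<phi> y = 0)" if x: "x \<in> Hm" for x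
    proof -
      obtain g where g: "g \<in> ?G" "x \<in> component X g" "x \<noteq> 0" using x unfolding Hm_def by blast
      have gs: "g \<in> support X" using g unfolding support_def by blast
      obtain \<phi> :: "'a \<Rightarrow> real" where \<phi>: "linear \<phi>" "\<forall>z\<in>e ` support X. \<phi> z = (if z = e g then 1 else 0)"
        using linear_independent_extend[OF indep[OF order_refl fin_supp], of "\<lambda>z. if z = e g then 1 else 0"] by blast
      have "e g \<in> span {x}" using line[OF g(3,2,1)] e(1)[OF gs] by blast
      then obtain r where r: "e g = r *\<^sub>R x" unfolding in_span_singleton ..
      have "r * \<phi> x = 1" using \<phi>(2) gs linear_scale[OF \<phi>(1), of r x] r by auto
      then have "\<phi> x \<noteq> 0" by auto
      moreover have "\<phi> y = 0" if y: "y \<in> Hm" "y \<notin> span {x}" for y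
      proof -
        obtain h where h: "h \<in> ?G" "y \<in> component X h" "y \<noteq> 0" using y unfolding Hm_def by blast
        have hs: "h \<in> support X" using h unfolding support_def by blast
        have "h \<noteq> g" using y(2) line[OF g(3,2,1)] h(2) by blast
        then have "e h \<noteq> e g" using e_inj gs hs by (auto dest: inj_onD)
        then have "\<phi> (e h) = 0" using \<phi>(2) hs by auto
        moreover have "y \<in> span {e h}" using line[OF e(2)[OF hs] e(1)[OF hs] h(1)] h(2) by blast
        ultimately show ?thesis using linear_scale[OF \<phi>(1)] by (auto simp: in_span_singleton)
      qed
      ultimately show ?thesis using \<phi>(1) by blast
    qed
  qed
qed

lemma graded_equivalent_to_item:
  fixes X :: "('a::real_vector, 'g) graded_algebra"
  assumes "comm_group (grading_group X)" "division_grading X" "simple_algebra X" "finite_dim_algebra X"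
    "\<forall>g\<in>support X. dim (component X g) = 1"
  shows "\<exists>k. equivalent_to_item X k"
proof -
  define Hm where "Hm = {x. x \<noteq> 0 \<and> (\<exists>g\<in>carrier (grading_group X). x \<in> component X g)}"
  note lines = division_grading_lines[OF assms, folded Hm_def]
  interpret division_lines X Hm by (rule lines(1))
  have type: "Pauli_type X m G c" if "lines_of_type m G c" for m c and G :: "'i monoid"
    using that unfolding Pauli_type_def lines_of_type_def lines(2) .
  show ?thesis
  proof (rule classification_of_lines)
    fix m assume "lines_of_type m (singleton_group ()) trivial_coeff"
    from Pauli_type_equivalent[OF type[OF this] Pauli_type_model_a]
    have "equivalent_to_item X (Item_a m)" by simp
    then show ?thesis ..
  next
    fix m assume "lines_of_type m (Z2 \<times>\<times> Z2) HH_coeff"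
    \<comment> \<open>The index of \<open>model_b\<close> counts the quaternion factor as well, so
      \<open>m\<close> copies of \<open>M2R\<close> belong to \<open>Suc m\<close>;
      \<open>model_d\<close> likewise counts its last factor.\<close>
    from Pauli_type_equivalent[OF type[OF this], of "model_b (Suc m)"] Pauli_type_model_b[of "Suc m"]
    have "equivalent_to_item X (Item_b (Suc m))" by simp
    then show ?thesis ..
  next
    fix m assume "lines_of_type m Z2 CC_coeff"
    from Pauli_type_equivalent[OF type[OF this] Pauli_type_model_c]
    have "equivalent_to_item X (Item_c m)" by simp
    then show ?thesis ..
  next
    fix m assume "lines_of_type m (Z2 \<times>\<times> Z4) M2C_coeff"
    from Pauli_type_equivalent[OF type[OF this], of "model_d (Suc m)"] Pauli_type_model_d[of "Suc m"]
    have "equivalent_to_item X (Item_d (Suc m))" by simp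
    then show ?thesis ..
  qed
qed

section \<open>Numerical invariants of the items\<close>

definition square_sum :: "('a::real_vector, 'g) graded_algebra \<Rightarrow> (real \<Rightarrow> real) \<Rightarrow> real"
  where "square_sum X h = (\<Sum>L\<in>component X ` support X. h (square_sign X L))"

text \<open>The value of \<open>square_sign\<close> on the line of index \<open>g\<close>, as
  computed in \<open>square_sign_line\<close>.\<close>

definition index_sign :: "'i monoid \<Rightarrow> ('i \<Rightarrow> 'i \<Rightarrow> real) \<Rightarrow> 'i \<Rightarrow> real"
  where "index_sign G c g = (if g \<otimes>\<^bsub>G\<^esub> g = \<one>\<^bsub>G\<^esub> then sgn (c g g) else 0)"

lemma card_index_groups:
  "card (carrier (Z2 \<times>\<times> Z2)) = 4" "card (carrier Z2) = 2" "card (carrier (Z2 \<times>\<times> Z4)) = 8"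
  "finite (carrier (Z2 \<times>\<times> Z2))" "finite (carrier Z2)" "finite (carrier (Z2 \<times>\<times> Z4))"
  unfolding carrier_Z2_Z2 carrier_Z2_Z4 carrier_Z2 by simp_all

text \<open>The sums factor over the slots. \<open>M2R\<close> has four lines, three with a square
  root of 1 and one with a square root of -1, so each slot contributes 4 to the counts and 3 - 1 = 2
  to the sum of signs.\<close>

lemma square_sum_Pauli:
  assumes X: "is_graded_algebra X" and eq: "graded_equivalent X Y" and Y: "Pauli_type Y m G c"
    and G: "finite (carrier G)"
  shows "square_sum X (\<lambda>_. 1) = 4 ^ m * real (card (carrier G))"
    and "square_sum X (\<lambda>x. x) = 2 ^ m * (\<Sum>g\<in>carrier G. index_sign G c g)"
    and "square_sum X abs = 4 ^ m * (\<Sum>g\<in>carrier G. \<bar>index_sign G c g\<bar>)"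
proof -
  let ?P = "carrier (Pauli_group m)"
  let ?\<pi> = "\<lambda>d. \<Prod>i<m. M2R_coeff (d i) (d i)"
  obtain e where e: "twisted_basis Y (Pauli_group m \<times>\<times> G) (Pauli_coeff m c) e"
    "component Y ` support Y = (\<lambda>s. span {e s}) ` carrier (Pauli_group m \<times>\<times> G)"
    using Y unfolding Pauli_type_def by blast
  have sq: "d \<otimes>\<^bsub>Pauli_group m\<^esub> d = \<one>\<^bsub>Pauli_group m\<^esub>" if "d \<in> ?P" for d
  proof -
    have "d i \<otimes>\<^bsub>Z2 \<times>\<times> Z2\<^esub> d i = \<one>\<^bsub>Z2 \<times>\<times> Z2\<^esub>" if "i < m" for i
      using Pauli_group_at[OF \<open>d \<in> ?P\<close> that] unfolding carrier_Z2_Z2 by auto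
    then show ?thesis unfolding mult_product_group one_product_group by (intro restrict_ext) simp
  qed
  have pi: "?\<pi> d = 1 \<or> ?\<pi> d = - 1" for d
  proof -
    have "\<bar>?\<pi> d\<bar> = 1" unfolding abs_prod by (rule prod.neutral) (simp add: M2R_coeff_def)
    then show ?thesis by linarith
  qed
  have sgn_pi: "sgn (?\<pi> d) = ?\<pi> d" "\<bar>?\<pi> d\<bar> = 1" for d using pi[of d] by auto
  have sum: "square_sum X h = (\<Sum>d\<in>?P. \<Sum>g\<in>carrier G. h (?\<pi> d * index_sign G c g))" for h
  proof -
    have "square_sum X h = (\<Sum>s\<in>carrier (Pauli_group m \<times>\<times> G).
        h (if s \<otimes>\<^bsub>Pauli_group m \<times>\<times> G\<^esub> s = \<one>\<^bsub>Pauli_group m \<times>\<times> G\<^esub> then sgn (Pauli_coeff m c s s) else 0))"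
      unfolding square_sum_def by (rule sum_square_sign[OF X eq e])
    also have "\<dots> = (\<Sum>s\<in>?P \<times> carrier G. h (?\<pi> (fst s) * index_sign G c (snd s)))"
      unfolding carrier_DirProd[of "Pauli_group m" G]
    proof (rule sum.cong[OF refl])
      fix s assume "s \<in> ?P \<times> carrier G"
      then obtain d g where s: "s = (d, g)" "d \<in> ?P" by blast
      show "h (if s \<otimes>\<^bsub>Pauli_group m \<times>\<times> G\<^esub> s = \<one>\<^bsub>Pauli_group m \<times>\<times> G\<^esub> then sgn (Pauli_coeff m c s s) else 0)
        = h (?\<pi> (fst s) * index_sign G c (snd s))"
        unfolding s(1) mult_DirProd[of "Pauli_group m" G] one_DirProd[of "Pauli_group m" G] sq[OF s(2)]
        by (simp add: index_sign_def Pauli_coeff_def sgn_mult sgn_pi)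
    qed
    also have "\<dots> = (\<Sum>d\<in>?P. \<Sum>g\<in>carrier G. h (?\<pi> d * index_sign G c g))"
      by (simp add: sum.cartesian_product split_def)
    finally show ?thesis .
  qed
  have "card ?P = (\<Prod>i<m. card (carrier (Z2 \<times>\<times> Z2)))"
    unfolding carrier_product_group by (rule card_PiE) simp
  also have "\<dots> = 4 ^ m" unfolding card_index_groups by simp
  finally have card_P: "real (card ?P) = 4 ^ m" by simp
  have "(\<Sum>d\<in>?P. ?\<pi> d) = (\<Prod>i<m. \<Sum>g\<in>carrier (Z2 \<times>\<times> Z2). M2R_coeff g g)"
    unfolding carrier_product_group
    by (rule prod_sum_PiE[symmetric]) (simp_all add: carrier_Z2)
  also have "(\<Sum>g\<in>carrier (Z2 \<times>\<times> Z2). M2R_coeff g g) = 2"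
    unfolding carrier_Z2_Z2 by (simp add: M2R_coeff_def)
  finally have sum_pi: "(\<Sum>d\<in>?P. ?\<pi> d) = 2 ^ m" by simp
  show "square_sum X (\<lambda>_. 1) = 4 ^ m * real (card (carrier G))"
    unfolding sum by (simp add: card_P del: carrier_product_group)
  show "square_sum X (\<lambda>x. x) = 2 ^ m * (\<Sum>g\<in>carrier G. index_sign G c g)"
    unfolding sum sum_pi[symmetric] by (simp only: sum_product)
  show "square_sum X abs = 4 ^ m * (\<Sum>g\<in>carrier G. \<bar>index_sign G c g\<bar>)"
    unfolding sum by (simp add: abs_mult sgn_pi card_P del: carrier_product_group)
qed

text \<open>For the quaternions 1 - 3 = -2. For \<open>Z2 \<times>\<times> Z4\<close> the four
  degrees with odd second entry have nontrivial square and count 0; the other four contribute each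
  sign twice.\<close>

lemma index_sign_sums:
  "(\<Sum>g\<in>carrier (singleton_group ()). index_sign (singleton_group ()) trivial_coeff g) = 1"
  "(\<Sum>g\<in>carrier (singleton_group ()). \<bar>index_sign (singleton_group ()) trivial_coeff g\<bar>) = 1"
  "(\<Sum>g\<in>carrier (Z2 \<times>\<times> Z2). index_sign (Z2 \<times>\<times> Z2) HH_coeff g) = - 2"
  "(\<Sum>g\<in>carrier (Z2 \<times>\<times> Z2). \<bar>index_sign (Z2 \<times>\<times> Z2) HH_coeff g\<bar>) = 4"
  "(\<Sum>g\<in>carrier Z2. index_sign Z2 CC_coeff g) = 0"
  "(\<Sum>g\<in>carrier Z2. \<bar>index_sign Z2 CC_coeff g\<bar>) = 2"
  "(\<Sum>g\<in>carrier (Z2 \<times>\<times> Z4). index_sign (Z2 \<times>\<times> Z4) M2C_coeff g) = 0"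
  "(\<Sum>g\<in>carrier (Z2 \<times>\<times> Z4). \<bar>index_sign (Z2 \<times>\<times> Z4) M2C_coeff g\<bar>) = 4"
  unfolding carrier_Z2_Z2 carrier_Z2_Z4 carrier_Z2
  by (simp_all add: index_sign_def singleton_group_def HH_coeff_def CC_coeff_def M2C_coeff_def)

text \<open>The number of homogeneous components, and the numbers of those containing a square root of
  $1$ and of $-1$, distinguish the items; they are encoded in three sums over the components.\<close>

lemma square_sum_item:
  assumes X: "is_graded_algebra X" and eq: "equivalent_to_item X k"
  shows "(square_sum X (\<lambda>_. 1), square_sum X (\<lambda>x. x), square_sum X abs) = (case k of
      Item_a m \<Rightarrow> (4 ^ m, 2 ^ m, 4 ^ m) | Item_b m \<Rightarrow> (4 ^ m, - (2 ^ m), 4 ^ m)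
    | Item_c m \<Rightarrow> (2 * 4 ^ m, 0, 2 * 4 ^ m) | Item_d m \<Rightarrow> (2 * 4 ^ m, 0, 4 ^ m))"
proof (cases k)
  case (Item_a m)
  then have "graded_equivalent X (model_a m)" using eq by simp
  from square_sum_Pauli[OF X this Pauli_type_model_a] show ?thesis
    unfolding index_sign_sums by (simp add: Item_a)
next
  case (Item_b m)
  then have "graded_equivalent X (model_b m)" and "m \<ge> 1" using eq by simp_all
  then obtain n where n: "m = Suc n" by (cases m) auto
  from square_sum_Pauli[OF X \<open>graded_equivalent X (model_b m)\<close> Pauli_type_model_b card_index_groups(4)] show ?thesis
    unfolding index_sign_sums card_index_groups by (simp add: Item_b n)
next
  case (Item_c m)
  then have "graded_equivalent X (model_c m)" using eq by simp
  from square_sum_Pauli[OF X this Pauli_type_model_c card_index_groups(5)] show ?thesis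
    unfolding index_sign_sums card_index_groups by (simp add: Item_c)
next
  case (Item_d m)
  then have "graded_equivalent X (model_d m)" and "m \<ge> 1" using eq by simp_all
  then obtain n where n: "m = Suc n" by (cases m) auto
  from square_sum_Pauli[OF X \<open>graded_equivalent X (model_d m)\<close> Pauli_type_model_d card_index_groups(6)] show ?thesis
    unfolding index_sign_sums card_index_groups by (simp add: Item_d n)
qed

text \<open>The second sum is positive for (1-a), negative for (1-b), zero otherwise; (1-c) and
  (1-d) differ in whether the third sum equals the first or half of it. Within an item the first sum
  gives the index.\<close>

lemma item_unique:
  assumes X: "is_graded_algebra X" and "equivalent_to_item X k" "equivalent_to_item X l"
  shows "k = l"
proof -
  have pos: "(2::real) ^ m > 0" "(4::real) ^ m > 0" for m by simp_all
  have neg: "(2::real) ^ m \<noteq> - (2 ^ n)" "- ((2::real) ^ m) \<noteq> 2 ^ n" for m n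
    using pos(1)[of m] pos(1)[of n] by linarith+
  have half: "\<not> (2 * 4 ^ m = (2 * 4 ^ n :: real) \<and> 2 * 4 ^ m = (4 ^ n :: real))"
    "\<not> (2 * 4 ^ m = (2 * 4 ^ n :: real) \<and> 4 ^ m = (2 * 4 ^ n :: real))" for m n
    using pos(2)[of m] pos(2)[of n] by linarith+
  show ?thesis
    using square_sum_item[OF X assms(2)] square_sum_item[OF X assms(3)] neg half
    by (cases k; cases l) auto
qed

theorem theorem2p5:
  shows "(\<forall>X :: ('a::real_vector, 'g) graded_algebra.
            comm_group (grading_group X) \<and> division_grading X \<and>
            simple_algebra X \<and> finite_dim_algebra X \<and>
            (\<forall>g\<in>support X. dim (component X g) = 1)
            \<longrightarrow> (\<exists>!k. equivalent_to_item X k))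
    \<and> (\<forall>m n :: nat. n = 2 ^ m \<longrightarrow>
          algebras_isomorphic (model_a m) (matrix_algebra n RR) \<and>
          grading_group (model_a m) \<cong> product_group {..<m} (\<lambda>_. Z2 \<times>\<times> Z2) \<and>
          grading_group (model_a m) \<cong> product_group {..<2 * m} (\<lambda>_. Z2))
    \<and> (\<forall>m n :: nat. m \<ge> 1 \<and> n = 2 ^ m \<longrightarrow>
          algebras_isomorphic (model_b m) (matrix_algebra (n div 2) HH) \<and>
          grading_group (model_b m) \<cong> product_group {..<m} (\<lambda>_. Z2 \<times>\<times> Z2) \<and>
          grading_group (model_b m) \<cong> product_group {..<2 * m} (\<lambda>_. Z2))
    \<and> (\<forall>m n :: nat. n = 2 ^ m \<longrightarrow>
          algebras_isomorphic (model_c m) (matrix_algebra n CC) \<and>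
          grading_group (model_c m) \<cong> product_group {..<m} (\<lambda>_. Z2 \<times>\<times> Z2) \<times>\<times> Z2 \<and>
          grading_group (model_c m) \<cong> product_group {..<2 * m + 1} (\<lambda>_. Z2))
    \<and> (\<forall>m n :: nat. m \<ge> 1 \<and> n = 2 ^ m \<longrightarrow>
          algebras_isomorphic (model_d m) (matrix_algebra n CC) \<and>
          grading_group (model_d m) \<cong> product_group {..<m - 1} (\<lambda>_. Z2 \<times>\<times> Z2) \<times>\<times> (Z2 \<times>\<times> Z4) \<and>
          grading_group (model_d m) \<cong> product_group {..<2 * m - 1} (\<lambda>_. Z2) \<times>\<times> Z4)"
proof (intro conjI allI impI)
  fix X :: "('a, 'g) graded_algebra"
  assume X: "comm_group (grading_group X) \<and> division_grading X \<and> simple_algebra X \<and> finite_dim_algebra X \<and>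
    (\<forall>g\<in>support X. dim (component X g) = 1)"
  then have "\<exists>k. equivalent_to_item X k" by (intro graded_equivalent_to_item) blast+
  moreover have "is_graded_algebra X" using X unfolding division_grading_def by blast
  ultimately show "\<exists>!k. equivalent_to_item X k" using item_unique by blast
next
  fix m n :: nat
  assume n: "n = 2 ^ m"
  show "algebras_isomorphic (model_a m) (matrix_algebra n RR)" unfolding n by (rule model_a_matrix_algebra)
  show "grading_group (model_a m) \<cong> Pauli_group m" unfolding grading_group_models by (rule iso_refl)
  show "grading_group (model_a m) \<cong> product_group {..<2 * m} (\<lambda>_. Z2)"
    unfolding grading_group_models by (rule product_group_squares)
  show "algebras_isomorphic (model_c m) (matrix_algebra n CC)" unfolding n by (rule model_c_matrix_algebra)
  show "grading_group (model_c m) \<cong> Pauli_group m \<times>\<times> Z2" unfolding grading_group_models by (rule iso_refl)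
  show "grading_group (model_c m) \<cong> product_group {..<2 * m + 1} (\<lambda>_. Z2)"
    unfolding grading_group_models by (rule product_group_squares_Z2)
next
  fix m n :: nat
  assume mn: "m \<ge> 1 \<and> n = 2 ^ m"
  then have n: "n = 2 ^ m" and m: "m \<ge> 1" "m = Suc (m - 1)" by simp_all
  show "algebras_isomorphic (model_b m) (matrix_algebra (n div 2) HH)"
    unfolding n by (rule model_b_matrix_algebra[OF m(1)])
  \<comment> \<open>The grading group of the quaternion factor is absorbed as the last of
    \<open>m\<close> copies of \<open>Z2 \<times>\<times> Z2\<close>.\<close>
  have "product_group {..<Suc (m - 1)} (\<lambda>_. Z2 \<times>\<times> Z2) \<cong> Pauli_group (m - 1) \<times>\<times> (Z2 \<times>\<times> Z2)"
    by (rule product_group_Suc)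
  then have "Pauli_group m \<cong> Pauli_group (m - 1) \<times>\<times> (Z2 \<times>\<times> Z2)" unfolding m(2)[symmetric] .
  then have b: "grading_group (model_b m) \<cong> Pauli_group m"
    unfolding grading_group_models by (rule group.iso_sym[rotated]) simp
  then show "grading_group (model_b m) \<cong> Pauli_group m" .
  show "grading_group (model_b m) \<cong> product_group {..<2 * m} (\<lambda>_. Z2)"
    by (rule iso_trans[OF b product_group_squares])
  show "algebras_isomorphic (model_d m) (matrix_algebra n CC)"
    unfolding n by (rule model_d_matrix_algebra[OF m(1)])
  show "grading_group (model_d m) \<cong> Pauli_group (m - 1) \<times>\<times> (Z2 \<times>\<times> Z4)"
    unfolding grading_group_models by (rule iso_refl)
  have "2 * (m - 1) + 1 = 2 * m - 1" using m(1) by simp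
  then show "grading_group (model_d m) \<cong> product_group {..<2 * m - 1} (\<lambda>_. Z2) \<times>\<times> Z4"
    unfolding grading_group_models using product_group_squares_Z2_Z4[of "m - 1"] by simp
qed

end
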